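(* For any $p\in\mathcal{S}_n\subseteq\mathbb{P}(\bigwedge^nV_{+})$ we have $$\dim(T_p^s\mathcal{S}_n)=\frac{1}{2}\sum_{k=1}^{s}\binom{n}{k}\left(\binom{n}{k}+1\right)-\sum_{k=1}^{\lceil\frac{s}{2}\rceil}\binom{n}{2k-1}$$ for $1\leq s\leq 2\lfloor\frac{n}{2}\rfloor-1$, while $T_p^s\mathcal{S}_n=\mathbb{P}(\bigwedge^nV_{+})$ for $s\geq 2\lfloor\frac{n}{2}\rfloor$.
   Context: Everything is over $\mathbb{C}$. $V$ is a complex vector space of dimension $2n$ with a non-degenerate quadratic form $Q$. The variety of $n$-dimensional $Q$-isotropic subspaces of $V$ has two isomorphic connected components; the Spinor variety $\mathcal{S}_n$ is either one of them, of dimension $\frac{n(n-1)}{2}$. Here $\mathcal{S}_n\subset\mathcal{G}(n,V)\subset\mathbb{P}(\bigwedge^nV)$ is considered in the Plücker embedding, and $\mathbb{P}(\bigwedge^nV_{+})\subseteq\mathbb{P}(\bigwedge^nV)$ is its linear span. For an irreducible variety $X\subset\mathbb{P}^N$ of dimension $m$, a smooth point $p\in X$, and a local parametrization $\phi:\mathcal{U}\subseteq\mathbb{C}^m\to\mathbb{C}^N$ of $X$ near $p$ with $\phi(0)=p$, the $s$-osculating space $T_p^sX$ is the projective closure in $\mathbb{P}^N$ of the affine subspace of $\mathbb{C}^N$ through $p$ whose direction is spanned by all partial derivatives of $\phi$ at $0$ of order at most $s$. Dimensions are projective dimensions. *)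

theory Defs
  imports "HOL-Analysis.Analysis" "HOL-Library.Function_Algebras"
begin

section \<open>Complex vector spaces of functions\<close>

text \<open>
  All projective geometry below takes place inside a linear subspace \<open>E\<close> of the complex vector
  space \<^typ>\<open>'a \<Rightarrow> complex\<close>, with pointwise operations and the topology of pointwise
  convergence.  If \<open>E\<close> is finite-dimensional, its subspace topology is the usual (Euclidean)
  topology of a finite-dimensional complex vector space.
\<close>

definition fscale :: "complex \<Rightarrow> ('a \<Rightarrow> complex) \<Rightarrow> 'a \<Rightarrow> complex" where
  "fscale c f = (\<lambda>a. c * f a)"

global_interpretation cfun: vector_space fscale
  by unfold_locales (auto simp: fscale_def fun_eq_iff algebra_simps)


section \<open>Projective space\<close>

abbreviation line :: "('a \<Rightarrow> complex) \<Rightarrow> ('a \<Rightarrow> complex) set" where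
  "line x \<equiv> cfun.span {x}"

text \<open>The points of \<open>\<P>(E)\<close> are the one-dimensional subspaces of \<open>E\<close>.\<close>

definition proj_space :: "('a \<Rightarrow> complex) set \<Rightarrow> ('a \<Rightarrow> complex) set set" where
  "proj_space E = line ` (E - {0})"

text \<open>The quotient topology under \<open>E - {0} \<rightarrow> \<P>(E)\<close>.\<close>

definition proj_topology :: "('a \<Rightarrow> complex) set \<Rightarrow> ('a \<Rightarrow> complex) set topology" where
  "proj_topology E = topology (\<lambda>\<U>. \<U> \<subseteq> proj_space E \<and>
     openin (top_of_set (E - {0})) {x \<in> E - {0}. line x \<in> \<U>})"

lemma openin_proj_topology:
  "openin (proj_topology E) \<U> \<longleftrightarrow> \<U> \<subseteq> proj_space E \<and>
     openin (top_of_set (E - {0})) {x \<in> E - {0}. line x \<in> \<U>}"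
proof -
  have "istopology (\<lambda>\<U>. \<U> \<subseteq> proj_space E \<and>
     openin (top_of_set (E - {0})) {x \<in> E - {0}. line x \<in> \<U>})"
    unfolding istopology_def
  proof (intro conjI allI impI)
    fix \<U> \<V>
    assume "\<U> \<subseteq> proj_space E \<and> openin (top_of_set (E - {0})) {x \<in> E - {0}. line x \<in> \<U>}"
      and "\<V> \<subseteq> proj_space E \<and> openin (top_of_set (E - {0})) {x \<in> E - {0}. line x \<in> \<V>}"
    moreover have "{x \<in> E - {0}. line x \<in> \<U> \<inter> \<V>} =
        {x \<in> E - {0}. line x \<in> \<U>} \<inter> {x \<in> E - {0}. line x \<in> \<V>}" by blast
    ultimately show "\<U> \<inter> \<V> \<subseteq> proj_space E"
      and "openin (top_of_set (E - {0})) {x \<in> E - {0}. line x \<in> \<U> \<inter> \<V>}"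
      by (auto intro: openin_Int)
  next
    fix \<K> :: "('a \<Rightarrow> complex) set set set"
    assume K: "\<forall>\<U>\<in>\<K>. \<U> \<subseteq> proj_space E \<and>
      openin (top_of_set (E - {0})) {x \<in> E - {0}. line x \<in> \<U>}"
    then show "\<Union>\<K> \<subseteq> proj_space E" by blast
    have "{x \<in> E - {0}. line x \<in> \<Union>\<K>} = \<Union>((\<lambda>\<U>. {x \<in> E - {0}. line x \<in> \<U>}) ` \<K>)" by blast
    then show "openin (top_of_set (E - {0})) {x \<in> E - {0}. line x \<in> \<Union>\<K>}"
      using K by (auto intro!: openin_Union)
  qed
  then show ?thesis
    unfolding proj_topology_def by (simp add: topology_inverse')
qed

text \<open>The smallest projective linear subspace containing a set \<open>X\<close> of points.\<close>

definition linear_span :: "('a \<Rightarrow> complex) set set \<Rightarrow> ('a \<Rightarrow> complex) set set" where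
  "linear_span X = proj_space (cfun.span (\<Union>X))"

text \<open>
  Projective dimension of a projective linear subspace \<open>T\<close>: the union of the lines in \<open>T\<close> is the
  underlying vector space if \<open>T\<close> is nonempty, and the empty subspace has dimension \<open>-1\<close>.
\<close>

definition proj_dim :: "('a \<Rightarrow> complex) set set \<Rightarrow> int" where
  "proj_dim T = int (cfun.dim (\<Union>T)) - 1"


section \<open>Local parametrizations and osculating spaces\<close>

text \<open>\<open>\<complex>\<^sup>m\<close>, with the same convention as \<^const>\<open>Euclidean_space\<close>.\<close>

definition complex_coord_space :: "nat \<Rightarrow> (nat \<Rightarrow> complex) set" where
  "complex_coord_space m = {z. \<forall>i\<ge>m. z i = 0}"

definition partial ::
    "nat \<Rightarrow> ((nat \<Rightarrow> complex) \<Rightarrow> 'a \<Rightarrow> complex) \<Rightarrow> (nat \<Rightarrow> complex) \<Rightarrow> 'a \<Rightarrow> complex" where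
  "partial i \<phi> = (\<lambda>z a. deriv (\<lambda>t. \<phi> (z(i := t)) a) (z i))"

text \<open>\<open>partials [i\<^sub>1, \<dots>, i\<^sub>k] \<phi>\<close> is the partial derivative of order \<open>k\<close> with respect to the
  coordinates \<open>i\<^sub>1, \<dots>, i\<^sub>k\<close>.\<close>

definition partials ::
    "nat list \<Rightarrow> ((nat \<Rightarrow> complex) \<Rightarrow> 'a \<Rightarrow> complex) \<Rightarrow> (nat \<Rightarrow> complex) \<Rightarrow> 'a \<Rightarrow> complex" where
  "partials is \<phi> = foldr partial is \<phi>"

text \<open>Holomorphy in several variables: continuous and holomorphic in each variable separately.\<close>

definition holomorphic_map ::
    "nat \<Rightarrow> (nat \<Rightarrow> complex) set \<Rightarrow> ((nat \<Rightarrow> complex) \<Rightarrow> 'a \<Rightarrow> complex) \<Rightarrow> bool" where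
  "holomorphic_map m U \<phi> \<longleftrightarrow> continuous_on U \<phi> \<and>
     (\<forall>z\<in>U. \<forall>i<m. \<forall>a. (\<lambda>t. \<phi> (z(i := t)) a) field_differentiable at (z i))"

text \<open>
  A local parametrization \<open>\<phi> : U \<subseteq> \<complex>\<^sup>m \<rightarrow> \<complex>\<^sup>N\<close> of \<open>X \<subseteq> \<P>(E)\<close> near \<open>p\<close>, where \<open>X\<close> has dimension
  \<open>m\<close>.  The affine chart \<open>\<complex>\<^sup>N \<subseteq> \<P>(E)\<close> is the affine hyperplane \<open>{x \<in> E. h x = 1}\<close> for a linear
  functional \<open>h\<close>, which is identified with the complement of \<open>h = 0\<close> in \<open>\<P>(E)\<close> by \<open>x \<mapsto> line x\<close>.
  The map \<open>\<phi>\<close> is a holomorphic immersion into this chart and, followed by the inclusion into \<open>\<P>(E)\<close>,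
  a homeomorphism from \<open>U\<close> onto an open neighbourhood of \<open>p\<close> in \<open>X\<close>.
\<close>

definition local_parametrization ::
    "('a \<Rightarrow> complex) set \<Rightarrow> nat \<Rightarrow> ('a \<Rightarrow> complex) set set \<Rightarrow> ('a \<Rightarrow> complex) set \<Rightarrow>
     (('a \<Rightarrow> complex) \<Rightarrow> complex) \<Rightarrow> (nat \<Rightarrow> complex) set \<Rightarrow>
     ((nat \<Rightarrow> complex) \<Rightarrow> 'a \<Rightarrow> complex) \<Rightarrow> bool" where
  "local_parametrization E m X p h U \<phi> \<longleftrightarrow>
     Vector_Spaces.linear fscale (*) h \<and>
     openin (top_of_set (complex_coord_space m)) U \<and> 0 \<in> U \<and>
     (\<forall>z\<in>U. \<phi> z \<in> E \<and> h (\<phi> z) = 1) \<and>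
     holomorphic_map m U \<phi> \<and>
     (\<forall>z\<in>U. cfun.dim ((\<lambda>i. partial i \<phi> z) ` {..<m}) = m) \<and>
     line (\<phi> 0) = p \<and>
     openin (subtopology (proj_topology E) X) ((\<lambda>z. line (\<phi> z)) ` U) \<and>
     homeomorphic_map (top_of_set U)
       (subtopology (proj_topology E) ((\<lambda>z. line (\<phi> z)) ` U)) (\<lambda>z. line (\<phi> z))"

text \<open>
  The affine subspace of the chart through \<open>\<phi> 0\<close>, with direction spanned by the partial derivatives
  of order at most \<open>s\<close>.  Order \<open>0\<close> is excluded: directions of \<open>{x. h x = 1}\<close> lie in the kernel of
  \<open>h\<close>, and \<open>\<phi> 0\<close> only enters as the base point.
\<close>

definition affine_osculating ::
    "nat \<Rightarrow> nat \<Rightarrow> ((nat \<Rightarrow> complex) \<Rightarrow> 'a \<Rightarrow> complex) \<Rightarrow> ('a \<Rightarrow> complex) set" where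
  "affine_osculating m s \<phi> = (\<lambda>d. \<phi> 0 + d) `
     cfun.span {partials is \<phi> 0 | is. set is \<subseteq> {..<m} \<and> 1 \<le> length is \<and> length is \<le> s}"

text \<open>
  The \<open>s\<close>-osculating space \<open>T\<^sub>p\<^sup>s X\<close> of \<open>X \<subseteq> \<P>(E)\<close> of dimension \<open>m\<close> at a smooth point \<open>p\<close>.  It does
  not depend on the chart and the parametrization, so it is the unique \<open>T\<close> obtained from some of them.
\<close>

definition osculating_space ::
    "('a \<Rightarrow> complex) set \<Rightarrow> nat \<Rightarrow> ('a \<Rightarrow> complex) set set \<Rightarrow> ('a \<Rightarrow> complex) set \<Rightarrow> nat \<Rightarrow>
     ('a \<Rightarrow> complex) set set" where
  "osculating_space E m X p s =
     (THE T. \<exists>h U \<phi>. local_parametrization E m X p h U \<phi> \<and>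
        T = proj_topology E closure_of (line ` affine_osculating m s \<phi>))"


section \<open>Exterior powers and the Pluecker embedding\<close>

text \<open>
  An alternating \<open>n\<close>-form is a function on lists of vectors, of which only the values on lists of
  length \<open>n\<close> matter.
\<close>

definition alternating_form ::
    "(complex \<Rightarrow> 'v \<Rightarrow> 'v::ab_group_add) \<Rightarrow> nat \<Rightarrow> ('v list \<Rightarrow> complex) \<Rightarrow> bool" where
  "alternating_form smul n \<omega> \<longleftrightarrow>
     (\<forall>vs i. length vs = n \<and> i < n \<longrightarrow>
        Vector_Spaces.linear smul (*) (\<lambda>v. \<omega> (vs[i := v]))) \<and>
     (\<forall>vs. length vs = n \<and> \<not> distinct vs \<longrightarrow> \<omega> vs = 0)"

text \<open>
  The exterior power \<open>\<Lambda>\<^sup>n V\<close> is realized inside the dual of the space of alternating \<open>n\<close>-forms on \<open>V\<close>: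
  \<open>v\<^sub>1 \<and> \<dots> \<and> v\<^sub>n\<close> is the evaluation \<open>\<omega> \<mapsto> \<omega>(v\<^sub>1, \<dots>, v\<^sub>n)\<close>.  Since \<open>(\<Lambda>\<^sup>n V)\<^sup>*\<close> is the space of
  alternating \<open>n\<close>-forms, the span of these evaluations is canonically isomorphic to \<open>\<Lambda>\<^sup>n V\<close>.
\<close>

definition wedge ::
    "(complex \<Rightarrow> 'v \<Rightarrow> 'v::ab_group_add) \<Rightarrow> nat \<Rightarrow> 'v list \<Rightarrow> ('v list \<Rightarrow> complex) \<Rightarrow> complex" where
  "wedge smul n vs = (\<lambda>\<omega>. if alternating_form smul n \<omega> then \<omega> vs else 0)"

text \<open>For a subspace \<open>W\<close> of \<open>V\<close> this is \<open>\<Lambda>\<^sup>n W \<subseteq> \<Lambda>\<^sup>n V\<close>.\<close>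

definition exterior_power ::
    "(complex \<Rightarrow> 'v \<Rightarrow> 'v::ab_group_add) \<Rightarrow> nat \<Rightarrow> 'v set \<Rightarrow> (('v list \<Rightarrow> complex) \<Rightarrow> complex) set" where
  "exterior_power smul n W = cfun.span {wedge smul n vs | vs. length vs = n \<and> set vs \<subseteq> W}"

text \<open>The Pluecker embedding: an \<open>n\<close>-dimensional subspace \<open>W\<close> is sent to the line \<open>\<Lambda>\<^sup>n W\<close>.\<close>

definition pluecker ::
    "(complex \<Rightarrow> 'v \<Rightarrow> 'v::ab_group_add) \<Rightarrow> nat \<Rightarrow> 'v set \<Rightarrow> (('v list \<Rightarrow> complex) \<Rightarrow> complex) set" where
  "pluecker smul n W = exterior_power smul n W"


section \<open>Spinor varieties\<close>

definition polar_form :: "('v::ab_group_add \<Rightarrow> complex) \<Rightarrow> 'v \<Rightarrow> 'v \<Rightarrow> complex" where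
  "polar_form Q v w = Q (v + w) - Q v - Q w"

definition quadratic_form ::
    "(complex \<Rightarrow> 'v \<Rightarrow> 'v::ab_group_add) \<Rightarrow> ('v \<Rightarrow> complex) \<Rightarrow> bool" where
  "quadratic_form smul Q \<longleftrightarrow>
     (\<forall>c v. Q (smul c v) = c\<^sup>2 * Q v) \<and>
     (\<forall>v. Vector_Spaces.linear smul (*) (polar_form Q v))"

definition nondegenerate :: "('v::ab_group_add \<Rightarrow> complex) \<Rightarrow> bool" where
  "nondegenerate Q \<longleftrightarrow> (\<forall>v. (\<forall>w. polar_form Q v w = 0) \<longrightarrow> v = 0)"

definition isotropic_subspaces ::
    "(complex \<Rightarrow> 'v \<Rightarrow> 'v::ab_group_add) \<Rightarrow> ('v \<Rightarrow> complex) \<Rightarrow> nat \<Rightarrow> 'v set set" where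
  "isotropic_subspaces smul Q n =
     {W. module.subspace smul W \<and> vector_space.dim smul W = n \<and> (\<forall>v\<in>W. Q v = 0)}"

text \<open>
  A spinor variety, in its Pluecker embedding, is one of the connected components of the variety of
  \<open>n\<close>-dimensional isotropic subspaces.  Components are taken in the classical topology; for complex
  varieties these are the same as the components in the Zariski topology.
\<close>

definition spinor_variety ::
    "(complex \<Rightarrow> 'v \<Rightarrow> 'v::ab_group_add) \<Rightarrow> ('v \<Rightarrow> complex) \<Rightarrow> nat \<Rightarrow>
     (('v list \<Rightarrow> complex) \<Rightarrow> complex) set set \<Rightarrow> bool" where
  "spinor_variety smul Q n S \<longleftrightarrow>
     S \<in> connected_components_of (subtopology (proj_topology (exterior_power smul n UNIV))
            (pluecker smul n ` isotropic_subspaces smul Q n))"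

end

theory Submission
  imports Defs "Jordan_Normal_Form.Determinant" "HOL-Complex_Analysis.Complex_Analysis"
begin

text \<open>
  Near an isotropic subspace \<open>W\<close> with basis \<open>e\<close>, the spinor variety consists of the graphs of skew maps
  from \<open>W\<close> to a complementary isotropic subspace with dual basis \<open>f\<close>, so that \<open>\<phi> A\<close> is the wedge of the
  vectors \<open>e\<^sub>i + \<Sum>\<^sub>j A\<^sub>i\<^sub>j f\<^sub>j\<close> and its homogeneous part of degree \<open>k\<close> lists the \<open>k\<close>-minors of a skew matrix.
  Since \<open>det A\<^sub>J\<^sub>I = (-1)\<^sup>k det A\<^sub>I\<^sub>J\<close>, these span a space of dimension at most the number of unordered pairs
  \<open>{I, J}\<close> of \<open>k\<close>-subsets, without the pairs \<open>{I, I}\<close> for odd \<open>k\<close>.  There are no further linear relations: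
  evaluating on matrices supported on a matching gives signed sums over the transversals of the matching,
  and an exchange argument recovers the individual coefficients.  That the osculating space does not
  depend on the parametrization follows from the chain rule, because the coordinates of the chart are
  quotients of Pluecker coordinates, so that any two parametrizations differ by a holomorphic factor and
  a holomorphic change of coordinates with invertible Jacobian.  Finally, the span of a chart is the same for
  any two charts that meet, and therefore equals the span of the whole component.
\<close>

section \<open>Finite-dimensional spaces of functions\<close>

text \<open>The dimensions are squeezed between bounds for all degrees at once. Each degree
  \<open>k\<close> contributes at most the number of admissible pairs, whereas a lower bound is
  obtained only for the span of the whole chart, because the functionals tested there vanish on all
  graphs and not just on a homogeneous part. Subtracting the upper bounds for the degrees above
  \<open>s\<close> yields the missing lower bound for order \<open>s\<close>. The threshold
  \<open>2 * (n div 2)\<close> appears because for odd \<open>n\<close> the one pair left in degree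
  \<open>n\<close> is the full set with itself, which an odd degree excludes. The parity of the
  number of common row and column indices shapes the combinatorics: these indices can be matched
  among themselves when the number is even, while otherwise one of them has to share its edges with
  a pair outside, and this produces the sign in \<open>key\<close>. Since the osculating space is
  defined by unique choice, the given chart must be compared with every continuous, separately
  holomorphic parametrization; as the chart is polynomial, only the inner map of each composition is
  merely holomorphic.\<close>

lemma fun_sum_apply: "(\<Sum>t\<in>A. v t) a = (\<Sum>t\<in>A. v t a)"
  for v :: "'t \<Rightarrow> 'a \<Rightarrow> complex"
  by (induct A rule: infinite_finite_induct) auto

text \<open>Extend a basis of \<open>T\<close> by \<open>x\<close> and prescribe the values.
  Membership in a span is proved below by refuting such an \<open>h\<close>: composed with wedges it
  is an alternating form, composed with a polynomial map it is a polynomial.\<close>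

lemma separating_functional:
  assumes T: "cfun.subspace T" and x: "x \<notin> T"
  obtains h where "Vector_Spaces.linear fscale (*) h" "\<And>y. y \<in> T \<Longrightarrow> h y = 0" "h x = 1"
proof -
  interpret vector_space_pair fscale "(*) :: complex \<Rightarrow> complex \<Rightarrow> complex"
    by (intro vector_space_pair.intro cfun.vector_space_axioms vector_space_over_itself.vector_space_axioms)
  obtain B where B: "B \<subseteq> T" "cfun.independent B" "T \<subseteq> cfun.span B"
    using cfun.maximal_independent_subset by blast
  have "cfun.span B \<subseteq> T" using B(1) T by (rule cfun.span_minimal)
  with x have xB: "x \<notin> cfun.span B" by blast
  then have "cfun.independent (insert x B)"
    using B(2) by (rule cfun.independent_insertI)
  then obtain h where h: "Vector_Spaces.linear fscale (*) h" "\<forall>y\<in>insert x B. h y = (if y = x then 1 else 0)"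
    using linear_independent_extend[of "insert x B" "\<lambda>y. if y = x then 1 else 0"] by blast
  interpret h: Vector_Spaces.linear fscale "(*)" h by (rule h)
  have "h y = 0" if "y \<in> B" for y
    using that h(2) xB cfun.span_base by auto
  then have "h y = 0" if "y \<in> cfun.span B" for y
    using that by (rule h.eq_0_on_span)
  then show thesis using that[OF h(1)] B(3) h(2) by auto
qed

text \<open>If there were no such vector, the \<open>j\<close>-th unit vector would lie outside the
  range of the joint evaluation \<open>R\<close>, and a functional separating the two would be a
  linear relation between the \<open>\<beta> i\<close> with coefficient 1 at
  \<open>j\<close>.\<close>

lemma dual_vectors:
  fixes n :: nat
  assumes \<beta>: "\<And>i. i < n \<Longrightarrow> Vector_Spaces.linear smul (*) (\<beta> i)"
    and inj: "\<And>c. (\<And>v. (\<Sum>i<n. c i * \<beta> i v) = 0) \<Longrightarrow> c j = 0" and j: "j < n"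
  shows "\<exists>v. \<forall>i<n. \<beta> i v = (if i = j then 1 else (0::complex))"
proof (rule ccontr)
  assume no: "\<nexists>v. \<forall>i<n. \<beta> i v = (if i = j then 1 else 0)"
  have lin: "\<beta> i (v + w) = \<beta> i v + \<beta> i w" "\<beta> i (smul c v) = c * \<beta> i v" if "i < n" for i v w c
    using \<beta>[OF that] by (auto simp: Vector_Spaces.linear_iff)
  define R where "R v = (\<lambda>i. if i < n then \<beta> i v else 0)" for v
  define \<delta> where "\<delta> k = (\<lambda>i. if i = k then 1 else 0 :: complex)" for k :: nat
  have RV: "R (v + w) = R v + R w" "R (smul c v) = fscale c (R v)" for v w c
    by (auto simp: R_def lin fscale_def fun_eq_iff)
  have "R 0 = 0"
    using RV(1)[of 0 0] by simp
  then have T: "cfun.subspace (range R)"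
    unfolding cfun.subspace_def
  proof (intro conjI ballI allI)
    show "0 \<in> range R" using \<open>R 0 = 0\<close> by (intro range_eqI[where x = 0]) simp
    fix x y assume "x \<in> range R" "y \<in> range R"
    then obtain v w where "x = R v" "y = R w" by blast
    then have "x + y = R (v + w)" by (simp only: RV)
    then show "x + y \<in> range R" by blast
  next
    fix c x assume "x \<in> range R"
    then obtain v where "x = R v" by blast
    then have "fscale c x = R (smul c v)" by (simp only: RV)
    then show "fscale c x \<in> range R" by blast
  qed
  have "\<delta> j \<notin> range R"
  proof
    assume "\<delta> j \<in> range R"
    then obtain v where v: "R v = \<delta> j" by (metis rangeE)
    have "\<beta> i v = (if i = j then 1 else 0)" if "i < n" for i
      using fun_cong[OF v, of i] that by (simp add: \<delta>_def R_def)
    with no show False by blast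
  qed
  then obtain h where h: "Vector_Spaces.linear fscale (*) h" "\<And>y. y \<in> range R \<Longrightarrow> h y = 0" "h (\<delta> j) = 1"
    using separating_functional[OF T] by blast
  interpret h: Vector_Spaces.linear fscale "(*)" h by (rule h)
  have "(\<Sum>i<n. h (\<delta> i) * \<beta> i v) = 0" for v
  proof -
    have "R v = (\<Sum>i<n. fscale (\<beta> i v) (\<delta> i))"
      by (intro ext) (auto simp: R_def fun_sum_apply fscale_def \<delta>_def if_distrib[of "\<lambda>x. _ * x"] cong: if_cong)
    then have "h (R v) = (\<Sum>i<n. \<beta> i v * h (\<delta> i))" by (simp add: h.sum h.scale)
    then show ?thesis using h(2)[of "R v"] by (simp add: mult.commute)
  qed
  then have "h (\<delta> j) = 0" using inj[of "\<lambda>i. h (\<delta> i)"] by blast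
  with h(3) show False by simp
qed

lemma independent_if_dual:
  fixes \<eta> :: "'q \<Rightarrow> 'a \<Rightarrow> complex"
  assumes Q: "finite Q" and dual: "\<And>q q'. q \<in> Q \<Longrightarrow> q' \<in> Q \<Longrightarrow> q \<noteq> q' \<Longrightarrow> \<eta> q (a q') = 0"
    and nz: "\<And>q. q \<in> Q \<Longrightarrow> \<eta> q (a q) \<noteq> 0"
  shows "inj_on \<eta> Q" "cfun.independent (\<eta> ` Q)"
proof -
  show inj: "inj_on \<eta> Q"
    by (rule inj_onI) (metis dual nz)
  show "cfun.independent (\<eta> ` Q)"
  proof (rule cfun.independent_if_scalars_zero)
    fix c x assume s: "(\<Sum>x\<in>\<eta> ` Q. fscale (c x) x) = 0" and "x \<in> \<eta> ` Q"
    then obtain q where q: "q \<in> Q" "x = \<eta> q" by blast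
    have "0 = (\<Sum>p\<in>Q. fscale (c (\<eta> p)) (\<eta> p)) (a q)"
      using s by (simp add: sum.reindex[OF inj])
    also have "\<dots> = (\<Sum>p\<in>Q. if p = q then c (\<eta> q) * \<eta> q (a q) else 0)"
      unfolding fun_sum_apply by (intro sum.cong refl) (auto simp: fscale_def dual q(1))
    also have "\<dots> = c (\<eta> q) * \<eta> q (a q)" using Q q by (subst sum.delta) auto
    finally show "c x = 0" using nz q by auto
  qed (use Q in simp)
qed

text \<open>Gaussian elimination on the generators, with points of the domain as pivots: a function
  in the span is determined by its values on \<open>P\<close>, and the \<open>w p\<close> form the
  interpolation basis. This turns a finite-dimensional span into the solution set of equations
  between values.\<close>

lemma span_finite_coordinates:
  fixes B :: "('a \<Rightarrow> complex) set"
  assumes "finite B"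
  shows "\<exists>P w. finite P \<and> (\<forall>p\<in>P. w p \<in> cfun.span B) \<and>
     (\<forall>p\<in>P. \<forall>q\<in>P. w p q = (if p = q then 1 else 0)) \<and>
     (\<forall>g\<in>cfun.span B. g = (\<Sum>p\<in>P. fscale (g p) (w p)))"
  using assms
proof (induct B)
  case empty
  show ?case by (rule exI[of _ "{}"]) auto
next
  case (insert b B)
  from insert(3) obtain P w where Pw: "finite P" "\<forall>p\<in>P. w p \<in> cfun.span B"
    "\<forall>p\<in>P. \<forall>q\<in>P. w p q = (if p = q then 1 else 0)"
    "\<forall>g\<in>cfun.span B. g = (\<Sum>p\<in>P. fscale (g p) (w p))" by (elim exE conjE)
  note P = Pw(1) Pw(2)[rule_format] and d = Pw(3)[rule_format] and ex = Pw(4)[rule_format]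
  have sub: "cfun.span B \<subseteq> cfun.span (insert b B)" by (intro cfun.span_mono) auto
  define s where "s = (\<Sum>p\<in>P. fscale (b p) (w p))"
  define b' where "b' = b - s"
  have s: "s \<in> cfun.span B" unfolding s_def by (intro cfun.span_sum cfun.span_scale P)
  have b': "b' \<in> cfun.span (insert b B)"
    unfolding b'_def by (rule cfun.span_diff[OF cfun.span_base subsetD[OF sub s]]) simp
  have b'0: "b' p = 0" if "p \<in> P" for p
  proof -
    have "s p = (\<Sum>q\<in>P. if q = p then b p else 0)"
      unfolding s_def fun_sum_apply using d that by (intro sum.cong refl) (auto simp: fscale_def)
    then show ?thesis using that P by (simp add: b'_def)
  qed
  show ?case
  proof (cases "b' = 0")
    case True
    then have "b \<in> cfun.span B" using s by (simp add: b'_def)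
    then have "cfun.span (insert b B) = cfun.span B" by (rule cfun.span_redundant)
    then show ?thesis using P d ex by (intro exI[of _ P] exI[of _ w]) auto
  next
    case False
    \<comment> \<open>The remainder \<open>b'\<close> vanishes on the old pivots, so any point where
      it is nonzero is a new one.\<close>
    then obtain q where q: "b' q \<noteq> 0" by (auto simp: fun_eq_iff)
    then have qP: "q \<notin> P" using b'0 by blast
    define c where "c = fscale (1 / b' q) b'"
    have c: "c \<in> cfun.span (insert b B)" "c q = 1" "\<And>p. p \<in> P \<Longrightarrow> c p = 0"
      using b' b'0 q by (auto simp: c_def cfun.span_scale) (auto simp: fscale_def)
    \<comment> \<open>The old basis vectors are corrected to vanish at the new pivot; as
      \<open>c\<close> vanishes on \<open>P\<close>, their values there do not change.\<close>
    define w' where "w' p = (if p = q then c else w p - fscale (w p q) c)" for p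
    have "w' p \<in> cfun.span (insert b B)" if "p \<in> insert q P" for p
      using that c(1) P(2) sub unfolding w'_def
      by (auto intro!: cfun.span_diff cfun.span_scale)
    moreover have "w' p r = (if p = r then 1 else 0)" if "p \<in> insert q P" "r \<in> insert q P" for p r
      using that d c qP by (auto simp: w'_def fscale_def)
    moreover have "g = (\<Sum>p\<in>insert q P. fscale (g p) (w' p))" if g: "g \<in> cfun.span (insert b B)" for g
    proof -
      obtain k where k: "g - fscale k b \<in> cfun.span B"
        using g by (auto simp: cfun.span_insert)
      define g' where "g' = g - fscale k b'"
      have "g' = (g - fscale k b) + fscale k s" by (simp add: g'_def b'_def cfun.scale_right_diff_distrib)
      then have g': "g' \<in> cfun.span B" using k s by (simp add: cfun.span_add cfun.span_scale)
      have gp: "g' p = g p" if "p \<in> P" for p using b'0[OF that] by (simp add: g'_def fscale_def)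
      have g'q: "g' q = (\<Sum>p\<in>P. g p * w p q)"
      proof -
        have "g' q = (\<Sum>p\<in>P. fscale (g' p) (w p)) q" using ex[OF g'] by simp
        then show ?thesis by (simp add: fun_sum_apply fscale_def gp)
      qed
      show ?thesis
      proof
        fix a
        have "g' a = (\<Sum>p\<in>P. g p * w p a)"
        proof -
          have "g' a = (\<Sum>p\<in>P. fscale (g' p) (w p)) a" using ex[OF g'] by simp
          then show ?thesis by (simp add: fun_sum_apply fscale_def gp)
        qed
        moreover have "(\<Sum>p\<in>insert q P. fscale (g p) (w' p)) a =
            g q * c a + (\<Sum>p\<in>P. g p * (w p a - w p q * c a))"
          using qP P(1) by (auto simp: fun_sum_apply w'_def fscale_def intro!: sum.cong)
        moreover have "(\<Sum>p\<in>P. g p * (w p a - w p q * c a)) = (\<Sum>p\<in>P. g p * w p a) - g' q * c a"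
          unfolding g'q by (simp add: algebra_simps sum_subtractf sum_distrib_left)
        moreover have "k * b' a = (g q - g' q) * c a" using q by (simp add: g'_def c_def fscale_def)
        ultimately show "g a = (\<Sum>p\<in>insert q P. fscale (g p) (w' p)) a"
          by (simp add: g'_def fscale_def algebra_simps)
      qed
    qed
    ultimately show ?thesis using P(1) by (intro exI[of _ "insert q P"] exI[of _ w']) blast
  qed
qed

lemma closed_span_finite:
  fixes B :: "('a \<Rightarrow> complex) set"
  assumes "finite B"
  shows "closed (cfun.span B)"
proof -
  obtain P w where Pw: "finite P" "\<forall>p\<in>P. w p \<in> cfun.span B"
    "\<forall>g\<in>cfun.span B. g = (\<Sum>p\<in>P. fscale (g p) (w p))"
    using span_finite_coordinates[OF assms] by (elim exE conjE)
  note P = Pw(1) Pw(2)[rule_format] and ex = Pw(3)[rule_format]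
  have "cfun.span B = {g. g = (\<Sum>p\<in>P. fscale (g p) (w p))}"
  proof (intro equalityI subsetI CollectI)
    fix g assume "g \<in> {g. g = (\<Sum>p\<in>P. fscale (g p) (w p))}"
    then have "g = (\<Sum>p\<in>P. fscale (g p) (w p))" by simp
    also have "\<dots> \<in> cfun.span B" by (intro cfun.span_sum cfun.span_scale P)
    finally show "g \<in> cfun.span B" .
  qed (rule ex)
  also have "\<dots> = {g. \<forall>a. g a = (\<Sum>p\<in>P. g p * w p a)}"
    by (auto simp: fun_eq_iff fun_sum_apply fscale_def)
  also have "closed \<dots>"
    by (intro closed_Collect_all closed_Collect_eq continuous_on_sum continuous_on_mult_right
        continuous_on_product_coordinates)
  finally show ?thesis .
qed

section \<open>Alternating forms\<close>

locale complex_space = vector_space smul for smul :: "complex \<Rightarrow> 'v \<Rightarrow> 'v::ab_group_add"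
begin

lemma linear_functional_iff:
  "Vector_Spaces.linear smul (*) (h :: 'v \<Rightarrow> complex) \<longleftrightarrow>
     (\<forall>v w. h (v + w) = h v + h w) \<and> (\<forall>c v. h (smul c v) = c * h v)"
proof -
  have "vector_space ((*) :: complex \<Rightarrow> complex \<Rightarrow> complex)"
    by (rule vector_space_over_itself.vector_space_axioms)
  then show ?thesis using vector_space_axioms by (simp add: Vector_Spaces.linear_iff)
qed

abbreviation "altform \<equiv> alternating_form smul"

lemma altform_update:
  assumes "altform n \<omega>" "length vs = n" "i < n"
  shows "\<omega> (vs[i := v + w]) = \<omega> (vs[i := v]) + \<omega> (vs[i := w])" "\<omega> (vs[i := smul c v]) = c * \<omega> (vs[i := v])"
  using assms unfolding alternating_form_def linear_functional_iff by blast+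

lemma altform_not_distinct: "altform n \<omega> \<Longrightarrow> length vs = n \<Longrightarrow> \<not> distinct vs \<Longrightarrow> \<omega> vs = 0"
  unfolding alternating_form_def by blast

lemma altformI:
  assumes "\<And>xs ys v w. length xs + length ys + 1 = n \<Longrightarrow> \<omega> (xs @ (v + w) # ys) = \<omega> (xs @ v # ys) + \<omega> (xs @ w # ys)"
    and "\<And>xs ys c v. length xs + length ys + 1 = n \<Longrightarrow> \<omega> (xs @ smul c v # ys) = c * \<omega> (xs @ v # ys)"
    and "\<And>vs. length vs = n \<Longrightarrow> \<not> distinct vs \<Longrightarrow> \<omega> vs = 0"
  shows "altform n \<omega>"
  unfolding alternating_form_def linear_functional_iff using assms
  by (auto simp: upd_conv_take_nth_drop)

lemma altform_slot:
  assumes \<omega>: "altform n \<omega>" and n: "length xs + length ys + 1 = n"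
  shows "\<omega> (xs @ (v + w) # ys) = \<omega> (xs @ v # ys) + \<omega> (xs @ w # ys)"
    "\<omega> (xs @ smul c v # ys) = c * \<omega> (xs @ v # ys)"
    "\<omega> (xs @ 0 # ys) = 0"
proof -
  have *: "(xs @ v # ys)[length xs := u] = xs @ u # ys" for u v by simp
  note upd = altform_update[OF \<omega>, of "xs @ v # ys" "length xs", unfolded *]
  show 1: "\<omega> (xs @ (v + w) # ys) = \<omega> (xs @ v # ys) + \<omega> (xs @ w # ys)"
    using upd(1)[of v w] n by simp
  show 2: "\<omega> (xs @ smul c v # ys) = c * \<omega> (xs @ v # ys)" for c v
    using altform_update(2)[OF \<omega>, of "xs @ v # ys" "length xs", unfolded *, of c v] n by simp
  show "\<omega> (xs @ 0 # ys) = 0" using 2[of 0 0] by simp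
qed

lemma altform_slot_sum:
  assumes \<omega>: "altform n \<omega>" and n: "length xs + length ys + 1 = n"
  shows "\<omega> (xs @ (\<Sum>t\<in>A. smul (c t) (u t)) # ys) = (\<Sum>t\<in>A. c t * \<omega> (xs @ u t # ys))"
  by (induct A rule: infinite_finite_induct) (auto simp: altform_slot[OF \<omega> n])

lemma altform_swap:
  assumes \<omega>: "altform n \<omega>" and vs: "length vs = n" and ij: "i < n" "j < n" "i \<noteq> j"
  shows "\<omega> (vs[i := v, j := w]) = - \<omega> (vs[i := w, j := v])"
proof -
  have nd: "\<omega> (vs[i := u, j := u]) = 0" for u
  proof (rule altform_not_distinct[OF \<omega>])
    have "vs[i := u, j := u] ! i = vs[i := u, j := u] ! j" using vs ij by simp
    then show "\<not> distinct (vs[i := u, j := u])" using vs ij by (metis length_list_update nth_eq_iff_index_eq)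
  qed (use vs in simp)
  have i: "\<omega> (vs[i := a + b, j := c]) = \<omega> (vs[i := a, j := c]) + \<omega> (vs[i := b, j := c])" for a b c
    using altform_update(1)[OF \<omega>, of "vs[j := c]" i a b] vs ij by (simp add: list_update_swap)
  have j: "\<omega> (vs[i := a, j := b + c]) = \<omega> (vs[i := a, j := b]) + \<omega> (vs[i := a, j := c])" for a b c
    using altform_update(1)[OF \<omega>, of "vs[i := a]" j b c] vs ij by simp
  have "\<omega> (vs[i := v + w, j := v + w]) = \<omega> (vs[i := v, j := w]) + \<omega> (vs[i := w, j := v])"
    by (simp only: i j) (simp add: nd)
  then have "\<omega> (vs[i := v, j := w]) + \<omega> (vs[i := w, j := v]) = 0"
    unfolding nd by (rule sym)
  then show ?thesis by (rule eq_neg_iff_add_eq_0[THEN iffD2])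
qed

lemma altform_swap_adj:
  assumes \<omega>: "altform n \<omega>" and n: "length xs + length ys + 2 = n"
  shows "\<omega> (xs @ v # w # ys) = - \<omega> (xs @ w # v # ys)"
  using altform_swap[OF \<omega>, of "xs @ v # w # ys" "length xs" "Suc (length xs)" v w] n
  by (simp add: list_update_append)

lemma altform_transpose:
  assumes \<omega>: "altform n \<omega>" and ij: "i < n" "j < n" "i \<noteq> j"
  shows "\<omega> (map (u \<circ> Transposition.transpose i j) [0..<n]) = - \<omega> (map u [0..<n])"
proof -
  have 1: "map (u \<circ> Transposition.transpose i j) [0..<n] = (map u [0..<n])[i := u j, j := u i]"
    using ij by (auto intro!: nth_equalityI simp: nth_list_update transpose_def)
  have 2: "map u [0..<n] = (map u [0..<n])[i := u i, j := u j]"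
    using ij by (auto intro!: nth_equalityI simp: nth_list_update)
  show ?thesis
    using altform_swap[OF \<omega>, of "map u [0..<n]" i j "u j" "u i"] ij by (simp add: 1 flip: 2)
qed

lemma altform_permute:
  assumes \<omega>: "altform n \<omega>" and p: "p permutes {..<n}"
  shows "\<omega> (map (u \<circ> p) [0..<n]) = of_int (sign p) * \<omega> (map u [0..<n])"
proof -
  have "\<forall>u. \<omega> (map (u \<circ> p) [0..<n]) = of_int (sign p) * \<omega> (map u [0..<n])"
  proof (rule permutes_induct[OF p finite_lessThan])
    fix a b q
    assume ab: "a \<in> {..<n}" "b \<in> {..<n}" "a \<noteq> b" and q: "q permutes {..<n}"
      and IH: "\<forall>u. \<omega> (map (u \<circ> q) [0..<n]) = of_int (sign q) * \<omega> (map u [0..<n])"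
    have "sign (Transposition.transpose a b \<circ> q) = - sign q"
      using ab q by (simp add: sign_compose permutation_swap_id sign_swap_id
          permutation_permutes[THEN iffD2, OF exI, of "{..<n}"])
    then show "\<forall>u. \<omega> (map (u \<circ> (Transposition.transpose a b \<circ> q)) [0..<n]) =
       of_int (sign (Transposition.transpose a b \<circ> q)) * \<omega> (map u [0..<n])"
      using IH altform_transpose[OF \<omega>, of a b] ab by (simp add: comp_assoc[symmetric])
  qed (simp add: sign_id)
  then show ?thesis by blast
qed

text \<open>The sign depends on the two index lists only. Choosing it before the form and the
  vectors allows the identity to be read as one between wedges.\<close>

lemma altform_reorder:
  assumes "mset is = mset js" "length js = n"
  shows "\<exists>\<sigma>\<in>{1, -1 :: complex}. \<forall>\<omega> u. altform n \<omega> \<longrightarrow> \<omega> (map u is) = \<sigma> * \<omega> (map u js)"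
proof -
  obtain p where p: "p permutes {..<length js}" "permute_list p js = is"
    using assms(1) by (rule mset_eq_permutation)
  have "\<omega> (map u is) = of_int (sign p) * \<omega> (map u js)" if "altform n \<omega>" for \<omega> u
  proof -
    have "map u is = map ((\<lambda>k. u (js ! k)) \<circ> p) [0..<n]"
      using p(2) assms(2) by (auto simp: permute_list_def)
    moreover have "map u js = map (\<lambda>k. u (js ! k)) [0..<n]"
      using assms(2) by (auto intro: nth_equalityI)
    ultimately show ?thesis using altform_permute[OF that, of p "\<lambda>k. u (js ! k)"] p(1) assms(2) by simp
  qed
  moreover have "(of_int (sign p) :: complex) \<in> {1, -1}" by (simp add: sign_def)
  ultimately show ?thesis by blast
qed

text \<open>Functionals on the exterior power correspond to alternating forms. Through this, what is
  proved for forms vanishing on graphs applies to functionals vanishing on a chart.\<close>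

lemma altform_functional_wedge:
  assumes h: "Vector_Spaces.linear fscale (*) h"
  shows "altform n (\<lambda>vs. h (wedge smul n vs))"
proof -
  have lin: "h (x + y) = h x + h y" "h (fscale c x) = c * h x" for x y c
    using h by (auto simp: Vector_Spaces.linear_iff)
  have "h 0 = 0" using lin(2)[of 0 0] by simp
  note lin = lin this
  show ?thesis
  proof (rule altformI)
    fix xs ys :: "'v list" and v w assume n: "length xs + length ys + 1 = n"
    have "wedge smul n (xs @ (v + w) # ys) = wedge smul n (xs @ v # ys) + wedge smul n (xs @ w # ys)"
      using altform_slot(1)[OF _ n] by (intro ext) (simp add: wedge_def)
    then show "h (wedge smul n (xs @ (v + w) # ys)) = h (wedge smul n (xs @ v # ys)) + h (wedge smul n (xs @ w # ys))"
      by (simp add: lin)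
  next
    fix xs ys :: "'v list" and c v assume n: "length xs + length ys + 1 = n"
    have "wedge smul n (xs @ smul c v # ys) = fscale c (wedge smul n (xs @ v # ys))"
      using altform_slot(2)[OF _ n] by (intro ext) (simp add: wedge_def fscale_def)
    then show "h (wedge smul n (xs @ smul c v # ys)) = c * h (wedge smul n (xs @ v # ys))"
      by (simp add: lin)
  next
    fix vs :: "'v list" assume "length vs = n" "\<not> distinct vs"
    then have "wedge smul n vs = 0"
      using altform_not_distinct by (intro ext) (auto simp: wedge_def)
    then show "h (wedge smul n vs) = 0" by (simp add: lin)
  qed
qed

text \<open>The slots are handled from left to right: the entries \<open>xs\<close> already lie in
  \<open>B\<close>, and by linearity in the next slot the admissible vectors form a subspace that
  contains \<open>B\<close>.\<close>

lemma wedge_in_span: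
  assumes "length vs = n" "set vs \<subseteq> span B"
  shows "wedge smul n vs \<in> cfun.span {wedge smul n ws | ws. length ws = n \<and> set ws \<subseteq> B}"
    (is "_ \<in> ?S")
proof -
  have "wedge smul n (xs @ ys) \<in> ?S"
    if "length xs + length ys = n" "set xs \<subseteq> B" "set ys \<subseteq> span B" for xs ys :: "'v list"
    using that
  proof (induct ys arbitrary: xs)
    case Nil
    then show ?case by (intro cfun.span_base) auto
  next
    case (Cons y ys)
    have n: "length xs + length ys + 1 = n" using Cons by simp
    have "subspace {v. wedge smul n (xs @ v # ys) \<in> ?S}"
      unfolding subspace_def
    proof (intro conjI ballI allI)
      have "wedge smul n (xs @ 0 # ys) = 0"
        using altform_slot(3)[OF _ n] by (intro ext) (simp add: wedge_def)
      then show "0 \<in> {v. wedge smul n (xs @ v # ys) \<in> ?S}" by (simp add: cfun.span_zero)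
      fix v w assume "v \<in> {v. wedge smul n (xs @ v # ys) \<in> ?S}" "w \<in> {v. wedge smul n (xs @ v # ys) \<in> ?S}"
      moreover have "wedge smul n (xs @ (v + w) # ys) = wedge smul n (xs @ v # ys) + wedge smul n (xs @ w # ys)"
        using altform_slot(1)[OF _ n] by (intro ext) (simp add: wedge_def)
      ultimately show "v + w \<in> {v. wedge smul n (xs @ v # ys) \<in> ?S}" by (simp add: cfun.span_add)
    next
      fix c v assume "v \<in> {v. wedge smul n (xs @ v # ys) \<in> ?S}"
      moreover have "wedge smul n (xs @ smul c v # ys) = fscale c (wedge smul n (xs @ v # ys))"
        using altform_slot(2)[OF _ n] by (intro ext) (simp add: wedge_def fscale_def)
      ultimately show "smul c v \<in> {v. wedge smul n (xs @ v # ys) \<in> ?S}" by (simp add: cfun.span_scale)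
    qed
    moreover have "B \<subseteq> {v. wedge smul n (xs @ v # ys) \<in> ?S}"
      using Cons.hyps[of "xs @ [_]"] Cons.prems by auto
    ultimately have "span B \<subseteq> {v. wedge smul n (xs @ v # ys) \<in> ?S}" by (intro span_minimal)
    then show ?case using Cons.prems by auto
  qed
  from this[of "[]" vs] assms show ?thesis by simp
qed

lemma wedge_in_line:
  assumes "length us = n" "length vs = n" "set vs \<subseteq> span (set us)"
  shows "wedge smul n vs \<in> line (wedge smul n us)"
proof -
  have "wedge smul n ws \<in> line (wedge smul n us)" if ws: "length ws = n" "set ws \<subseteq> set us" for ws
  proof (cases "distinct ws")
    case False
    then have "wedge smul n ws = 0"
      using altform_not_distinct ws by (intro ext) (auto simp: wedge_def)
    then show ?thesis by (simp add: cfun.span_zero)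
  next
    case True
    \<comment> \<open>Distinct entries of \<open>ws\<close> leave no room in \<open>set us\<close>,
      so \<open>us\<close> is distinct as well and \<open>ws\<close> is a rearrangement of
      it.\<close>
    then have "card (set us) \<ge> n" using ws by (metis card_mono distinct_card finite_set)
    then have us: "distinct us" "set ws = set us"
      using assms(1) ws True by (auto intro!: card_distinct antisym card_length card_subset_eq simp: distinct_card)
         (metis card_length card_subset_eq distinct_card finite_set le_antisym subsetD)
    then have "mset ws = mset us" using True by (simp add: set_eq_iff_mset_eq_distinct)
    then obtain \<sigma> where "\<And>\<omega> u. altform n \<omega> \<Longrightarrow> \<omega> (map u ws) = (\<sigma>::complex) * \<omega> (map u us)"
      using altform_reorder assms(1) by blast
    from this[where u = id] have "wedge smul n ws = fscale \<sigma> (wedge smul n us)"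
      by (intro ext) (simp add: wedge_def fscale_def)
    then show ?thesis by (simp add: cfun.span_scale cfun.span_base)
  qed
  then have "cfun.span {wedge smul n ws | ws. length ws = n \<and> set ws \<subseteq> set us} \<subseteq> line (wedge smul n us)"
    by (intro cfun.span_minimal) auto
  then show ?thesis using wedge_in_span[OF assms(2,3)] by blast
qed

lemma exterior_power_eq_line:
  assumes "length us = n"
  shows "exterior_power smul n (span (set us)) = line (wedge smul n us)"
  unfolding exterior_power_def
proof
  show "cfun.span {wedge smul n vs |vs. length vs = n \<and> set vs \<subseteq> span (set us)} \<subseteq> line (wedge smul n us)"
    using wedge_in_line[OF assms] by (intro cfun.span_minimal) auto
  show "line (wedge smul n us) \<subseteq> cfun.span {wedge smul n vs |vs. length vs = n \<and> set vs \<subseteq> span (set us)}"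
    using assms span_superset by (intro cfun.span_mono) blast
qed

text \<open>The exterior product of the covectors \<open>\<xi> 0\<close>, ...,
  \<open>\<xi> (n - 1)\<close> as a form. With coordinate functions for the covectors these are the
  Pluecker coordinates.\<close>

definition det_form :: "nat \<Rightarrow> (nat \<Rightarrow> 'v \<Rightarrow> complex) \<Rightarrow> 'v list \<Rightarrow> complex" where
  "det_form n \<xi> vs = Determinant.det (Matrix.mat n n (\<lambda>(i, j). \<xi> j (vs ! i)))"

lemma det_form_leibniz:
  "det_form n \<xi> vs = (\<Sum>p | p permutes {0..<n}. signof p * (\<Prod>i = 0..<n. \<xi> (p i) (vs ! i)))"
proof -
  have "p i < n" if "p permutes {0..<n}" "i < n" for p i
    using that permutes_in_image[of p "{0..<n}" i] by auto
  then show ?thesis unfolding det_form_def Determinant.det_def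
    by (auto intro!: sum.cong prod.cong)
qed

lemma det_form_zero_column:
  assumes "j < n" "\<And>i. i < n \<Longrightarrow> \<xi> j (vs ! i) = 0"
  shows "det_form n \<xi> vs = 0"
  unfolding det_form_leibniz
proof (intro sum.neutral ballI)
  fix p assume "p \<in> {p. p permutes {0..<n}}"
  then have p: "p permutes {0..<n}" by simp
  then obtain i where "i \<in> {0..<n}" "p i = j"
    using assms(1) permutes_image[OF p] by (metis atLeastLessThan_iff imageE le0)
  then have "(\<Prod>i = 0..<n. \<xi> (p i) (vs ! i)) = 0"
    using assms(2) by (intro prod_zero bexI[of _ i]) auto
  then show "signof p * (\<Prod>i = 0..<n. \<xi> (p i) (vs ! i)) = 0" by simp
qed

lemma det_form_dual:
  assumes "\<And>i j. i < n \<Longrightarrow> j < n \<Longrightarrow> \<xi> j (vs ! i) = (if i = j then 1 else 0)"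
  shows "det_form n \<xi> vs = 1"
proof -
  have "Matrix.mat n n (\<lambda>(i, j). \<xi> j (vs ! i)) = 1\<^sub>m n"
    using assms by (intro eq_matI) auto
  then show ?thesis by (simp add: det_form_def)
qed

lemma altform_det_form:
  assumes \<xi>: "\<And>j. j < n \<Longrightarrow> Vector_Spaces.linear smul (*) (\<xi> j)"
  shows "altform n (det_form n \<xi>)"
  unfolding alternating_form_def
proof (intro conjI allI impI)
  fix vs :: "'v list" and k assume vs: "length vs = n \<and> k < n"
  have lin: "\<xi> j (v + w) = \<xi> j v + \<xi> j w" "\<xi> j (smul c v) = c * \<xi> j v" if "j < n" for j v w c
    using \<xi>[OF that] by (auto simp: linear_functional_iff)
  have pk: "p k < n" if "p permutes {0..<n}" for p
    using that vs permutes_in_image[of p "{0..<n}" k] by auto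
  have eq: "det_form n \<xi> (vs[k := v]) =
      (\<Sum>p | p permutes {0..<n}. signof p * ((\<Prod>i\<in>{0..<n} - {k}. \<xi> (p i) (vs ! i)) * \<xi> (p k) v))" for v
    unfolding det_form_leibniz
  proof (intro sum.cong refl arg_cong2[where f = "(*)"])
    fix p
    have "(\<Prod>i = 0..<n. \<xi> (p i) (vs[k := v] ! i)) =
        \<xi> (p k) (vs[k := v] ! k) * (\<Prod>i\<in>{0..<n} - {k}. \<xi> (p i) (vs[k := v] ! i))"
      using vs by (intro prod.remove) auto
    also have "(\<Prod>i\<in>{0..<n} - {k}. \<xi> (p i) (vs[k := v] ! i)) = (\<Prod>i\<in>{0..<n} - {k}. \<xi> (p i) (vs ! i))"
      by (intro prod.cong) auto
    finally show "(\<Prod>i = 0..<n. \<xi> (p i) (vs[k := v] ! i)) =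
        (\<Prod>i\<in>{0..<n} - {k}. \<xi> (p i) (vs ! i)) * \<xi> (p k) v"
      using vs by simp
  qed
  show "Vector_Spaces.linear smul (*) (\<lambda>v. det_form n \<xi> (vs[k := v]))"
    unfolding linear_functional_iff eq
    by (auto simp: lin pk sum.distrib[symmetric] sum_distrib_left algebra_simps intro!: sum.cong)
next
  fix vs :: "'v list" assume vs: "length vs = n \<and> \<not> distinct vs"
  then obtain i j where ij: "i < n" "j < n" "i \<noteq> j" "vs ! i = vs ! j"
    by (auto simp: distinct_conv_nth)
  show "det_form n \<xi> vs = 0"
    unfolding det_form_def
    by (rule det_identical_rows[of _ n i j]) (use ij in \<open>auto intro!: eq_vecI\<close>)
qed

end

section \<open>Polarizations and charts\<close>

lemma line_eqI: "x \<in> line y \<Longrightarrow> x \<noteq> 0 \<Longrightarrow> line x = line y"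
proof -
  assume x: "x \<in> line y" "x \<noteq> 0"
  then obtain c where c: "x = fscale c y" by (auto simp: cfun.span_singleton)
  with x have "c \<noteq> 0" by auto
  then have "y = fscale (1 / c) x" using c by (auto simp: fscale_def fun_eq_iff)
  then have "y \<in> line x" by (metis cfun.span_base cfun.span_scale singletonI)
  then show "line x = line y" using x by (simp add: cfun.span_eq)
qed

context complex_space
begin

lemma independent_if_dual_functionals:
  assumes Q: "finite K"
    and \<xi>: "\<And>k. k \<in> K \<Longrightarrow> Vector_Spaces.linear smul (*) (\<xi> k)"
    and dual: "\<And>k l. k \<in> K \<Longrightarrow> l \<in> K \<Longrightarrow> \<xi> k (u l) = (if k = l then 1 else 0)"
  shows "inj_on u K" "independent (u ` K)"
proof -
  show inj: "inj_on u K"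
    by (rule inj_onI) (metis dual zero_neq_one)
  show "independent (u ` K)"
  proof (rule independent_if_scalars_zero)
    fix c x assume s: "(\<Sum>x\<in>u ` K. smul (c x) x) = 0" and "x \<in> u ` K"
    then obtain k where k: "k \<in> K" "x = u k" by blast
    interpret \<xi>: Vector_Spaces.linear smul "(*)" "\<xi> k" by (rule \<xi>[OF k(1)])
    have "0 = \<xi> k (\<Sum>l\<in>K. smul (c (u l)) (u l))"
      using s by (simp add: sum.reindex[OF inj])
    also have "\<dots> = (\<Sum>l\<in>K. if l = k then c (u k) else 0)"
      unfolding \<xi>.sum \<xi>.scale by (intro sum.cong refl) (auto simp: dual k(1))
    also have "\<dots> = c (u k)" using Q k by (subst sum.delta) auto
    finally show "c x = 0" using k by simp
  qed (use Q in simp)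
qed

lemma polar_form_laws:
  assumes "quadratic_form smul Q"
  shows "polar_form Q v (w + w') = polar_form Q v w + polar_form Q v w'"
    "polar_form Q v (smul c w) = c * polar_form Q v w"
    "polar_form Q (w + w') v = polar_form Q w v + polar_form Q w' v"
    "polar_form Q (smul c w) v = c * polar_form Q w v"
    "polar_form Q v w = polar_form Q w v"
    "polar_form Q v v = 2 * Q v"
    "Vector_Spaces.linear smul (*) (polar_form Q v)"
proof -
  have sym: "polar_form Q v w = polar_form Q w v" for v w
    by (simp add: polar_form_def add.commute)
  show lin: "Vector_Spaces.linear smul (*) (polar_form Q v)" for v
    using assms by (simp add: quadratic_form_def)
  show 1: "polar_form Q v (w + w') = polar_form Q v w + polar_form Q v w'" for v w w'
    using lin[of v] unfolding linear_functional_iff by blast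
  show 2: "polar_form Q v (smul c w) = c * polar_form Q v w" for v w c
    using lin[of v] unfolding linear_functional_iff by blast
  show "polar_form Q (w + w') v = polar_form Q w v + polar_form Q w' v"
    using 1[of v w w'] by (simp only: sym)
  show "polar_form Q (smul c w) v = c * polar_form Q w v"
    using 2[of v c w] by (simp only: sym)
  show "polar_form Q v w = polar_form Q w v" by (rule sym)
  have "v + v = smul 2 v" using scale_left_distrib[of 1 1 v] by simp
  then have "Q (v + v) = 4 * Q v" using assms by (simp add: quadratic_form_def)
  then show "polar_form Q v v = 2 * Q v" by (simp add: polar_form_def)
qed

end

text \<open>As \<open>e\<close> and \<open>f\<close> are dual to each other, pairing with \<open>f\<^sub>i\<close> gives the coordinate of \<open>e\<^sub>i\<close> and vice versa.\<close>

locale polarized = complex_space smul for smul :: "complex \<Rightarrow> 'v \<Rightarrow> 'v::ab_group_add" +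
  fixes Q :: "'v \<Rightarrow> complex" and n :: nat and e f :: "nat \<Rightarrow> 'v"
  assumes Q: "quadratic_form smul Q"
    and ee: "i < n \<Longrightarrow> j < n \<Longrightarrow> polar_form Q (e i) (e j) = 0"
    and ff: "i < n \<Longrightarrow> j < n \<Longrightarrow> polar_form Q (f i) (f j) = 0"
    and ef: "i < n \<Longrightarrow> j < n \<Longrightarrow> polar_form Q (e i) (f j) = (if i = j then 1 else 0)"
    and expand: "v = (\<Sum>i<n. smul (polar_form Q (f i) v) (e i)) + (\<Sum>i<n. smul (polar_form Q (e i) v) (f i))"

text \<open>On a basis \<open>e\<close> of \<open>W\<close>, nondegeneracy makes the functionals
  \<open>polar_form Q (e i)\<close> independent, which gives dual vectors \<open>f'\<close>. A
  correction inside \<open>W\<close> makes these isotropic, and the resulting \<open>2 * n\<close>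
  vectors are independent, hence span the whole space.\<close>

lemma (in complex_space) exists_polarization:
  assumes n: "n \<ge> 1" and dim: "dim (UNIV :: 'v set) = 2 * n" and Q: "quadratic_form smul Q"
    and nd: "nondegenerate Q" and W: "W \<in> isotropic_subspaces smul Q n"
  obtains e f where "polarized smul Q n e f" "W = span (e ` {..<n})"
proof -
  let ?B = "polar_form Q"
  note B = polar_form_laws[OF Q]
  have Bsum: "?B v (\<Sum>k\<in>A. smul (c k) (u k)) = (\<Sum>k\<in>A. c k * ?B v (u k))" for A :: "nat set" and v c u
  proof -
    interpret b: Vector_Spaces.linear smul "(*)" "?B v" by (rule B(7))
    show ?thesis by (simp add: b.sum b.scale)
  qed
  have W': "subspace W" "dim W = n" "\<And>v. v \<in> W \<Longrightarrow> Q v = 0"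
    using W by (auto simp: isotropic_subspaces_def)
  obtain b where b: "b \<subseteq> W" "independent b" "W \<subseteq> span b" "card b = dim W"
    using basis_exists by blast
  have finb: "finite b" using b(4) W'(2) n by (intro card_ge_0_finite) simp
  have spanb: "span b = W" using b span_minimal[OF b(1) W'(1)] by blast
  obtain e where e: "bij_betw e {..<n} b"
    using ex_bij_betw_nat_finite[OF finb] b(4) W'(2) by (auto simp: lessThan_atLeast0)
  have eW: "e i \<in> W" if "i < n" for i using e b(1) that by (auto simp: bij_betw_def)
  have ee: "?B (e i) (e j) = 0" if "i < n" "j < n" for i j
    using W'(3) eW that subspace_add[OF W'(1)] by (simp add: polar_form_def)
  have "\<exists>v. \<forall>i<n. ?B (e i) v = (if i = j then 1 else 0)" if j: "j < n" for j
  proof (rule dual_vectors[of n smul "\<lambda>i. ?B (e i)", OF _ _ j])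
    show "Vector_Spaces.linear smul (*) (?B (e i))" for i by (rule B(7))
    fix c assume c: "\<And>v. (\<Sum>i<n. c i * ?B (e i) v) = 0"
    have "?B (\<Sum>i<n. smul (c i) (e i)) v = 0" for v
      using c[of v] by (simp add: B(5)[of _ v] Bsum)
    then have s: "(\<Sum>i<n. smul (c i) (e i)) = 0" using nd by (simp add: nondegenerate_def)
    have inj: "inj_on e {..<n}" and im: "e ` {..<n} = b" using e by (auto simp: bij_betw_def)
    have "(\<Sum>x\<in>b. smul (c (the_inv_into {..<n} e x)) x) = 0"
      unfolding im[symmetric] sum.reindex[OF inj] using s by (simp add: the_inv_into_f_f[OF inj])
    then have "c (the_inv_into {..<n} e x) = 0" if "x \<in> b" for x
      by (rule independentD[OF b(2) finb order_refl _ that])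
    from this[of "e j"] show "c j = 0" using j im by (auto simp: the_inv_into_f_f[OF inj])
  qed
  then obtain f' where f': "\<And>i j. i < n \<Longrightarrow> j < n \<Longrightarrow> ?B (e i) (f' j) = (if i = j then 1 else 0)"
    by metis
  \<comment> \<open>Subtracting half the Gram matrix of \<open>f'\<close> cancels the pairings among
    the \<open>f'\<close>, one half coming from each argument. The pairing with \<open>e\<close> is
    unchanged because the \<open>e k\<close> are mutually orthogonal.\<close>
  define f where "f j = f' j + smul (- 1 / 2) (\<Sum>k<n. smul (?B (f' j) (f' k)) (e k))" for j
  have ef: "?B (e i) (f j) = (if i = j then 1 else 0)" if "i < n" "j < n" for i j
  proof -
    have "(\<Sum>k<n. ?B (f' j) (f' k) * ?B (e i) (e k)) = 0"
      using ee that by (intro sum.neutral) auto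
    then show ?thesis using f' that by (simp only: f_def B(1,2) Bsum) simp
  qed
  have ff: "?B (f i) (f j) = 0" if ij: "i < n" "j < n" for i j
  proof -
    have "?B (f i) (f j) = ?B (f i) (f' j) - 1/2 * (\<Sum>k<n. ?B (f' j) (f' k) * ?B (f i) (e k))"
      unfolding f_def[of j] by (simp only: B(1,2) Bsum) simp
    also have "(\<Sum>k<n. ?B (f' j) (f' k) * ?B (f i) (e k)) = (\<Sum>k<n. if k = i then ?B (f' j) (f' i) else 0)"
      by (intro sum.cong refl) (use ef ij in \<open>auto simp: B(5)[of "f i"]\<close>)
    also have "\<dots> = ?B (f' j) (f' i)" using ij by simp
    also have "?B (f i) (f' j) = ?B (f' j) (f' i) - 1/2 * (\<Sum>k<n. ?B (f' i) (f' k) * ?B (f' j) (e k))"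
      unfolding B(5)[of "f i"] unfolding f_def[of i] by (simp only: B(1,2) Bsum) simp
    also have "(\<Sum>k<n. ?B (f' i) (f' k) * ?B (f' j) (e k)) = (\<Sum>k<n. if k = j then ?B (f' i) (f' j) else 0)"
      by (intro sum.cong refl) (use f' ij in \<open>auto simp: B(5)[of "f' j"]\<close>)
    also have "\<dots> = ?B (f' i) (f' j)" using ij by simp
    finally show ?thesis using B(5)[of "f' i" "f' j"] by simp
  qed
  define u where "u = case_sum e f"
  define \<xi> where "\<xi> = case_sum (\<lambda>i. ?B (f i)) (\<lambda>i. ?B (e i))"
  define K where "K = {..<n} <+> {..<n}"
  have finK: "finite K" and cardK: "card K = 2 * n"
    by (auto simp: K_def card_Plus)
  have dual: "\<xi> k (u l) = (if k = l then 1 else 0)" if "k \<in> K" "l \<in> K" for k l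
    using that ee ef ff unfolding K_def \<xi>_def u_def
    by (auto simp: B(5)[of "f _" "e _"] split: if_splits)
  have lin\<xi>: "Vector_Spaces.linear smul (*) (\<xi> k)" for k
    using B(7) by (cases k) (auto simp: \<xi>_def)
  note ind = independent_if_dual_functionals[of K \<xi> u, OF finK lin\<xi> dual]
  have cardu: "card (u ` K) = 2 * n" using ind(1) cardK by (simp add: card_image)
  have spanU: "v \<in> span (u ` K)" for v
  proof (rule ccontr)
    assume v: "v \<notin> span (u ` K)"
    then have "independent (insert v (u ` K))" using ind(2) by (rule independent_insertI)
    moreover obtain b0 where b0: "independent b0" "(UNIV :: 'v set) \<subseteq> span b0" "card b0 = 2 * n"
      using basis_exists[of UNIV] dim by metis
    moreover have "finite b0" using b0(3) n by (intro card_ge_0_finite) simp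
    ultimately have "card (insert v (u ` K)) \<le> card b0"
      using independent_span_bound[of b0 "insert v (u ` K)"] by blast
    moreover have "v \<notin> u ` K" using v span_base by blast
    ultimately show False using b0(3) cardu finK by simp
  qed
  have expand: "v = (\<Sum>i<n. smul (?B (f i) v) (e i)) + (\<Sum>i<n. smul (?B (e i) v) (f i))" for v
  proof -
    \<comment> \<open>The error of the expansion is orthogonal to every \<open>e j\<close> and
      \<open>f j\<close>, hence to the whole space, and nondegeneracy makes it zero.\<close>
    define v' where "v' = (\<Sum>i<n. smul (?B (f i) v) (e i)) + (\<Sum>i<n. smul (?B (e i) v) (f i)) + smul (-1) v"
    have e0: "?B (e j) v' = 0" if j: "j < n" for j
    proof -
      have "(\<Sum>i<n. ?B (f i) v * ?B (e j) (e i)) = 0" using ee j by (intro sum.neutral) auto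
      moreover have "(\<Sum>i<n. ?B (e i) v * ?B (e j) (f i)) = (\<Sum>i<n. if i = j then ?B (e j) v else 0)"
        using ef j by (intro sum.cong refl) auto
      ultimately show ?thesis using j by (simp only: v'_def B(1,2) Bsum) simp
    qed
    have f0: "?B (f j) v' = 0" if j: "j < n" for j
    proof -
      have "(\<Sum>i<n. ?B (e i) v * ?B (f j) (f i)) = 0" using ff j by (intro sum.neutral) auto
      moreover have "(\<Sum>i<n. ?B (f i) v * ?B (f j) (e i)) = (\<Sum>i<n. if i = j then ?B (f j) v else 0)"
        using ef j by (intro sum.cong refl) (auto simp: B(5)[of "f j"])
      ultimately show ?thesis using j by (simp only: v'_def B(1,2) Bsum) simp
    qed
    have "subspace {w. ?B v' w = 0}"
      by (auto simp: subspace_def B(1,2)) (use B(2)[of v' 0 0] in simp)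
    moreover have "u ` K \<subseteq> {w. ?B v' w = 0}"
      using e0 f0 by (auto simp: u_def K_def B(5)[of v'])
    ultimately have "span (u ` K) \<subseteq> {w. ?B v' w = 0}" by (intro span_minimal)
    then have "v' = 0" using nd spanU unfolding nondegenerate_def by blast
    then show ?thesis by (simp add: v'_def eq_neg_iff_add_eq_0 flip: minus_equation_iff)
  qed
  have "polarized smul Q n e f"
    by unfold_locales (use Q ee ef ff expand in auto)
  moreover have "W = span (e ` {..<n})" using spanb e by (simp add: bij_betw_def)
  ultimately show thesis by (rule that)
qed

context polarized
begin

abbreviation B :: "'v \<Rightarrow> 'v \<Rightarrow> complex" where "B \<equiv> polar_form Q"

lemmas B_laws = polar_form_laws[OF Q]

lemma B_sum: "B v (\<Sum>k\<in>A. smul (c k) (u k)) = (\<Sum>k\<in>A. c k * B v (u k))"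
proof -
  interpret b: Vector_Spaces.linear smul "(*)" "B v" by (rule B_laws)
  show ?thesis by (simp add: b.sum b.scale)
qed

lemma fe: "i < n \<Longrightarrow> j < n \<Longrightarrow> B (f i) (e j) = (if i = j then 1 else 0)"
  using ef[of j i] by (auto simp: B_laws(5)[of "f i"])

section \<open>Graphs of skew maps\<close>

definition graph_vec :: "(nat \<Rightarrow> nat \<Rightarrow> complex) \<Rightarrow> nat \<Rightarrow> 'v" where
  "graph_vec A i = e i + (\<Sum>j<n. smul (A i j) (f j))"

definition graph_list :: "(nat \<Rightarrow> nat \<Rightarrow> complex) \<Rightarrow> 'v list" where
  "graph_list A = map (graph_vec A) [0..<n]"

definition skew :: "(nat \<Rightarrow> nat \<Rightarrow> complex) \<Rightarrow> bool" where
  "skew A \<longleftrightarrow> (\<forall>i<n. \<forall>j<n. A i j = - A j i)"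

lemma length_graph_list [simp]: "length (graph_list A) = n"
  by (simp add: graph_list_def)

lemma set_graph_list: "set (graph_list A) = graph_vec A ` {..<n}"
  by (simp add: graph_list_def lessThan_atLeast0)

lemma B_graph_vec:
  assumes "i < n" "j < n"
  shows "B (f i) (graph_vec A j) = (if i = j then 1 else 0)" "B (e i) (graph_vec A j) = A j i"
proof -
  have "(\<Sum>k<n. A j k * B (f i) (f k)) = 0" using ff assms by (intro sum.neutral) auto
  then show "B (f i) (graph_vec A j) = (if i = j then 1 else 0)"
    using assms by (simp add: graph_vec_def B_laws(1,2) B_sum fe)
  have "(\<Sum>k<n. A j k * B (e i) (f k)) = (\<Sum>k<n. if k = i then A j i else 0)"
    using ef assms by (intro sum.cong refl) auto
  then show "B (e i) (graph_vec A j) = A j i"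
    using assms by (simp add: graph_vec_def B_laws(1,2) B_sum ee)
qed

lemma B_graph_graph:
  assumes "i < n" "j < n"
  shows "B (graph_vec A i) (graph_vec A j) = A i j + A j i"
proof -
  have "B (graph_vec A i) (graph_vec A j) = B (graph_vec A j) (e i) + (\<Sum>k<n. A i k * B (graph_vec A j) (f k))"
    unfolding B_laws(5)[of "graph_vec A i"] unfolding graph_vec_def[of A i] by (simp add: B_laws(1,2) B_sum)
  also have "\<dots> = A j i + (\<Sum>k<n. if k = j then A i j else 0)"
    using B_graph_vec assms
    by (intro arg_cong2[where f = "(+)"] sum.cong refl) (auto simp: B_laws(5)[of "graph_vec A j"])
  finally show ?thesis using assms by simp
qed

text \<open>By \<open>B_graph_graph\<close> the pairings of the basis vectors measure exactly the
  failure of skewness. Isotropy for \<open>Q\<close> follows from isotropy for \<open>B\<close>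
  because \<open>B v v = 2 * Q v\<close>.\<close>

lemma graph_isotropic:
  assumes A: "skew A"
  shows "span (set (graph_list A)) \<in> isotropic_subspaces smul Q n"
proof -
  let ?G = "graph_vec A ` {..<n}"
  have gg: "B v w = 0" if vw: "v \<in> ?G" "w \<in> ?G" for v w
  proof -
    obtain i where i: "i < n" "v = graph_vec A i" using vw(1) by blast
    obtain j where j: "j < n" "w = graph_vec A j" using vw(2) by blast
    note ij = i(1) j(1) i(2) j(2)
    moreover have "A i j = - A j i" using A ij unfolding skew_def by blast
    ultimately show ?thesis by (simp add: B_graph_graph)
  qed
  have sub: "subspace {w. B v w = 0}" for v
    by (auto simp: subspace_def B_laws(1,2)) (use B_laws(2)[of v 0 0] in simp)
  have 1: "B v w = 0" if "v \<in> ?G" "w \<in> span ?G" for v w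
    using span_minimal[OF _ sub[of v], of ?G] gg that by blast
  have 2: "B v w = 0" if "v \<in> span ?G" "w \<in> span ?G" for v w
    using span_minimal[OF _ sub[of w], of ?G] 1 that by (auto simp: B_laws(5)[of w])
  have "Q v = 0" if "v \<in> span ?G" for v
    using 2[OF that that] by (simp add: B_laws(6))
  moreover have "dim (span ?G) = n"
  proof -
    have "inj_on (graph_vec A) {..<n}" "independent ?G"
      by (rule independent_if_dual_functionals[of "{..<n}" "\<lambda>i. B (f i)"]; simp add: B_laws B_graph_vec)+
    then show ?thesis by (simp add: dim_eq_card_independent card_image)
  qed
  ultimately show ?thesis
    by (simp add: isotropic_subspaces_def set_graph_list)
qed

text \<open>The Pluecker coordinate belonging to the wedge of the \<open>e i\<close>. It is nonzero
  on an \<open>n\<close>-dimensional subspace exactly when the subspace projects isomorphically onto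
  the span of \<open>e\<close> along the span of \<open>f\<close>.\<close>

definition chart_form :: "'v list \<Rightarrow> complex" where
  "chart_form = det_form n (\<lambda>i. B (f i))"

lemma altform_chart_form: "altform n chart_form"
  unfolding chart_form_def by (intro altform_det_form B_laws)

lemma chart_form_graph [simp]: "wedge smul n (graph_list A) chart_form = 1"
proof -
  have "chart_form (graph_list A) = 1"
    unfolding chart_form_def by (rule det_form_dual) (simp add: graph_list_def B_graph_vec)
  then show ?thesis by (simp add: wedge_def altform_chart_form)
qed

lemma graph_nonzero: "wedge smul n (graph_list A) \<noteq> 0"
  using chart_form_graph[of A] by (metis zero_fun_apply zero_neq_one)

lemma pluecker_graph: "pluecker smul n (span (set (graph_list A))) = line (wedge smul n (graph_list A))"
  by (simp add: pluecker_def exterior_power_eq_line)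

text \<open>A nonzero chart coordinate says that the \<open>e\<close>-coordinates of a basis of
  \<open>W\<close> form an invertible matrix \<open>M\<close>. Multiplying the basis by the inverse
  \<open>N\<close> normalizes this block to the identity, and isotropy makes the other block
  skew.\<close>

lemma chart_form_nonzero_imp_graph:
  assumes n: "n \<ge> 1" and W: "W \<in> isotropic_subspaces smul Q n"
    and x: "x \<in> pluecker smul n W" "x chart_form \<noteq> 0"
  obtains A where "skew A" "pluecker smul n W = line (wedge smul n (graph_list A))"
proof -
  have W': "subspace W" "dim W = n" "\<And>v. v \<in> W \<Longrightarrow> Q v = 0"
    using W by (auto simp: isotropic_subspaces_def)
  obtain b where b: "b \<subseteq> W" "independent b" "W \<subseteq> span b" "card b = dim W"
    using basis_exists by blast
  have finb: "finite b" using b(4) W'(2) n by (intro card_ge_0_finite) simp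
  obtain us where us: "set us = b" "distinct us" using finite_distinct_list[OF finb] by blast
  have len: "length us = n" using us b(4) W'(2) by (metis distinct_card)
  have spanW: "W = span (set us)" using b us span_minimal[OF b(1) W'(1)] by blast
  have pl: "pluecker smul n W = line (wedge smul n us)"
    unfolding pluecker_def spanW by (rule exterior_power_eq_line[OF len])
  obtain c where "x = fscale c (wedge smul n us)" using x(1) unfolding pl by (auto simp: cfun.span_singleton)
  then have nz: "chart_form us \<noteq> 0" using x(2) by (auto simp: fscale_def wedge_def altform_chart_form)
  define M where "M = Matrix.mat n n (\<lambda>(i, j). B (f j) (us ! i))"
  have M: "M \<in> carrier_mat n n" by (simp add: M_def)
  have det: "Determinant.det M \<noteq> 0" using nz by (simp add: M_def chart_form_def det_form_def)
  define N where "N i k = adj_mat M $$ (i, k) / Determinant.det M" for i k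
  have adj: "adj_mat M \<in> carrier_mat n n" "adj_mat M * M = Determinant.det M \<cdot>\<^sub>m 1\<^sub>m n"
    using adj_mat[OF M] by auto
  have NM: "(\<Sum>k<n. N i k * B (f j) (us ! k)) = (if i = j then 1 else 0)" if "i < n" "j < n" for i j
  proof -
    have "(adj_mat M * M) $$ (i, j) = (\<Sum>k<n. adj_mat M $$ (i, k) * B (f j) (us ! k))"
      using that adj(1) M by (subst index_mult_mat) (auto simp: M_def scalar_prod_def lessThan_atLeast0)
    then have "(\<Sum>k<n. adj_mat M $$ (i, k) * B (f j) (us ! k)) = (if i = j then Determinant.det M else 0)"
      using that unfolding adj(2) by (auto split: if_splits)
    moreover have "(\<Sum>k<n. N i k * B (f j) (us ! k)) = (\<Sum>k<n. adj_mat M $$ (i, k) * B (f j) (us ! k)) / Determinant.det M"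
      by (simp add: N_def sum_divide_distrib)
    ultimately show ?thesis using det by simp
  qed
  define g where "g i = (\<Sum>k<n. smul (N i k) (us ! k))" for i
  have gW: "g i \<in> W" for i
    unfolding g_def spanW by (intro span_sum span_scale span_base) (use len in auto)
  define A where "A i j = B (e j) (g i)" for i j
  have gA: "g i = graph_vec A i" if i: "i < n" for i
  proof -
    have "(\<Sum>j<n. smul (B (f j) (g i)) (e j)) = (\<Sum>j<n. if j = i then e i else 0)"
      using NM[OF i] by (intro sum.cong refl) (auto simp: g_def B_sum)
    also have "\<dots> = e i" using i by simp
    finally show ?thesis using expand[of "g i"] by (simp add: graph_vec_def A_def)
  qed
  have "skew A"
    unfolding skew_def
  proof (intro allI impI)
    fix i j assume ij: "i < n" "j < n"
    have "B (g i) (g j) = 0" using W'(3) gW subspace_add[OF W'(1)] by (simp add: polar_form_def)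
    then have "A i j + A j i = 0" using ij by (simp add: gA B_graph_graph)
    then show "A i j = - A j i" by (simp add: eq_neg_iff_add_eq_0)
  qed
  moreover have "pluecker smul n W = line (wedge smul n (graph_list A))"
  proof -
    have "set (graph_list A) \<subseteq> span (set us)"
      using gW gA by (auto simp: set_graph_list spanW[symmetric]) (metis gA gW)
    then have "wedge smul n (graph_list A) \<in> line (wedge smul n us)"
      by (intro wedge_in_line len) auto
    then show ?thesis unfolding pl using line_eqI[OF _ graph_nonzero] by blast
  qed
  ultimately show thesis by (rule that)
qed

end

section \<open>Forms vanishing on a chart\<close>

context complex_space
begin

lemma altform_cons:
  assumes G: "altform m G"
  shows "Suc (length ws) = m \<Longrightarrow> G ((v + w) # ws) = G (v # ws) + G (w # ws)"
    "Suc (length ws) = m \<Longrightarrow> G (smul c v # ws) = c * G (v # ws)"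
    "Suc (Suc (length ws)) = m \<Longrightarrow> G (x # (v + w) # ws) = G (x # v # ws) + G (x # w # ws)"
    "Suc (Suc (length ws)) = m \<Longrightarrow> G (x # smul c v # ws) = c * G (x # v # ws)"
    "Suc (Suc (Suc (length ws))) = m \<Longrightarrow> G (x # y # (v + w) # ws) = G (x # y # v # ws) + G (x # y # w # ws)"
    "Suc (Suc (Suc (length ws))) = m \<Longrightarrow> G (x # y # smul c v # ws) = c * G (x # y # v # ws)"
  using altform_slot(1,2)[OF G, of "[]" ws] altform_slot(1,2)[OF G, of "[x]" ws]
    altform_slot(1,2)[OF G, of "[x, y]" ws] by auto

lemma altform_cons_swap:
  assumes G: "altform m G"
  shows "Suc (Suc (length ws)) = m \<Longrightarrow> G (v # w # ws) = - G (w # v # ws)"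
    "Suc (Suc (Suc (length ws))) = m \<Longrightarrow> G (x # v # w # ws) = - G (x # w # v # ws)"
  by (rule altform_swap_adj[OF G, of "[]" ws v w, simplified]
      altform_swap_adj[OF G, of "[x]" ws v w, simplified]; assumption)+

lemma altform_Cons: "altform (Suc m) G \<Longrightarrow> altform m (\<lambda>ws. G (u # ws))"
proof (rule altformI)
  fix xs ys :: "'v list" and v w c
  assume G: "altform (Suc m) G" and l: "length xs + length ys + 1 = m"
  show "G (u # xs @ (v + w) # ys) = G (u # xs @ v # ys) + G (u # xs @ w # ys)"
    using altform_slot(1)[OF G, of "u # xs" ys] l by simp
  show "G (u # xs @ smul c v # ys) = c * G (u # xs @ v # ys)"
    using altform_slot(2)[OF G, of "u # xs" ys] l by simp
next
  fix vs :: "'v list" assume G: "altform (Suc m) G" and "length vs = m" "\<not> distinct vs"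
  then show "G (u # vs) = 0" by (intro altform_not_distinct[OF G]) auto
qed

lemma altform_add: "altform m G \<Longrightarrow> altform m H \<Longrightarrow> altform m (\<lambda>ws. G ws + H ws)"
  by (rule altformI) (simp_all add: altform_slot altform_not_distinct algebra_simps)

lemma altform_diff: "altform m G \<Longrightarrow> altform m H \<Longrightarrow> altform m (\<lambda>ws. G ws - H ws)"
  by (rule altformI) (simp_all add: altform_slot altform_not_distinct algebra_simps)

end

lemma quadratic_zero:
  fixes a b c :: complex
  assumes "\<And>s. a + s * b + s\<^sup>2 * c = 0"
  shows "a = 0" "b = 0" "c = 0"
proof -
  show a: "a = 0" using assms[of 0] by simp
  have 1: "b + c = 0" using assms[of 1] a by simp
  have "c - b = 0" using assms[of "-1"] a by simp
  then have "2 * c = 0" using 1 by (simp add: algebra_simps)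
  then show "c = 0" by simp
  then show "b = 0" using 1 by simp
qed

context polarized
begin

text \<open>Restricting to one block of indices after the other turns a form that vanishes on all graphs
  into forms of lower degree with the same property.\<close>

definition vanishes :: "nat list \<Rightarrow> ('v list \<Rightarrow> complex) \<Rightarrow> bool" where
  "vanishes xs G \<longleftrightarrow> altform (length xs) G \<and> distinct xs \<and> set xs \<subseteq> {..<n} \<and>
     (\<forall>A. (\<forall>i j. A i j = - A j i) \<and> (\<forall>i j. i \<notin> set xs \<longrightarrow> A i j = 0) \<longrightarrow> G (map (graph_vec A) xs) = 0)"

lemma vanishesD:
  assumes "vanishes xs G" "\<And>i j. A i j = - A j i" "\<And>i j. i \<notin> set xs \<Longrightarrow> A i j = 0"
  shows "G (map (graph_vec A) xs) = 0"
  using assms unfolding vanishes_def by blast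

lemma graph_vec_0: "(\<And>j. j < n \<Longrightarrow> A i j = 0) \<Longrightarrow> graph_vec A i = e i"
  by (simp add: graph_vec_def)

lemma vanishesI:
  assumes "altform (length xs) G" "distinct xs" "set xs \<subseteq> {..<n}"
    and "\<And>A. (\<And>i j. A i j = - A j i) \<Longrightarrow> (\<And>i j. i \<notin> set xs \<Longrightarrow> A i j = 0) \<Longrightarrow>
      G (map (graph_vec A) xs) = 0"
  shows "vanishes xs G"
  unfolding vanishes_def using assms by blast

lemma vanishes_Cons:
  assumes v: "vanishes (a # xs) G"
  shows "vanishes xs (\<lambda>ws. G (e a # ws))"
proof (rule vanishesI)
  show "altform (length xs) (\<lambda>ws. G (e a # ws))"
    using v by (intro altform_Cons) (simp add: vanishes_def)
  fix A :: "nat \<Rightarrow> nat \<Rightarrow> complex"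
  assume A: "\<And>i j. A i j = - A j i" "\<And>i j. i \<notin> set xs \<Longrightarrow> A i j = 0"
  have "a \<notin> set xs" using v by (simp add: vanishes_def)
  then have "graph_vec A a = e a" using A(2) by (intro graph_vec_0)
  moreover have "G (map (graph_vec A) (a # xs)) = 0"
    by (rule vanishesD[OF v A(1)]) (simp add: A(2))
  ultimately show "G (e a # map (graph_vec A) xs) = 0" by simp
qed (use v in \<open>auto simp: vanishes_def\<close>)

text \<open>The elementary skew matrix of an edge between two indices; adding a multiple of it to a
  matrix changes only two rows.\<close>

definition edge :: "nat \<Rightarrow> nat \<Rightarrow> nat \<Rightarrow> nat \<Rightarrow> complex" where
  "edge a b i j = (if i = a \<and> j = b then 1 else 0) - (if i = b \<and> j = a then 1 else 0)"

lemma graph_vec_edge: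
  assumes "a < n" "b < n" "a \<noteq> b"
  shows "graph_vec (\<lambda>i j. A i j + s * edge a b i j) i =
    graph_vec A i + (if i = a then smul s (f b) else if i = b then smul (- s) (f a) else 0)"
proof -
  have "(\<Sum>j<n. smul (A i j + s * edge a b i j) (f j)) =
      (\<Sum>j<n. smul (A i j) (f j)) + (\<Sum>j<n. smul (s * edge a b i j) (f j))"
    by (simp add: scale_left_distrib sum.distrib)
  also have "(\<Sum>j<n. smul (s * edge a b i j) (f j)) =
     (\<Sum>j<n. if j = (if i = a then b else a) then
        (if i = a then smul s (f b) else if i = b then smul (- s) (f a) else 0) else 0)"
    using assms by (intro sum.cong refl) (auto simp: edge_def)
  also have "\<dots> = (if i = a then smul s (f b) else if i = b then smul (- s) (f a) else 0)"
    using assms by (subst sum.delta) auto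
  finally show ?thesis by (simp add: graph_vec_def)
qed

lemma edge_skew: "edge a b i j = - edge a b j i"
  by (simp add: edge_def conj_commute)

text \<open>As \<open>a\<close> and \<open>b\<close> lie outside the support of \<open>A\<close>,
  adding \<open>s\<close> times the edge between them changes just the first two entries of the
  list. The value of the form becomes a quadratic polynomial in \<open>s\<close>, and the two claims
  concern its linear coefficient (up to sign) and its leading one.\<close>

lemma vanishes_edge:
  assumes v: "vanishes (a # b # xs) G"
    and A: "\<And>i j. A i j = - A j i" "\<And>i j. i \<notin> set xs \<Longrightarrow> A i j = 0"
  shows "G (e a # f a # map (graph_vec A) xs) + G (e b # f b # map (graph_vec A) xs) = 0" (is ?th1)
    and "G (f a # f b # map (graph_vec A) xs) = 0" (is ?th2)
proof -
  have G: "altform (Suc (Suc (length xs))) G" and ab: "a < n" "b < n" "a \<noteq> b" "a \<notin> set xs" "b \<notin> set xs"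
    using v by (auto simp: vanishes_def)
  define ws where "ws = map (graph_vec A) xs"
  have len: "Suc (Suc (length ws)) = Suc (Suc (length xs))" by (simp add: ws_def)
  have "G (e a # e b # ws) + s * (- (G (e a # f a # ws) + G (e b # f b # ws))) + s\<^sup>2 * G (f a # f b # ws) = 0" for s
  proof -
    let ?A = "\<lambda>i j. A i j + s * edge a b i j"
    have "G (map (graph_vec ?A) (a # b # xs)) = 0"
    proof (rule vanishesD[OF v])
      show "?A i j = - ?A j i" for i j using A(1)[of i j] edge_skew[of a b i j] by simp
      show "?A i j = 0" if "i \<notin> set (a # b # xs)" for i j using A(2)[of i j] that by (auto simp: edge_def)
    qed
    moreover have "map (graph_vec ?A) xs = ws"
      unfolding ws_def by (intro map_cong refl) (use ab graph_vec_edge in auto)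
    moreover have "graph_vec ?A a = e a + smul s (f b)" "graph_vec ?A b = e b + smul (- s) (f a)"
      using ab A(2) by (simp_all add: graph_vec_edge graph_vec_0)
    ultimately have "G ((e a + smul s (f b)) # (e b + smul (- s) (f a)) # ws) = 0" by simp
    then have "G (e a # e b # ws) + s * G (f b # e b # ws) - s * G (e a # f a # ws) - s * s * G (f b # f a # ws) = 0"
      by (simp only: altform_cons[OF G] len length_Cons) (simp add: algebra_simps)
    then show ?thesis
      using altform_cons_swap(1)[OF G len, of "f b" "e b"] altform_cons_swap(1)[OF G len, of "f b" "f a"]
      by (simp add: algebra_simps power2_eq_square)
  qed
  note q = quadratic_zero[OF this]
  show ?th1 using q(2) unfolding ws_def by (simp only: neg_equal_0_iff_equal)
  show ?th2 using q(3) unfolding ws_def .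
qed

lemma vanishes_pair_ff:
  assumes v: "vanishes (a # b # xs) G"
  shows "vanishes xs (\<lambda>ws. G (f a # f b # ws))"
proof -
  have "altform (length xs) (\<lambda>ws. G (f a # f b # ws))"
    using v by (intro altform_Cons[of _ "\<lambda>ws. G (f a # ws)"] altform_Cons) (simp add: vanishes_def)
  then show ?thesis
  proof (rule vanishesI)
    fix A :: "nat \<Rightarrow> nat \<Rightarrow> complex"
    assume A: "\<And>i j. A i j = - A j i" "\<And>i j. i \<notin> set xs \<Longrightarrow> A i j = 0"
    show "G (f a # f b # map (graph_vec A) xs) = 0" by (rule vanishes_edge(2)[OF v A])
  qed (use v in \<open>simp_all add: vanishes_def\<close>)
qed

lemma vanishes_pair_ef:
  assumes v: "vanishes (a # b # xs) G"
  shows "vanishes xs (\<lambda>ws. G (e a # f a # ws) + G (e b # f b # ws))"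
proof -
  have "altform (length xs) (\<lambda>ws. G (e c # f c # ws))" for c
    using v by (intro altform_Cons[of _ "\<lambda>ws. G (e c # ws)"] altform_Cons) (simp add: vanishes_def)
  then have "altform (length xs) (\<lambda>ws. G (e a # f a # ws) + G (e b # f b # ws))"
    by (intro altform_add)
  then show ?thesis
  proof (rule vanishesI)
    fix A :: "nat \<Rightarrow> nat \<Rightarrow> complex"
    assume A: "\<And>i j. A i j = - A j i" "\<And>i j. i \<notin> set xs \<Longrightarrow> A i j = 0"
    show "G (e a # f a # map (graph_vec A) xs) + G (e b # f b # map (graph_vec A) xs) = 0"
      by (rule vanishes_edge(1)[OF v A])
  qed (use v in \<open>simp_all add: vanishes_def\<close>)
qed

text \<open>The index \<open>c\<close> is joined to \<open>a\<close> and to \<open>b\<close> with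
  independent weights \<open>s\<close> and \<open>t\<close>. The terms of the coefficient of
  \<open>s * t\<close> contain \<open>f c\<close> once and both vectors of one of the indices
  \<open>a\<close>, \<open>b\<close>. This accommodates the index left over when the number of
  common row and column indices is odd.\<close>

lemma vanishes_triple:
  assumes v: "vanishes (c # a # b # xs) G"
  shows "vanishes xs (\<lambda>ws. G (f c # e a # f a # ws) - G (f c # e b # f b # ws))"
proof -
  have G: "altform (Suc (Suc (Suc (length xs)))) G" and abc: "a < n" "b < n" "c < n" "a \<noteq> b" "c \<noteq> a" "c \<noteq> b"
    "a \<notin> set xs" "b \<notin> set xs" "c \<notin> set xs"
    using v by (auto simp: vanishes_def)
  have alt: "altform (length xs) (\<lambda>ws. G (f c # e d # f d # ws))" for d
    using G by (intro altform_Cons[of _ "\<lambda>ws. G (f c # e d # ws)"] altform_Cons[of _ "\<lambda>ws. G (f c # ws)"] altform_Cons)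
  have van: "G (f c # e a # f a # map (graph_vec A) xs) - G (f c # e b # f b # map (graph_vec A) xs) = 0"
    if A: "\<And>i j. A i j = - A j i" "\<And>i j. i \<notin> set xs \<Longrightarrow> A i j = 0" for A
  proof -
    define ws where "ws = map (graph_vec A) xs"
    have len: "Suc (Suc (Suc (length ws))) = Suc (Suc (Suc (length xs)))" by (simp add: ws_def)
    define H where "H s t = G ((e c + smul s (f a) + smul t (f b)) # (e a + smul (- s) (f c)) # (e b + smul (- t) (f c)) # ws)" for s t
    have H0: "H s t = 0" for s t
    proof -
      let ?A = "\<lambda>i j. A i j + s * edge c a i j"
      let ?A' = "\<lambda>i j. ?A i j + t * edge c b i j"
      have "G (map (graph_vec ?A') (c # a # b # xs)) = 0"
      proof (rule vanishesD[OF v])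
        show "?A' i j = - ?A' j i" for i j
          using A(1)[of i j] edge_skew[of c a i j] edge_skew[of c b i j] by simp
        show "?A' i j = 0" if "i \<notin> set (c # a # b # xs)" for i j
          using A(2)[of i j] that by (auto simp: edge_def)
      qed
      moreover have "graph_vec ?A' i = graph_vec A i + (if i = c then smul s (f a) else if i = a then smul (- s) (f c) else 0)
          + (if i = c then smul t (f b) else if i = b then smul (- t) (f c) else 0)" for i
        using abc graph_vec_edge[of c b ?A t i] graph_vec_edge[of c a A s i] by simp
      note gv = this
      moreover have "map (graph_vec ?A') xs = ws"
        unfolding ws_def gv by (intro map_cong refl) (use abc in auto)
      moreover have "graph_vec A c = e c" "graph_vec A a = e a" "graph_vec A b = e b"
        using abc A(2) by (simp_all add: graph_vec_0)
      ultimately show ?thesis using abc by (simp add: H_def)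
    qed
    let ?g = "\<lambda>u v w. G (u # v # w # ws)"
    have z: "?g u v v = 0" for u v
      using altform_cons_swap(2)[OF G len, of u v v] by simp
    have "H s t = ?g (e c) (e a) (e b) - t * ?g (e c) (e a) (f c) - s * ?g (e c) (f c) (e b)
       + s * ?g (f a) (e a) (e b) - s * t * ?g (f a) (e a) (f c) - s * s * ?g (f a) (f c) (e b)
       + t * ?g (f b) (e a) (e b) - t * t * ?g (f b) (e a) (f c) - s * t * ?g (f b) (f c) (e b)" for s t
      unfolding H_def by (simp only: altform_cons[OF G] len length_Cons) (simp add: z algebra_simps)
    \<comment> \<open>The alternating sum over the four choices of signs kills every monomial except
      \<open>s * t\<close>, which it multiplies by 4.\<close>
    then have "H 1 1 - H 1 (-1) - H (-1) 1 + H (-1) (-1) = - 4 * (?g (f a) (e a) (f c) + ?g (f b) (f c) (e b))"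
      by (simp only:) (simp add: algebra_simps)
    from this[symmetric] have "- 4 * (?g (f a) (e a) (f c) + ?g (f b) (f c) (e b)) = 0"
      by (simp only: H0 diff_zero add_0)
    then have "?g (f a) (e a) (f c) + ?g (f b) (f c) (e b) = 0"
      by (metis mult_eq_0_iff neg_equal_0_iff_equal zero_neq_numeral)
    moreover have "?g (f a) (e a) (f c) = - ?g (f c) (e a) (f a)"
      using altform_cons_swap(1)[OF G, of "f c # ws" "f a" "e a"] altform_cons_swap(2)[OF G len, of "e a" "f a" "f c"]
        altform_cons_swap(1)[OF G, of "f a # ws" "e a" "f c"] len by simp
    moreover have "?g (f b) (f c) (e b) = ?g (f c) (e b) (f b)"
      using altform_cons_swap(1)[OF G, of "e b # ws" "f b" "f c"] altform_cons_swap(2)[OF G len, of "f c" "f b" "e b"] len by simp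
    ultimately show ?thesis by (simp add: ws_def)
  qed
  from altform_diff[OF alt alt] show ?thesis
  proof (rule vanishesI)
    fix A :: "nat \<Rightarrow> nat \<Rightarrow> complex"
    assume A: "\<And>i j. A i j = - A j i" "\<And>i j. i \<notin> set xs \<Longrightarrow> A i j = 0"
    show "G (f c # e a # f a # map (graph_vec A) xs) - G (f c # e b # f b # map (graph_vec A) xs) = 0"
      by (rule van[OF A])
  qed (use v in \<open>simp_all add: vanishes_def\<close>)
qed

lemma vanishes_all_ff:
  "even (length C) \<Longrightarrow> vanishes (C @ xs) G \<Longrightarrow> vanishes xs (\<lambda>ws. G (map f C @ ws))"
proof (induct C arbitrary: G rule: induct_list012)
  case (3 a b C)
  then show ?case using vanishes_pair_ff[of a b "C @ xs" G] by simp
qed auto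

lemma vanishes_all_e: "vanishes N G \<Longrightarrow> G (map e N) = 0"
proof (induct N arbitrary: G)
  case Nil
  show ?case using vanishesD[OF Nil, of "\<lambda>_ _. 0"] by simp
next
  case (Cons a N)
  show ?case using Cons.hyps[OF vanishes_Cons[OF Cons.prems]] by simp
qed

abbreviation ef_list :: "nat list \<Rightarrow> 'v list" where
  "ef_list ps \<equiv> concat (map (\<lambda>p. [e p, f p]) ps)"

end

section \<open>Transversals of a matching\<close>

abbreviation flat :: "('a \<times> 'a) list \<Rightarrow> 'a list" where
  "flat ms \<equiv> concat (map (\<lambda>(a, b). [a, b]) ms)"

text \<open>Sums over the transversals of a list of disjoint pairs, as lists and as sets.\<close>

fun list_tsum :: "('a \<times> 'a) list \<Rightarrow> ('a list \<Rightarrow> complex) \<Rightarrow> complex" where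
  "list_tsum [] H = H []"
| "list_tsum ((a, b) # ms) H = list_tsum ms (\<lambda>cs. H (a # cs)) + list_tsum ms (\<lambda>cs. H (b # cs))"

fun tsum :: "('a set \<Rightarrow> complex) \<Rightarrow> ('a \<times> 'a) list \<Rightarrow> 'a set \<Rightarrow> complex" where
  "tsum F [] S = F S"
| "tsum F ((a, b) # ms) S = tsum F ms (insert a S) + tsum F ms (insert b S)"

lemma list_tsum_add: "list_tsum ms (\<lambda>cs. H cs + H' cs) = list_tsum ms H + list_tsum ms H'"
proof (induct ms arbitrary: H H')
  case (Cons m ms)
  then show ?case by (cases m) (simp add: algebra_simps)
qed simp

lemma list_tsum_diff: "list_tsum ms (\<lambda>cs. H cs - H' cs) = list_tsum ms H - list_tsum ms H'"
proof (induct ms arbitrary: H H')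
  case (Cons m ms)
  then show ?case by (cases m) (simp add: algebra_simps)
qed simp

text \<open>The list version follows the order in which pairs are split off a form, while exchanges
  are stated for the set version. The two agree as soon as the value depends only on the set of
  chosen elements.\<close>

lemma tsum_eq_list_tsum:
  assumes "distinct (flat ms)"
    and "\<And>cs. distinct cs \<Longrightarrow> set cs \<subseteq> set (flat ms) \<Longrightarrow> H cs = F (S \<union> set cs)"
  shows "tsum F ms S = list_tsum ms H"
  using assms
proof (induct ms H arbitrary: S rule: list_tsum.induct)
  case (1 H) then show ?case by simp
next
  case (2 a b ms H)
  have d: "distinct (flat ms)" "a \<notin> set (flat ms)" "b \<notin> set (flat ms)" using 2(3) by auto
  have H: "H (c # cs) = F (insert c S \<union> set cs)"
    if "c \<in> {a, b}" "distinct cs" "set cs \<subseteq> set (flat ms)" for c cs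
  proof -
    have "c \<notin> set (flat ms)" using that(1) d(2,3) by blast
    with that(3) have "c \<notin> set cs" by blast
    then have "distinct (c # cs)" using that(2) by simp
    moreover have "set (c # cs) \<subseteq> set (flat ((a, b) # ms))" using that by auto
    ultimately have "H (c # cs) = F (S \<union> set (c # cs))" by (rule 2(4))
    then show ?thesis by simp
  qed
  have "tsum F ms (insert a S) = list_tsum ms (\<lambda>cs. H (a # cs))"
    by (rule 2(1)[OF d(1) H]) auto
  moreover have "tsum F ms (insert b S) = list_tsum ms (\<lambda>cs. H (b # cs))"
    by (rule 2(2)[OF d(1) H]) auto
  ultimately show ?case by simp
qed

lemma tsum_add: "tsum (\<lambda>P. F P + c * F' P) ms S = tsum F ms S + c * tsum F' ms S"
  by (induct F ms S rule: tsum.induct) (auto simp: algebra_simps)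

text \<open>Passing to complements swaps the chosen and the rejected element of every pair, so the
  transversals of \<open>ms\<close> are merely permuted.\<close>

lemma tsum_complement:
  assumes "distinct (flat ms)" "set (flat ms) \<subseteq> D" "S \<subseteq> D" "S \<inter> set (flat ms) = {}"
  shows "tsum (\<lambda>P. F (D - P)) ms S = tsum F ms (D - S - set (flat ms))"
  using assms
proof (induct "\<lambda>P. F (D - P)" ms S rule: tsum.induct)
  case (1 S) then show ?case by simp
next
  case (2 a b ms S)
  have "tsum (\<lambda>P. F (D - P)) ms (insert a S) = tsum F ms (D - insert a S - set (flat ms))"
    by (intro 2(1)) (use 2 in auto)
  moreover have "tsum (\<lambda>P. F (D - P)) ms (insert b S) = tsum F ms (D - insert b S - set (flat ms))"
    by (intro 2(2)) (use 2 in auto)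
  moreover have "D - insert a S - set (flat ms) = insert b (D - S - set (flat ((a, b) # ms)))"
    "D - insert b S - set (flat ms) = insert a (D - S - set (flat ((a, b) # ms)))"
    using 2(3-6) by auto
  ultimately show ?case by simp
qed

text \<open>Exchanging an element of \<open>S\<close> for another element of \<open>Q\<close> changes the sign of the sum, and three
  exchanges in a circle are the identity.\<close>

lemma tsum_exchange:
  assumes D: "finite D"
    and base: "\<And>a b ms. a \<noteq> b \<Longrightarrow> {a, b} \<subseteq> D \<Longrightarrow> distinct (flat ms) \<Longrightarrow> set (flat ms) = D - {a, b} \<Longrightarrow> tsum F ms {a} = 0"
    and "Q \<subseteq> D" "S \<subseteq> Q" "card S = Suc k" "card Q = 2 * Suc k"
    and "distinct (flat ms)" "set (flat ms) = D - Q"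
  shows "tsum F ms S = 0"
  using assms(3-)
proof (induct k arbitrary: Q S ms)
  case 0
  then obtain a where a: "S = {a}" by (auto simp: card_1_singleton_iff)
  have "card (Q - {a}) = 1" using 0 a D by (subst card_Diff_singleton) auto
  then obtain b where b: "Q - {a} = {b}" by (auto simp: card_1_singleton_iff)
  then have Q: "Q = {a, b}" "a \<noteq> b" using 0 a by auto
  show ?case unfolding a by (rule base[of a b]) (use 0 Q in auto)
next
  case (Suc k)
  have finQ: "finite Q" using Suc.prems(1) D by (rule finite_subset)
  have finS: "finite S" using Suc.prems(2) finQ by (rule finite_subset)
  obtain a where a: "a \<in> S" using Suc.prems(3) by fastforce
  have "card (Q - S) = 2 * Suc (Suc k) - Suc (Suc k)"
    using Suc.prems finS by (simp add: card_Diff_subset)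
  then have "2 \<le> card (Q - S)" by simp
  then obtain T where "T \<subseteq> Q - S" "card T = 2" by (meson obtain_subset_with_card_n)
  then obtain b c where bc: "b \<in> Q - S" "c \<in> Q - S" "b \<noteq> c" by (auto simp: card_2_iff)
  define S' where "S' = S - {a}"
  have S': "card S' = Suc k" "S = insert a S'" "a \<notin> S'" using a Suc.prems(3) finS by (auto simp: S'_def)
  have step: "tsum F ms (insert x S') + tsum F ms (insert y S') = 0"
    if xy: "x \<in> Q" "y \<in> Q" "x \<noteq> y" "x \<notin> S'" "y \<notin> S'" for x y
  proof -
    \<comment> \<open>Moving \<open>x\<close> and \<open>y\<close> from \<open>Q\<close> into the
      matching makes the sum split into the two sums that differ by the exchange, and leaves a
      smaller instance for the induction hypothesis.\<close>
    have "tsum F ((x, y) # ms) S' = 0"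
    proof (rule Suc.hyps[of "Q - {x, y}"])
      show "card (Q - {x, y}) = 2 * Suc k" using Suc.prems(4) xy finQ by (simp add: card_Diff_subset)
    qed (use Suc.prems S' xy in auto)
    then show ?thesis by simp
  qed
  have ab: "tsum F ms (insert a S') + tsum F ms (insert b S') = 0"
    and ac: "tsum F ms (insert a S') + tsum F ms (insert c S') = 0"
    and bc': "tsum F ms (insert b S') + tsum F ms (insert c S') = 0"
    by (intro step; use bc a Suc.prems S' in auto)+
  have "2 * tsum F ms (insert a S') = (tsum F ms (insert a S') + tsum F ms (insert b S')) +
      (tsum F ms (insert a S') + tsum F ms (insert c S')) - (tsum F ms (insert b S') + tsum F ms (insert c S'))"
    by (simp add: algebra_simps)
  also have "\<dots> = 0" unfolding ab ac bc' by simp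
  finally have "tsum F ms (insert a S') = 0" by simp
  then show ?case using S' by simp
qed

section \<open>Extraction of single coefficients\<close>

context polarized
begin

text \<open>Each pair of \<open>ms\<close> contributes the linear coefficient of
  \<open>vanishes_edge\<close>, that is, a choice between the block of \<open>a\<close> and the
  block of \<open>b\<close>. When all pairs are used up, the remaining indices keep their
  \<open>e\<close>.\<close>

lemma list_tsum_vanishes:
  "vanishes (flat ms @ N) G \<Longrightarrow> list_tsum ms (\<lambda>cs. G (ef_list cs @ map e N)) = 0"
proof (induct ms arbitrary: G)
  case Nil
  then show ?case using vanishes_all_e by simp
next
  case (Cons m ms)
  obtain a b where m: "m = (a, b)" by fastforce
  have "list_tsum ms (\<lambda>cs. G (e a # f a # ef_list cs @ map e N) + G (e b # f b # ef_list cs @ map e N)) = 0"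
    using Cons.hyps[OF vanishes_pair_ef[of a b "flat ms @ N" G]] Cons.prems m by simp
  then show ?case by (simp add: m list_tsum_add)
qed

text \<open>Blocks of degree 2 commute: four adjacent transpositions exchange them, and the signs
  cancel.\<close>

lemma altform_ef_swap:
  assumes \<omega>: "altform m \<omega>" and "length (pre @ [e p, f p, e q, f q] @ post) = m"
  shows "\<omega> (pre @ e p # f p # e q # f q # post) = \<omega> (pre @ e q # f q # e p # f p # post)"
proof -
  have "\<omega> (pre @ e p # f p # e q # f q # post) = - \<omega> (pre @ e p # e q # f p # f q # post)"
    using altform_swap_adj[OF \<omega>, of "pre @ [e p]" "f q # post" "f p" "e q"] assms(2) by simp
  also have "\<omega> (pre @ e p # e q # f p # f q # post) = - \<omega> (pre @ e q # e p # f p # f q # post)"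
    using altform_swap_adj[OF \<omega>, of pre "f p # f q # post" "e p" "e q"] assms(2) by simp
  also have "\<omega> (pre @ e q # e p # f p # f q # post) = - \<omega> (pre @ e q # e p # f q # f p # post)"
    using altform_swap_adj[OF \<omega>, of "pre @ [e q, e p]" post "f p" "f q"] assms(2) by simp
  also have "\<omega> (pre @ e q # e p # f q # f p # post) = - \<omega> (pre @ e q # f q # e p # f p # post)"
    using altform_swap_adj[OF \<omega>, of "pre @ [e q]" "f p # post" "e p" "f q"] assms(2) by simp
  finally show ?thesis by simp
qed

lemma altform_ef_front:
  assumes \<omega>: "altform m \<omega>" and "length (pre @ ef_list (xs @ p # ys) @ post) = m"
  shows "\<omega> (pre @ ef_list (xs @ p # ys) @ post) = \<omega> (pre @ ef_list (p # xs @ ys) @ post)"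
  using assms(2)
proof (induct xs arbitrary: pre)
  case (Cons x xs)
  have "\<omega> (pre @ ef_list ((x # xs) @ p # ys) @ post) = \<omega> ((pre @ [e x, f x]) @ ef_list (xs @ p # ys) @ post)"
    by simp
  also have "\<dots> = \<omega> ((pre @ [e x, f x]) @ ef_list (p # xs @ ys) @ post)"
    by (rule Cons.hyps) (use Cons.prems in simp)
  also have "\<dots> = \<omega> (pre @ e x # f x # e p # f p # ef_list (xs @ ys) @ post)" by simp
  also have "\<dots> = \<omega> (pre @ e p # f p # e x # f x # ef_list (xs @ ys) @ post)"
    by (rule altform_ef_swap[OF \<omega>]) (use Cons.prems in simp)
  finally show ?case by simp
qed simp

lemma altform_ef_mset:
  assumes \<omega>: "altform m \<omega>" and "mset ps = mset qs" "length (pre @ ef_list ps @ post) = m"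
  shows "\<omega> (pre @ ef_list ps @ post) = \<omega> (pre @ ef_list qs @ post)"
  using assms(2,3)
proof (induct ps arbitrary: pre qs)
  case (Cons p ps)
  have "p \<in> set qs" using Cons.prems(1) by (metis list.set_intros(1) set_mset_mset)
  then obtain xs ys where qs: "qs = xs @ p # ys" by (meson split_list)
  have ms: "mset ps = mset (xs @ ys)" using Cons.prems(1) qs by simp
  then have len: "length ps = length (xs @ ys)" by (rule mset_eq_length)
  have lenef: "length (ef_list zs) = 2 * length zs" for zs by (induct zs) auto
  have "\<omega> (pre @ ef_list (p # ps) @ post) = \<omega> ((pre @ [e p, f p]) @ ef_list ps @ post)" by simp
  also have "\<dots> = \<omega> ((pre @ [e p, f p]) @ ef_list (xs @ ys) @ post)"
    by (rule Cons.hyps[OF ms]) (use Cons.prems in simp)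
  also have "\<dots> = \<omega> (pre @ ef_list (p # xs @ ys) @ post)" by simp
  also have "\<dots> = \<omega> (pre @ ef_list (xs @ p # ys) @ post)"
  proof (rule altform_ef_front[OF \<omega>, symmetric])
    show "length (pre @ ef_list (xs @ p # ys) @ post) = m"
      using Cons.prems(2) len by (simp add: lenef)
  qed
  finally show ?case by (simp add: qs)
qed simp

text \<open>The basis wedge for a minor with rows \<open>I\<close> and columns \<open>J\<close>:
  \<open>C\<close> lists their intersection, \<open>P\<close> consists of the columns that are not
  rows, and \<open>N\<close> lists the indices outside both. Replacing \<open>P\<close> by its
  complement in the symmetric difference exchanges \<open>I\<close> and \<open>J\<close>.\<close>

definition basis_list :: "nat list \<Rightarrow> nat set \<Rightarrow> nat list \<Rightarrow> 'v list" where
  "basis_list C P N = map f C @ ef_list (sorted_list_of_set P) @ map e N"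

lemma basis_list_eq:
  assumes \<omega>: "altform n \<omega>" and "distinct cs" "length (map f C @ ef_list cs @ map e N) = n"
  shows "\<omega> (map f C @ ef_list cs @ map e N) = \<omega> (basis_list C (set cs) N)"
  unfolding basis_list_def
  by (rule altform_ef_mset[OF \<omega> _ assms(3)]) (use assms(2) in \<open>simp add: set_eq_iff_mset_eq_distinct[symmetric]\<close>)

lemma length_ef_list: "length (ef_list zs) = 2 * length zs"
  by (induct zs) auto

lemma length_flat: "length (flat ms) = 2 * length ms"
  by (induct ms) auto

text \<open>The indices in \<open>C\<close> are used up in consecutive pairs by
  \<open>vanishes_all_ff\<close>, those in the matching by \<open>list_tsum_vanishes\<close>. For
  odd \<open>length C\<close> the last index of \<open>C\<close> shares the pair \<open>a\<close>,
  \<open>b\<close> through \<open>vanishes_triple\<close>, whose minus sign explains the factor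
  \<open>(-1) ^ length C\<close>.\<close>

lemma key_base:
  assumes \<omega>: "altform n \<omega>" and van: "\<And>A. skew A \<Longrightarrow> \<omega> (graph_list A) = 0"
    and dist: "distinct (C @ a # b # flat ms @ N)" "set (C @ a # b # flat ms @ N) = {..<n}"
  shows "tsum (\<lambda>P. \<omega> (basis_list C P N)) ms {a} +
     (-1) ^ length C * tsum (\<lambda>P. \<omega> (basis_list C P N)) ms {b} = 0"
proof -
  have len: "length xs = n" if "distinct xs" "set xs = {..<n}" for xs :: "nat list"
    using that distinct_card by fastforce
  have van': "vanishes xs \<omega>" if xs: "distinct xs" "set xs = {..<n}" for xs
  proof -
    have "mset xs = mset [0..<n]" using xs by (subst set_eq_iff_mset_eq_distinct[symmetric]) (auto simp: lessThan_atLeast0)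
    moreover have "length [0..<n] = n" by simp
    ultimately obtain \<sigma> where \<sigma>: "\<And>\<omega> u. altform n \<omega> \<Longrightarrow> \<omega> (map u xs) = (\<sigma>::complex) * \<omega> (map u [0..<n])"
      using altform_reorder by blast
    have "\<omega> (map (graph_vec A) xs) = 0" if "\<And>i j. A i j = - A j i" for A
    proof -
      have "skew A" unfolding skew_def using that by blast
      then show ?thesis using \<sigma>[OF \<omega>, of "graph_vec A"] van[of A] by (simp add: graph_list_def)
    qed
    then show ?thesis by (intro vanishesI) (use xs \<omega> len[OF xs] in \<open>blast | simp\<close>)+
  qed
  have lenC: "length C + 2 + 2 * length ms + length N = n"
    using len[OF dist] by (simp add: length_flat)
  have dms: "distinct (flat ms)" using dist(1) by simp
  \<comment> \<open>Transversals of \<open>ms\<close> have the length of \<open>ms\<close>, but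
    \<open>tsum_eq_list_tsum\<close> asks for every distinct \<open>cs\<close>. For other lengths,
    where the list of vectors has the wrong degree, the set-based value serves as a default.\<close>
  have "c \<in> {a, b} \<Longrightarrow> tsum (\<lambda>P. \<omega> (basis_list C P N)) ms {c} =
      list_tsum ms (\<lambda>cs. if length cs = length ms then \<omega> (map f C @ ef_list (c # cs) @ map e N) else \<omega> (basis_list C ({c} \<union> set cs) N))" for c
  proof (rule tsum_eq_list_tsum[OF dms])
    fix cs assume c: "c \<in> {a, b}" and cs: "distinct cs" "set cs \<subseteq> set (flat ms)"
    have "a \<notin> set (flat ms)" "b \<notin> set (flat ms)" using dist(1) by simp_all
    with c have "c \<notin> set (flat ms)" by blast
    with cs(2) have "c \<notin> set cs" by blast
    then have "distinct (c # cs)" using cs(1) by simp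
    then have "\<omega> (map f C @ ef_list (c # cs) @ map e N) = \<omega> (basis_list C (set (c # cs)) N)" if "length cs = length ms"
      using that lenC by (intro basis_list_eq[OF \<omega>]) (auto simp: length_ef_list)
    then show "(if length cs = length ms then \<omega> (map f C @ ef_list (c # cs) @ map e N) else \<omega> (basis_list C ({c} \<union> set cs) N)) = \<omega> (basis_list C ({c} \<union> set cs) N)"
      by simp
  qed
  moreover have lt: "list_tsum ms (\<lambda>cs. if length cs = length ms then H cs else H' cs) = list_tsum ms H" for H H'
    by (induct ms arbitrary: H H') auto
  ultimately have ts: "tsum (\<lambda>P. \<omega> (basis_list C P N)) ms {c} = list_tsum ms (\<lambda>cs. \<omega> (map f C @ ef_list (c # cs) @ map e N))"
    if "c \<in> {a, b}" for c using that by simp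
  show ?thesis
  proof (cases "even (length C)")
    case True
    have "vanishes (flat ((a, b) # ms) @ N) (\<lambda>ws. \<omega> (map f C @ ws))"
      using van'[OF dist] True by (intro vanishes_all_ff) auto
    from list_tsum_vanishes[OF this] show ?thesis
      using True by (simp add: ts)
  next
    case False
    then obtain C' c where C: "C = C' @ [c]" by (metis list.size(3) even_zero rev_exhaust)
    have "vanishes (c # a # b # flat ms @ N) (\<lambda>ws. \<omega> (map f C' @ ws))"
      using van'[OF dist] False C by (intro vanishes_all_ff) auto
    from list_tsum_vanishes[OF vanishes_triple[OF this]] show ?thesis
      using False by (simp add: ts[unfolded C] list_tsum_diff C)
  qed
qed

text \<open>By \<open>key_base\<close> and \<open>tsum_complement\<close> all transversal sums of
  this combination, as a function of \<open>P\<close>, vanish; \<open>tsum_exchange\<close> then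
  yields the vanishing of every single value.\<close>

lemma key:
  assumes \<omega>: "altform n \<omega>" and van: "\<And>A. skew A \<Longrightarrow> \<omega> (graph_list A) = 0"
    and C: "distinct C" "distinct N" and D: "finite D" "card D = 2 * Suc k" "P \<subseteq> D" "card P = Suc k"
    and disj: "set C \<inter> D = {}" "set C \<inter> set N = {}" "D \<inter> set N = {}" "set C \<union> D \<union> set N = {..<n}"
  shows "\<omega> (basis_list C P N) + (-1) ^ length C * \<omega> (basis_list C (D - P) N) = 0"
proof -
  let ?y = "\<lambda>P. \<omega> (basis_list C P N)"
  have "tsum (\<lambda>P. ?y P + (-1) ^ length C * ?y (D - P)) [] P = 0"
  proof (rule tsum_exchange[OF D(1) _ order_refl D(3,4,2)])
    fix a b ms assume ab: "a \<noteq> b" "{a, b} \<subseteq> D" "distinct (flat ms)" "set (flat ms) = D - {a, b}"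
    have "tsum (\<lambda>P. ?y (D - P)) ms {a} = tsum ?y ms (D - {a} - set (flat ms))"
      by (rule tsum_complement) (use ab in auto)
    also have "D - {a} - set (flat ms) = {b}" using ab by auto
    finally have "tsum (\<lambda>P. ?y P + (-1) ^ length C * ?y (D - P)) ms {a} = tsum ?y ms {a} + (-1) ^ length C * tsum ?y ms {b}"
      by (simp only: tsum_add)
    also have "\<dots> = 0"
      by (rule key_base[OF \<omega> van]) (use ab C disj in auto)
    finally show "tsum (\<lambda>P. ?y P + (-1) ^ length C * ?y (D - P)) ms {a} = 0" .
  qed auto
  then show ?thesis by simp
qed

text \<open>When the row and column sets agree, no index of \<open>C\<close> needs a partner
  outside: a perfect matching of \<open>C\<close> isolates one coefficient.\<close>

lemma key_diagonal:
  assumes \<omega>: "altform n \<omega>" and van: "\<And>A. skew A \<Longrightarrow> \<omega> (graph_list A) = 0"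
    and C: "distinct (C @ N)" "set (C @ N) = {..<n}" "even (length C)"
  shows "\<omega> (map f C @ map e N) = 0"
proof -
  have "length (C @ N) = n" using C(1,2) distinct_card by fastforce
  have "mset (C @ N) = mset [0..<n]"
    using C by (subst set_eq_iff_mset_eq_distinct[symmetric]) (auto simp: lessThan_atLeast0)
  moreover have "length [0..<n] = n" by simp
  ultimately obtain \<sigma> where \<sigma>: "\<And>\<omega> u. altform n \<omega> \<Longrightarrow> \<omega> (map u (C @ N)) = (\<sigma>::complex) * \<omega> (map u [0..<n])"
    using altform_reorder by blast
  have "\<omega> (map (graph_vec A) (C @ N)) = 0" if "\<And>i j. A i j = - A j i" for A
  proof -
    have "skew A" unfolding skew_def using that by blast
    then show ?thesis using \<sigma>[OF \<omega>, of "graph_vec A"] van[of A] by (simp add: graph_list_def)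
  qed
  then have "vanishes (C @ N) \<omega>"
    by (intro vanishesI) (use C \<omega> \<open>length (C @ N) = n\<close> in \<open>blast | simp\<close>)+
  then show ?thesis using vanishes_all_e[OF vanishes_all_ff[OF C(3)]] by simp
qed

end

section \<open>The monomial expansion of a chart\<close>

definition pairs :: "nat \<Rightarrow> (nat \<times> nat) set" where
  "pairs n = {(i, j). i < j \<and> j < n}"

lemma card_pairs: "card (pairs n) = n * (n - 1) div 2" and finite_pairs: "finite (pairs n)"
proof -
  have "finite (pairs n) \<and> 2 * card (pairs n) = n * (n - 1)"
  proof (induct n)
    case 0 then show ?case by (simp add: pairs_def)
  next
    case (Suc n)
    have eq: "pairs (Suc n) = pairs n \<union> (\<lambda>i. (i, n)) ` {..<n}"
      by (auto simp: pairs_def less_Suc_eq)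
    have "card (pairs (Suc n)) = card (pairs n) + n"
      unfolding eq using Suc by (subst card_Un_disjoint) (auto simp: pairs_def card_image inj_on_def)
    then show ?case using Suc eq by (cases n) (auto simp: algebra_simps)
  qed
  then show "card (pairs n) = n * (n - 1) div 2" "finite (pairs n)" by auto
qed

definition pair_index :: "nat \<Rightarrow> nat \<times> nat \<Rightarrow> nat" where
  "pair_index n = (SOME h. bij_betw h (pairs n) {..<n * (n - 1) div 2})"

lemma bij_pair_index: "bij_betw (pair_index n) (pairs n) {..<n * (n - 1) div 2}"
  unfolding pair_index_def
  using ex_bij_betw_finite_nat[OF finite_pairs[of n], unfolded card_pairs atLeast0LessThan] by (rule someI_ex)

definition skew_mat :: "nat \<Rightarrow> (nat \<Rightarrow> complex) \<Rightarrow> nat \<Rightarrow> nat \<Rightarrow> complex" where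
  "skew_mat n z i j = (if i < j then z (pair_index n (i, j)) else if j < i then - z (pair_index n (j, i)) else 0)"

section \<open>Partial injections\<close>

definition pinv :: "(nat \<Rightarrow> nat option) \<Rightarrow> nat \<Rightarrow> nat option" where
  "pinv \<tau> j = (if \<exists>i. \<tau> i = Some j then Some (THE i. \<tau> i = Some j) else None)"

definition pinjs :: "nat \<Rightarrow> (nat \<Rightarrow> nat option) set" where
  "pinjs n = {\<tau>. dom \<tau> \<subseteq> {..<n} \<and> ran \<tau> \<subseteq> {..<n} \<and> inj_on \<tau> (dom \<tau>)}"

lemma pinv_eq_Some: "inj_on \<tau> (dom \<tau>) \<Longrightarrow> pinv \<tau> j = Some i \<longleftrightarrow> \<tau> i = Some j"
proof -
  assume inj: "inj_on \<tau> (dom \<tau>)"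
  have "(THE i. \<tau> i = Some j) = i" if "\<tau> i = Some j" for i
  proof (rule the_equality)
    fix i' assume "\<tau> i' = Some j"
    then show "i' = i" using that inj by (metis domI inj_onD)
  qed (rule that)
  then show ?thesis by (auto simp: pinv_def)
qed

lemma pinv_props:
  assumes "\<tau> \<in> pinjs n"
  shows "dom (pinv \<tau>) = ran \<tau>" "ran (pinv \<tau>) = dom \<tau>" "pinv \<tau> \<in> pinjs n" "pinv (pinv \<tau>) = \<tau>"
proof -
  have inj: "inj_on \<tau> (dom \<tau>)" using assms by (simp add: pinjs_def)
  note S = pinv_eq_Some[OF inj]
  show d: "dom (pinv \<tau>) = ran \<tau>" by (auto simp: dom_def ran_def pinv_def)
  show r: "ran (pinv \<tau>) = dom \<tau>" using S by (auto simp: dom_def ran_def)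
  have i: "inj_on (pinv \<tau>) (dom (pinv \<tau>))"
  proof (rule inj_onI)
    fix x y assume x: "x \<in> dom (pinv \<tau>)" and "pinv \<tau> x = pinv \<tau> y"
    from x obtain i where i: "pinv \<tau> x = Some i" by (auto simp: dom_def)
    with \<open>pinv \<tau> x = pinv \<tau> y\<close> have "pinv \<tau> y = Some i" by simp
    with i show "x = y" using S by auto
  qed
  then show "pinv \<tau> \<in> pinjs n" using d r assms by (auto simp: pinjs_def)
  show "pinv (pinv \<tau>) = \<tau>"
  proof
    fix i show "pinv (pinv \<tau>) i = \<tau> i"
      by (cases "\<tau> i") (metis S i option.exhaust pinv_eq_Some, metis S i pinv_eq_Some)
  qed
qed

lemma finite_dom_pinjs: "\<tau> \<in> pinjs n \<Longrightarrow> finite (dom \<tau>)"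
  by (auto simp: pinjs_def intro: finite_subset)

lemma bij_betw_pinj: "\<tau> \<in> pinjs n \<Longrightarrow> bij_betw (\<lambda>i. the (\<tau> i)) (dom \<tau>) (ran \<tau>)"
  unfolding bij_betw_def pinjs_def
  by (auto simp: inj_on_def ran_def dom_def image_iff) (metis option.sel)

lemma card_ran_pinj: "\<tau> \<in> pinjs n \<Longrightarrow> card (ran \<tau>) = card (dom \<tau>)"
  using bij_betw_same_card[OF bij_betw_pinj] by simp

definition weight :: "(nat \<Rightarrow> nat \<Rightarrow> complex) \<Rightarrow> (nat \<Rightarrow> nat option) \<Rightarrow> complex" where
  "weight A \<tau> = (\<Prod>i\<in>dom \<tau>. A i (the (\<tau> i)))"

text \<open>Each factor \<open>A i j\<close> becomes \<open>A j i\<close>, which costs one sign per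
  element of the domain.\<close>

lemma weight_pinv:
  assumes \<tau>: "\<tau> \<in> pinjs n" and A: "\<And>i j. i < n \<Longrightarrow> j < n \<Longrightarrow> A i j = - A j i"
  shows "weight A (pinv \<tau>) = (-1) ^ card (dom \<tau>) * weight A \<tau>"
proof -
  have inj: "inj_on \<tau> (dom \<tau>)" using \<tau> by (simp add: pinjs_def)
  have "weight A (pinv \<tau>) = (\<Prod>j\<in>ran \<tau>. A j (the (pinv \<tau> j)))"
    by (simp add: weight_def pinv_props[OF \<tau>])
  also have "\<dots> = (\<Prod>i\<in>dom \<tau>. A (the (\<tau> i)) (the (pinv \<tau> (the (\<tau> i)))))"
    by (rule prod.reindex_bij_betw[OF bij_betw_pinj[OF \<tau>], symmetric])
  also have "\<dots> = (\<Prod>i\<in>dom \<tau>. (-1) * A i (the (\<tau> i)))"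
  proof (rule prod.cong[OF refl])
    fix i assume i: "i \<in> dom \<tau>"
    then obtain j where j: "\<tau> i = Some j" by auto
    then have "pinv \<tau> j = Some i" by (simp add: pinv_eq_Some[OF inj])
    moreover have "i < n" "j < n" using i j \<tau> by (auto simp: pinjs_def ran_def)
    ultimately show "A (the (\<tau> i)) (the (pinv \<tau> (the (\<tau> i)))) = (-1) * A i (the (\<tau> i))"
      using A[of j i] j by simp
  qed
  finally show ?thesis unfolding weight_def prod.distrib prod_constant .
qed

text \<open>Intermediate stages of a multilinear expansion: choices for the first \<open>k\<close>
  slots, where \<open>None\<close> stands for the summand \<open>e i\<close>. Injectivity is not
  imposed, so that the slots can be filled independently.\<close>

definition pmaps :: "nat \<Rightarrow> nat \<Rightarrow> (nat \<Rightarrow> nat option) set" where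
  "pmaps n k = {\<tau>. dom \<tau> \<subseteq> {..<k} \<and> ran \<tau> \<subseteq> {..<n}}"

lemma pmaps_0: "pmaps n 0 = {Map.empty}"
  by (auto simp: pmaps_def)

lemma pmaps_None: "\<tau> \<in> pmaps n k \<Longrightarrow> \<tau> k = None"
  by (auto simp: pmaps_def dom_def)

lemma pmaps_Suc: "pmaps n (Suc k) = pmaps n k \<union> (\<lambda>(\<tau>, j). \<tau>(k \<mapsto> j)) ` (pmaps n k \<times> {..<n})"
proof (intro equalityI subsetI)
  fix \<tau> assume \<tau>: "\<tau> \<in> pmaps n (Suc k)"
  show "\<tau> \<in> pmaps n k \<union> (\<lambda>(\<tau>, j). \<tau>(k \<mapsto> j)) ` (pmaps n k \<times> {..<n})"
  proof (cases "\<tau> k")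
    case None
    have "i < k" if "i \<in> dom \<tau>" for i
    proof -
      have "i < Suc k" using \<tau> that by (auto simp: pmaps_def)
      moreover have "i \<noteq> k" using None that by auto
      ultimately show ?thesis by simp
    qed
    then have "\<tau> \<in> pmaps n k" using \<tau> by (auto simp: pmaps_def)
    then show ?thesis ..
  next
    case (Some j)
    define \<tau>' where "\<tau>' = \<tau>(k := None)"
    have "i < k" if "i \<in> dom \<tau>'" for i
    proof -
      have "i < Suc k" using \<tau> that by (auto simp: pmaps_def \<tau>'_def split: if_splits)
      moreover have "i \<noteq> k" using that by (auto simp: \<tau>'_def)
      ultimately show ?thesis by simp
    qed
    moreover have "ran \<tau>' \<subseteq> ran \<tau>" by (auto simp: \<tau>'_def ran_def split: if_splits)
    ultimately have "\<tau>' \<in> pmaps n k" using \<tau> by (auto simp: pmaps_def)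
    moreover have "j < n" using \<tau> Some by (auto simp: pmaps_def ran_def)
    moreover have "\<tau> = \<tau>'(k \<mapsto> j)" using Some by (auto simp: \<tau>'_def)
    ultimately show ?thesis by (intro UnI2 image_eqI[of _ _ "(\<tau>', j)"]) auto
  qed
next
  fix \<tau> assume "\<tau> \<in> pmaps n k \<union> (\<lambda>(\<tau>, j). \<tau>(k \<mapsto> j)) ` (pmaps n k \<times> {..<n})"
  then show "\<tau> \<in> pmaps n (Suc k)"
  proof
    assume "\<tau> \<in> pmaps n k"
    then show ?thesis by (auto simp: pmaps_def)
  next
    assume "\<tau> \<in> (\<lambda>(\<tau>, j). \<tau>(k \<mapsto> j)) ` (pmaps n k \<times> {..<n})"
    then obtain \<tau>' j where t: "\<tau>' \<in> pmaps n k" "j < n" "\<tau> = \<tau>'(k \<mapsto> j)" by auto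
    then have "ran \<tau> \<subseteq> insert j (ran \<tau>')" by (auto simp: ran_def split: if_splits)
    then show ?thesis using t by (auto simp: pmaps_def)
  qed
qed

lemma finite_pmaps: "finite (pmaps n k)"
  by (induct k) (auto simp: pmaps_0 pmaps_Suc)

lemma finite_pinjs: "finite (pinjs n)"
  by (rule finite_subset[OF _ finite_pmaps[of n n]]) (auto simp: pinjs_def pmaps_def)

lemma sum_pmaps_Suc:
  fixes F :: "(nat \<Rightarrow> nat option) \<Rightarrow> 'b::comm_monoid_add"
  shows "sum F (pmaps n (Suc k)) = (\<Sum>\<tau>\<in>pmaps n k. F \<tau> + (\<Sum>j<n. F (\<tau>(k \<mapsto> j))))"
proof -
  have inj: "inj_on (\<lambda>(\<tau>, j). \<tau>(k \<mapsto> j)) (pmaps n k \<times> {..<n})"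
  proof (rule inj_onI, clarify)
    fix \<tau> j \<tau>' j' assume t: "\<tau> \<in> pmaps n k" "\<tau>' \<in> pmaps n k" and eq: "\<tau>(k \<mapsto> j) = \<tau>'(k \<mapsto> j')"
    have "j = j'" using fun_cong[OF eq, of k] by simp
    moreover have "\<tau> i = \<tau>' i" for i
      using fun_cong[OF eq, of i] pmaps_None[OF t(1)] pmaps_None[OF t(2)] by (cases "i = k") auto
    ultimately show "\<tau> = \<tau>' \<and> j = j'" by auto
  qed
  have "pmaps n k \<inter> (\<lambda>(\<tau>, j). \<tau>(k \<mapsto> j)) ` (pmaps n k \<times> {..<n}) = {}"
    by (auto dest: pmaps_None)
  then have "sum F (pmaps n (Suc k)) = sum F (pmaps n k) + sum F ((\<lambda>(\<tau>, j). \<tau>(k \<mapsto> j)) ` (pmaps n k \<times> {..<n}))"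
    unfolding pmaps_Suc by (intro sum.union_disjoint) (auto simp: finite_pmaps)
  also have "sum F ((\<lambda>(\<tau>, j). \<tau>(k \<mapsto> j)) ` (pmaps n k \<times> {..<n})) = (\<Sum>\<tau>\<in>pmaps n k. \<Sum>j<n. F (\<tau>(k \<mapsto> j)))"
    unfolding sum.reindex[OF inj] by (simp add: sum.cartesian_product case_prod_unfold)
  finally show ?thesis by (simp add: sum.distrib)
qed

lemma weight_update:
  assumes "\<tau> \<in> pmaps n k"
  shows "weight A (\<tau>(k \<mapsto> j)) = A k j * weight A \<tau>"
proof -
  have k: "k \<notin> dom \<tau>" using pmaps_None[OF assms] by auto
  have fin: "finite (dom \<tau>)" using assms by (auto simp: pmaps_def intro: finite_subset)
  have "(\<Prod>i\<in>dom \<tau>. A i (the ((\<tau>(k \<mapsto> j)) i))) = (\<Prod>i\<in>dom \<tau>. A i (the (\<tau> i)))"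
    using k by (intro prod.cong) auto
  then show ?thesis using k fin by (simp add: weight_def)
qed

section \<open>Expansion of a graph into minors\<close>

context polarized
begin

text \<open>A partial injection \<open>\<tau>\<close> chooses one summand from each of the \<open>n\<close> vectors \<open>graph_vec A i\<close>: it is a term of
  the minor of \<open>A\<close> with rows \<open>dom \<tau>\<close> and columns \<open>ran \<tau>\<close>.  On skew matrices the terms of \<open>\<tau>\<close> and \<open>pinv \<tau>\<close>
  agree up to sign.\<close>

definition graph_row :: "(nat \<Rightarrow> nat option) \<Rightarrow> nat \<Rightarrow> 'v" where
  "graph_row \<tau> i = (case \<tau> i of None \<Rightarrow> e i | Some j \<Rightarrow> f j)"

definition eps :: "(nat \<Rightarrow> nat option) \<Rightarrow> ('v list \<Rightarrow> complex) \<Rightarrow> complex" where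
  "eps \<tau> = wedge smul n (map (graph_row \<tau>) [0..<n])"

definition eta :: "(nat \<Rightarrow> nat option) \<Rightarrow> ('v list \<Rightarrow> complex) \<Rightarrow> complex" where
  "eta \<tau> = eps \<tau> + fscale ((-1) ^ card (dom \<tau>)) (eps (pinv \<tau>))"

lemma altform_graph_expand:
  assumes \<omega>: "altform n \<omega>" and "k + length ys = n"
  shows "\<omega> (map (graph_vec A) [0..<k] @ ys) = (\<Sum>\<tau>\<in>pmaps n k. weight A \<tau> * \<omega> (map (graph_row \<tau>) [0..<k] @ ys))"
  using assms(2)
proof (induct k arbitrary: ys)
  case 0 then show ?case by (simp add: pmaps_0 weight_def)
next
  case (Suc k)
  have "\<omega> (map (graph_vec A) [0..<Suc k] @ ys) = \<omega> (map (graph_vec A) [0..<k] @ graph_vec A k # ys)" by simp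
  also have "\<dots> = (\<Sum>\<tau>\<in>pmaps n k. weight A \<tau> * \<omega> (map (graph_row \<tau>) [0..<k] @ graph_vec A k # ys))"
    by (rule Suc.hyps) (use Suc.prems in simp)
  also have "\<dots> = (\<Sum>\<tau>\<in>pmaps n k. weight A \<tau> * \<omega> (map (graph_row \<tau>) [0..<Suc k] @ ys) +
      (\<Sum>j<n. weight A (\<tau>(k \<mapsto> j)) * \<omega> (map (graph_row (\<tau>(k \<mapsto> j))) [0..<Suc k] @ ys)))"
  proof (rule sum.cong[OF refl])
    fix \<tau> assume \<tau>: "\<tau> \<in> pmaps n k"
    have len: "length (map (graph_row \<tau>) [0..<k]) + length ys + 1 = n" using Suc.prems by simp
    have "graph_row \<tau> k = e k" using pmaps_None[OF \<tau>] by (simp add: graph_row_def)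
    moreover have "map (graph_row (\<tau>(k \<mapsto> j))) [0..<k] = map (graph_row \<tau>) [0..<k]" "graph_row (\<tau>(k \<mapsto> j)) k = f j" for j
      by (simp_all add: graph_row_def)
    ultimately show "weight A \<tau> * \<omega> (map (graph_row \<tau>) [0..<k] @ graph_vec A k # ys) =
       weight A \<tau> * \<omega> (map (graph_row \<tau>) [0..<Suc k] @ ys) +
        (\<Sum>j<n. weight A (\<tau>(k \<mapsto> j)) * \<omega> (map (graph_row (\<tau>(k \<mapsto> j))) [0..<Suc k] @ ys))"
      by (simp add: graph_vec_def altform_slot(1)[OF \<omega> len] altform_slot_sum[OF \<omega> len] weight_update[OF \<tau>]
          distrib_left sum_distrib_left mult.assoc mult.left_commute del: map_eq_conv)
  qed
  also have "\<dots> = (\<Sum>\<tau>\<in>pmaps n (Suc k). weight A \<tau> * \<omega> (map (graph_row \<tau>) [0..<Suc k] @ ys))"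
    by (rule sum_pmaps_Suc[symmetric])
  finally show ?case .
qed

text \<open>A choice that takes the same value \<open>Some j\<close> twice puts \<open>f j\<close>
  into two slots, so only partial injections survive.\<close>

lemma wedge_graph_expand:
  "wedge smul n (graph_list A) = (\<Sum>\<tau>\<in>pinjs n. fscale (weight A \<tau>) (eps \<tau>))"
proof
  fix \<omega>
  show "wedge smul n (graph_list A) \<omega> = (\<Sum>\<tau>\<in>pinjs n. fscale (weight A \<tau>) (eps \<tau>)) \<omega>"
  proof (cases "altform n \<omega>")
    case True
    have "wedge smul n (graph_list A) \<omega> = (\<Sum>\<tau>\<in>pmaps n n. weight A \<tau> * \<omega> (map (graph_row \<tau>) [0..<n]))"
      using altform_graph_expand[OF True, of n "[]"] True by (simp add: wedge_def graph_list_def)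
    also have "\<dots> = (\<Sum>\<tau>\<in>pinjs n. weight A \<tau> * \<omega> (map (graph_row \<tau>) [0..<n]))"
    proof (rule sum.mono_neutral_right[OF finite_pmaps])
      show "pinjs n \<subseteq> pmaps n n" by (auto simp: pinjs_def pmaps_def)
      show "\<forall>\<tau>\<in>pmaps n n - pinjs n. weight A \<tau> * \<omega> (map (graph_row \<tau>) [0..<n]) = 0"
      proof
        fix \<tau> assume \<tau>: "\<tau> \<in> pmaps n n - pinjs n"
        then obtain i j where ij: "i \<in> dom \<tau>" "j \<in> dom \<tau>" "\<tau> i = \<tau> j" "i \<noteq> j"
          by (auto simp: pinjs_def pmaps_def inj_on_def)
        then have "i < n" "j < n" using \<tau> by (auto simp: pmaps_def)
        moreover have "graph_row \<tau> i = graph_row \<tau> j" using ij by (auto simp: graph_row_def)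
        ultimately have "\<not> distinct (map (graph_row \<tau>) [0..<n])"
          using ij(4) by (auto simp: distinct_conv_nth)
        then show "weight A \<tau> * \<omega> (map (graph_row \<tau>) [0..<n]) = 0"
          using altform_not_distinct[OF True] by simp
      qed
    qed
    finally show ?thesis using True by (simp add: fun_sum_apply fscale_def eps_def wedge_def)
  next
    case False
    then show ?thesis by (simp add: fun_sum_apply fscale_def eps_def wedge_def)
  qed
qed

text \<open>The expansion is averaged with its image under \<open>pinv\<close>. Each term then
  carries the combination to which a skew matrix gives a common weight, and the factor 1/2 accounts
  for listing \<open>\<tau>\<close> and \<open>pinv \<tau>\<close> separately.\<close>

lemma wedge_graph_expand_eta:
  assumes A: "skew A"
  shows "wedge smul n (graph_list A) = (\<Sum>\<tau>\<in>pinjs n. fscale (weight A \<tau> / 2) (eta \<tau>))"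
proof -
  have A': "\<And>i j. i < n \<Longrightarrow> j < n \<Longrightarrow> A i j = - A j i" using A unfolding skew_def by blast
  have bij: "bij_betw pinv (pinjs n) (pinjs n)"
    by (rule bij_betw_byWitness[where f' = pinv]) (use pinv_props in auto)
  have "(\<Sum>\<tau>\<in>pinjs n. fscale (weight A \<tau>) (eps \<tau>)) = (\<Sum>\<tau>\<in>pinjs n. fscale (weight A (pinv \<tau>)) (eps (pinv \<tau>)))"
    by (rule sum.reindex_bij_betw[OF bij, symmetric])
  also have "\<dots> = (\<Sum>\<tau>\<in>pinjs n. fscale (weight A \<tau>) (fscale ((-1) ^ card (dom \<tau>)) (eps (pinv \<tau>))))"
    by (intro sum.cong refl) (simp add: weight_pinv[OF _ A'] mult.commute)
  finally have "(\<Sum>\<tau>\<in>pinjs n. fscale (weight A \<tau>) (eps \<tau>)) =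
     fscale (1/2) ((\<Sum>\<tau>\<in>pinjs n. fscale (weight A \<tau>) (eps \<tau>)) + (\<Sum>\<tau>\<in>pinjs n. fscale (weight A \<tau>) (fscale ((-1) ^ card (dom \<tau>)) (eps (pinv \<tau>)))))"
    by (simp add: fscale_def fun_eq_iff)
  also have "\<dots> = (\<Sum>\<tau>\<in>pinjs n. fscale (weight A \<tau> / 2) (eta \<tau>))"
    by (simp add: sum.distrib[symmetric] cfun.scale_sum_right eta_def cfun.scale_right_distrib)
  finally show ?thesis by (simp only: wedge_graph_expand)
qed

lemma eps_transpose:
  assumes ab: "a < n" "b < n" "a \<noteq> b" and "\<tau> a \<noteq> None" "\<tau> b \<noteq> None"
  shows "eps (\<tau> \<circ> Transposition.transpose a b) = fscale (-1) (eps \<tau>)"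
proof -
  have r: "graph_row (\<tau> \<circ> Transposition.transpose a b) = graph_row \<tau> \<circ> Transposition.transpose a b"
  proof
    fix x show "graph_row (\<tau> \<circ> Transposition.transpose a b) x = (graph_row \<tau> \<circ> Transposition.transpose a b) x"
      using assms by (cases "x = a \<or> x = b") (auto simp: graph_row_def)
  qed
  show ?thesis
    unfolding eps_def r
    using altform_transpose[OF _ ab, of _ "graph_row \<tau>"] by (auto simp: wedge_def fscale_def fun_eq_iff)
qed

text \<open>Composition with \<open>p\<close> rearranges the rows of the term and, for the inverse
  map, the columns by a conjugate of the inverse permutation. Both summands of
  \<open>eta \<tau>\<close> therefore pick up the same sign.\<close>

lemma eps_permute:
  assumes \<tau>: "\<tau> \<in> pinjs n" and p: "p permutes dom \<tau>"
  shows "eps (\<tau> \<circ> p) = fscale (of_int (sign p)) (eps \<tau>) \<and>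
     eps (pinv (\<tau> \<circ> p)) = fscale (of_int (sign p)) (eps (pinv \<tau>))"
proof -
  define I where "I = dom \<tau>"
  have finI: "finite I" unfolding I_def by (rule finite_dom_pinjs[OF \<tau>])
  have pI: "p permutes I" using p by (simp add: I_def)
  have "\<forall>\<tau>. \<tau> \<in> pinjs n \<and> dom \<tau> = I \<longrightarrow> eps (\<tau> \<circ> p) = fscale (of_int (sign p)) (eps \<tau>) \<and>
     eps (pinv (\<tau> \<circ> p)) = fscale (of_int (sign p)) (eps (pinv \<tau>))"
  proof (rule permutes_induct[OF pI finI])
    show "\<forall>\<tau>. \<tau> \<in> pinjs n \<and> dom \<tau> = I \<longrightarrow> eps (\<tau> \<circ> id) = fscale (of_int (sign id)) (eps \<tau>) \<and>
     eps (pinv (\<tau> \<circ> id)) = fscale (of_int (sign id)) (eps (pinv \<tau>))"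
      by (simp add: sign_id fscale_def)
    fix a b q
    assume ab: "a \<in> I" "b \<in> I" "a \<noteq> b" and q: "q permutes I"
      and IH: "\<forall>\<tau>. \<tau> \<in> pinjs n \<and> dom \<tau> = I \<longrightarrow> eps (\<tau> \<circ> q) = fscale (of_int (sign q)) (eps \<tau>) \<and>
         eps (pinv (\<tau> \<circ> q)) = fscale (of_int (sign q)) (eps (pinv \<tau>))"
    let ?t = "Transposition.transpose a b"
    have sg: "sign (?t \<circ> q) = - sign q"
      using ab q finI by (simp add: sign_compose permutation_swap_id sign_swap_id
          permutation_permutes[THEN iffD2, OF exI, of I])
    show "\<forall>\<tau>. \<tau> \<in> pinjs n \<and> dom \<tau> = I \<longrightarrow> eps (\<tau> \<circ> (?t \<circ> q)) = fscale (of_int (sign (?t \<circ> q))) (eps \<tau>) \<and>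
         eps (pinv (\<tau> \<circ> (?t \<circ> q))) = fscale (of_int (sign (?t \<circ> q))) (eps (pinv \<tau>))"
    proof (intro allI impI, elim conjE)
      fix \<tau> assume \<tau>: "\<tau> \<in> pinjs n" and dom: "dom \<tau> = I"
      have inj: "inj_on \<tau> (dom \<tau>)" and lt: "dom \<tau> \<subseteq> {..<n}" "ran \<tau> \<subseteq> {..<n}" using \<tau> by (auto simp: pinjs_def)
      obtain a' b' where ab': "\<tau> a = Some a'" "\<tau> b = Some b'" using ab dom by blast
      define \<tau>1 where "\<tau>1 = \<tau> \<circ> ?t"
      have val: "\<tau>1 a = Some b'" "\<tau>1 b = Some a'" "i \<noteq> a \<Longrightarrow> i \<noteq> b \<Longrightarrow> \<tau>1 i = \<tau> i" for i
        using ab' by (auto simp: \<tau>1_def transpose_def)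
      have dom1: "dom \<tau>1 = I"
      proof -
        have "\<tau>1 i = None \<longleftrightarrow> \<tau> i = None" for i using val ab' by (cases "i = a \<or> i = b") auto
        then show ?thesis using dom by (auto simp: dom_def)
      qed
      have ran1: "ran \<tau>1 \<subseteq> ran \<tau>" by (auto simp: \<tau>1_def ran_def)
      have inj1: "inj_on \<tau>1 (dom \<tau>1)"
      proof (rule inj_onI)
        fix x y assume xy: "x \<in> dom \<tau>1" "y \<in> dom \<tau>1" "\<tau>1 x = \<tau>1 y"
        then have "?t x \<in> dom \<tau>" "?t y \<in> dom \<tau>" "\<tau> (?t x) = \<tau> (?t y)" by (auto simp: \<tau>1_def)
        then have "?t x = ?t y" using inj by (auto dest: inj_onD)
        then show "x = y" by (metis transpose_involutory)
      qed
      have \<tau>1: "\<tau>1 \<in> pinjs n" using dom1 ran1 inj1 lt dom by (auto simp: pinjs_def)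
      have ne: "a' \<noteq> b'" using ab ab' inj by (metis domI inj_onD)
      \<comment> \<open>For the inverse map, a transposition of arguments becomes the transposition
        of the corresponding values, so \<open>eps_transpose\<close> applies a second time.\<close>
      have p1: "pinv \<tau>1 = pinv \<tau> \<circ> Transposition.transpose a' b'"
      proof
        fix j
        show "pinv \<tau>1 j = (pinv \<tau> \<circ> Transposition.transpose a' b') j"
        proof (cases "j = a' \<or> j = b'")
          case True
          then show ?thesis
            using val ab' by (auto simp: pinv_eq_Some[OF inj] pinv_eq_Some[OF inj1] transpose_def)
              (metis pinv_eq_Some[OF inj] pinv_eq_Some[OF inj1])+
        next
          case False
          then have tr: "Transposition.transpose a' b' j = j" by (simp add: transpose_def)
          have "pinv \<tau>1 j = Some i \<longleftrightarrow> pinv \<tau> j = Some i" for i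
            unfolding pinv_eq_Some[OF inj] pinv_eq_Some[OF inj1]
            using val ab' False by (cases "i = a \<or> i = b") auto
          then show ?thesis using tr by (metis comp_apply option.exhaust)
        qed
      qed
      have "eps \<tau>1 = fscale (-1) (eps \<tau>)"
        unfolding \<tau>1_def by (rule eps_transpose) (use ab dom lt in auto)
      moreover have "eps (pinv \<tau>1) = fscale (-1) (eps (pinv \<tau>))"
        unfolding p1
      proof (rule eps_transpose)
        have "a' \<in> ran \<tau>" "b' \<in> ran \<tau>" using ab' by (auto intro: ranI)
        then show "a' < n" "b' < n" using lt by auto
        have "pinv \<tau> a' = Some a" "pinv \<tau> b' = Some b" using ab' by (simp_all add: pinv_eq_Some[OF inj])
        then show "pinv \<tau> a' \<noteq> None" "pinv \<tau> b' \<noteq> None" by auto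
      qed (rule ne)
      moreover have "\<tau> \<circ> (?t \<circ> q) = \<tau>1 \<circ> q" by (simp add: \<tau>1_def comp_assoc)
      ultimately show "eps (\<tau> \<circ> (?t \<circ> q)) = fscale (of_int (sign (?t \<circ> q))) (eps \<tau>) \<and>
         eps (pinv (\<tau> \<circ> (?t \<circ> q))) = fscale (of_int (sign (?t \<circ> q))) (eps (pinv \<tau>))"
        using IH[rule_format, of \<tau>1] \<tau>1 dom1 by (simp add: sg)
    qed
  qed
  then show ?thesis using \<tau> I_def by blast
qed

text \<open>Two bijections between the same sets differ by a permutation \<open>p\<close> of the
  domain. Hence, up to sign, \<open>eta\<close> depends only on the row set and the column
  set.\<close>

lemma eta_same_dom_ran:
  assumes \<tau>: "\<tau> \<in> pinjs n" and \<tau>': "\<tau>' \<in> pinjs n" and "dom \<tau>' = dom \<tau>" "ran \<tau>' = ran \<tau>"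
  shows "\<exists>\<sigma>. eta \<tau>' = fscale \<sigma> (eta \<tau>)"
proof -
  have inj: "inj_on \<tau> (dom \<tau>)" "inj_on \<tau>' (dom \<tau>')" using \<tau> \<tau>' by (auto simp: pinjs_def)
  define p where "p i = (if i \<in> dom \<tau> then the (pinv \<tau> (the (\<tau>' i))) else i)" for i
  have eq: "\<tau> (p i) = \<tau>' i" for i
  proof (cases "i \<in> dom \<tau>")
    case True
    then obtain j where j: "\<tau>' i = Some j" using assms(3) by blast
    then have "j \<in> ran \<tau>" using assms(4) by (metis ranI)
    then obtain k where k: "\<tau> k = Some j" by (auto simp: ran_def)
    then have "pinv \<tau> j = Some k" by (simp add: pinv_eq_Some[OF inj(1)])
    then show ?thesis using True j k by (simp add: p_def)
  next
    case False
    then show ?thesis using assms(3) by (simp add: p_def) (metis domIff)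
  qed
  have pI: "p i \<in> dom \<tau>" if "i \<in> dom \<tau>" for i
    using eq[of i] that assms(3) by (metis domIff)
  have "inj_on p (dom \<tau>)"
  proof (rule inj_onI)
    fix x y assume "x \<in> dom \<tau>" "y \<in> dom \<tau>" "p x = p y"
    then have "\<tau>' x = \<tau>' y" using eq by metis
    then show "x = y" using inj(2) \<open>x \<in> dom \<tau>\<close> \<open>y \<in> dom \<tau>\<close> assms(3) by (auto dest: inj_onD)
  qed
  then have "bij_betw p (dom \<tau>) (dom \<tau>)"
    using pI finite_dom_pinjs[OF \<tau>] by (metis bij_betw_def endo_inj_surj image_subsetI)
  then have p: "p permutes dom \<tau>"
    by (rule bij_imp_permutes) (simp add: p_def)
  have "\<tau>' = \<tau> \<circ> p" using eq by auto
  then have "eta \<tau>' = fscale (of_int (sign p)) (eta \<tau>)"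
    using eps_permute[OF \<tau> p] assms(3)
    by (simp add: eta_def cfun.scale_right_distrib mult.commute)
  then show ?thesis by blast
qed

lemma eta_pinv:
  assumes "\<tau> \<in> pinjs n"
  shows "eta (pinv \<tau>) = fscale ((-1) ^ card (dom \<tau>)) (eta \<tau>)"
proof -
  have "fscale ((-1) ^ k) (fscale ((-1) ^ k) x) = x" for k and x :: "('v list \<Rightarrow> complex) \<Rightarrow> complex"
    by (simp flip: power_add mult_2)
  then show ?thesis
    using assms by (simp add: eta_def pinv_props card_ran_pinj cfun.scale_right_distrib add.commute)
qed

end

section \<open>Functions that are continuous and separately holomorphic\<close>

text \<open>Joint continuity makes the one-variable Cauchy estimates locally uniform in the other
  variables; this is how the class is shown to be closed under partial derivatives.\<close>

definition sep_holomorphic :: "nat \<Rightarrow> (nat \<Rightarrow> complex) set \<Rightarrow> ((nat \<Rightarrow> complex) \<Rightarrow> complex) \<Rightarrow> bool" where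
  "sep_holomorphic m U c \<longleftrightarrow> continuous_on U c \<and>
     (\<forall>z\<in>U. \<forall>i<m. (\<lambda>t. c (z(i := t))) field_differentiable at (z i))"

definition pd :: "nat \<Rightarrow> ((nat \<Rightarrow> complex) \<Rightarrow> complex) \<Rightarrow> (nat \<Rightarrow> complex) \<Rightarrow> complex" where
  "pd i c z = deriv (\<lambda>t. c (z(i := t))) (z i)"

abbreviation coord_open :: "nat \<Rightarrow> (nat \<Rightarrow> complex) set \<Rightarrow> bool" where
  "coord_open m U \<equiv> openin (top_of_set (complex_coord_space m)) U"

lemma continuous_on_fun_upd:
  "continuous_on S (\<lambda>x. (f x)(i := g x))"
  if "continuous_on S f" "continuous_on S g"
  for f :: "'a::topological_space \<Rightarrow> 'i \<Rightarrow> 'b::topological_space"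
proof (rule continuous_on_coordinatewise_then_product)
  fix j show "continuous_on S (\<lambda>x. ((f x)(i := g x)) j)"
    using that by (cases "j = i") (auto intro: continuous_on_product_then_coordinatewise)
qed

lemma coord_space_upd: "z \<in> complex_coord_space m \<Longrightarrow> i < m \<Longrightarrow> z(i := t) \<in> complex_coord_space m"
  by (auto simp: complex_coord_space_def)

lemma coord_open_slice:
  assumes "coord_open m U" "z \<in> complex_coord_space m" "i < m"
  shows "open {t. z(i := t) \<in> U}"
proof -
  obtain O' where O: "open O'" "U = complex_coord_space m \<inter> O'"
    using assms(1) by (auto simp: openin_open)
  have "{t. z(i := t) \<in> U} = (\<lambda>t. z(i := t)) -` O'"
    using O coord_space_upd[OF assms(2,3)] by auto
  moreover have "open ((\<lambda>t. z(i := t)) -` O')"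
    by (intro open_vimage O continuous_on_fun_upd continuous_intros)
  ultimately show ?thesis by simp
qed

lemma coord_open_subset: "coord_open m U \<Longrightarrow> z \<in> U \<Longrightarrow> z \<in> complex_coord_space m"
  using openin_subset[of "top_of_set (complex_coord_space m)" U] by auto

text \<open>One radius \<open>r\<close> works for all \<open>z\<close> near \<open>z0\<close>, so
  that slices over different points can be compared on a common disc.\<close>

lemma coord_open_box:
  assumes U: "coord_open m U" and z0: "z0 \<in> U" and i: "i < m"
  obtains r X where "r > 0" "open X" "z0 \<in> X"
    "\<And>z t. z \<in> X \<Longrightarrow> z \<in> complex_coord_space m \<Longrightarrow> t \<in> cball (z0 i) r \<Longrightarrow> z(i := t) \<in> U"
proof -
  obtain O' where O: "open O'" "U = complex_coord_space m \<inter> O'"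
    using U by (auto simp: openin_open)
  have "open ((\<lambda>p. (fst p)(i := snd p)) -` O')"
    by (intro open_vimage O continuous_on_fun_upd continuous_intros)
  moreover have "(z0, z0 i) \<in> (\<lambda>p. (fst p)(i := snd p)) -` O'"
    using O z0 by auto
  ultimately obtain A B where AB: "open A" "open B" "(z0, z0 i) \<in> A \<times> B"
    "A \<times> B \<subseteq> (\<lambda>p. (fst p)(i := snd p)) -` O'"
    by (rule open_prod_elim)
  obtain r where "r > 0" "cball (z0 i) r \<subseteq> B"
    using AB by (meson mem_Sigma_iff open_contains_cball)
  moreover have "z(i := t) \<in> U" if "z \<in> A" "z \<in> complex_coord_space m" "t \<in> B" for z t
    using AB(4) O(2) that coord_space_upd[OF that(2) i] by auto
  ultimately show thesis
    using AB that[of r A] by blast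
qed

lemma sep_holomorphic_slice:
  assumes "sep_holomorphic m U c" "z(i := t) \<in> U" "i < m"
  shows "(\<lambda>t. c (z(i := t))) field_differentiable at t"
proof -
  have "(\<lambda>s. c ((z(i := t))(i := s))) field_differentiable at ((z(i := t)) i)"
    using assms unfolding sep_holomorphic_def by blast
  then show ?thesis by simp
qed

text \<open>Slices over nearby points are uniformly close on a compact disc, and Cauchy's inequality
  transfers this to their derivatives. What remains is the continuity of a one-variable derivative
  on the slice over \<open>z0\<close>.\<close>

lemma sep_holomorphic_pd_cont:
  assumes c: "sep_holomorphic m U c" and U: "coord_open m U" and i: "i < m"
  shows "continuous_on U (pd i c)"
  unfolding continuous_on_def
proof
  fix z0 assume z0: "z0 \<in> U"
  obtain r X1 where r: "r > 0" and X1: "open X1" "z0 \<in> X1"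
    and box: "\<And>z t. z \<in> X1 \<Longrightarrow> z \<in> complex_coord_space m \<Longrightarrow> t \<in> cball (z0 i) r \<Longrightarrow> z(i := t) \<in> U"
    using coord_open_box[OF U z0 i] by metis
  have UC: "z \<in> complex_coord_space m" if "z \<in> U" for z
    using U that by (rule coord_open_subset)
  define g where "g z t = c (z(i := t))" for z t
  have contc: "continuous_on U c" using c by (simp add: sep_holomorphic_def)
  have gcont: "continuous_on ((X1 \<inter> U) \<times> cball (z0 i) r) (\<lambda>p. g (fst p) (snd p))"
    unfolding g_def
    by (intro continuous_on_compose2[OF contc] continuous_on_fun_upd continuous_intros)
       (use box UC in auto)
  have gdiff: "g z field_differentiable at t" if "z \<in> X1" "z \<in> U" "t \<in> cball (z0 i) r" for z t
    unfolding g_def using that box UC i by (intro sep_holomorphic_slice[OF c]) auto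
  have ghol: "g z holomorphic_on ball (z0 i) r" if "z \<in> X1" "z \<in> U" for z
    using gdiff[OF that] by (auto simp: holomorphic_on_def intro: field_differentiable_at_within)
  have d0: "continuous (at (z0 i)) (deriv (g z0))"
    using holomorphic_deriv[OF ghol[OF X1(2) z0] open_ball] r
    by (meson centre_in_ball continuous_on_eq_continuous_at holomorphic_on_imp_continuous_on open_ball)
  show "(pd i c \<longlongrightarrow> pd i c z0) (at z0 within U)"
  proof (rule tendstoI)
    fix e :: real assume e: "e > 0"
    \<comment> \<open>On discs of radius \<open>r / 2\<close> Cauchy's inequality turns
      \<open>e * r / 8\<close> into \<open>e / 4\<close>; another \<open>e / 2\<close> is spent on
      the slice over \<open>z0\<close>.\<close>
    have e': "e * r / 8 > 0" using e r by simp
    obtain X2 where X2: "z0 \<in> X2" "open X2"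
      "\<forall>z\<in>X2 \<inter> (X1 \<inter> U). \<forall>t\<in>cball (z0 i) r. dist (g (fst (z,t)) (snd (z,t))) (g (fst (z0,t)) (snd (z0,t))) \<le> e * r / 8"
      using continuous_on_prod_compactE[OF gcont compact_cball _ e', of z0] X1 z0 by blast
    obtain d where d: "d > 0" "\<And>t. dist t (z0 i) < d \<Longrightarrow> dist (deriv (g z0) t) (deriv (g z0) (z0 i)) < e / 2"
      using d0 e unfolding continuous_at_eps_delta by (meson half_gt_zero)
    define X3 where "X3 = X1 \<inter> X2 \<inter> (\<lambda>z. z i) -` ball (z0 i) (min d (r/2))"
    have "open X3" unfolding X3_def
      by (intro open_Int X1 X2 open_vimage) (auto intro: continuous_on_product_then_coordinatewise continuous_on_id)
    moreover have "z0 \<in> X3" using X1 X2 d r by (auto simp: X3_def)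
    moreover have "dist (pd i c z) (pd i c z0) < e" if "z \<in> X3" "z \<in> U" for z
    proof -
      have z: "z \<in> X1" "z \<in> X2" "z \<in> U" and zi: "dist (z0 i) (z i) < d" "dist (z0 i) (z i) < r / 2"
        using that by (auto simp: X3_def)
      have sub: "cball (z i) (r/2) \<subseteq> cball (z0 i) r"
      proof
        fix t assume "t \<in> cball (z i) (r/2)"
        then show "t \<in> cball (z0 i) r"
          using zi dist_triangle[of "z0 i" t "z i"] by auto
      qed
      have zib: "z i \<in> cball (z0 i) r" using zi r by auto
      have fd: "(\<lambda>t. g z t - g z0 t) field_differentiable at t" if "t \<in> cball (z0 i) r" for t
        by (rule field_differentiable_diff[OF gdiff[OF z(1,3) that] gdiff[OF X1(2) z0 that]])
      have "norm ((deriv ^^ 1) (\<lambda>t. g z t - g z0 t) (z i)) \<le> fact 1 * (e * r / 8) / (r/2)^1"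
      proof (rule Cauchy_inequality)
        have "t \<in> cball (z0 i) r" if "t \<in> ball (z i) (r/2)" for t
          using that sub ball_subset_cball by blast
        then show "(\<lambda>t. g z t - g z0 t) holomorphic_on ball (z i) (r/2)"
          unfolding holomorphic_on_def using fd field_differentiable_at_within by blast
        show "continuous_on (cball (z i) (r/2)) (\<lambda>t. g z t - g z0 t)"
          using fd sub field_differentiable_imp_continuous_at continuous_at_imp_continuous_on by blast
        show "0 < r/2" using r by simp
        fix t assume t: "norm (z i - t) = r / 2"
        then have "t \<in> cball (z i) (r/2)" by (simp add: dist_norm)
        then have "t \<in> cball (z0 i) r" using sub by blast
        with X2(3) z show "norm (g z t - g z0 t) \<le> e * r / 8"
          by (auto simp: dist_norm)
      qed
      moreover have "deriv (\<lambda>t. g z t - g z0 t) (z i) = deriv (g z) (z i) - deriv (g z0) (z i)"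
        by (rule deriv_diff) (use gdiff[OF z(1,3) zib] gdiff[OF X1(2) z0 zib] in auto)
      ultimately have "norm (deriv (g z) (z i) - deriv (g z0) (z i)) \<le> e / 4"
        using r by (simp add: field_simps)
      moreover have "dist (deriv (g z0) (z i)) (deriv (g z0) (z0 i)) < e / 2"
        by (rule d) (use zi in \<open>simp add: dist_commute\<close>)
      moreover have "dist (deriv (g z) (z i)) (deriv (g z0) (z0 i)) \<le>
          dist (deriv (g z) (z i)) (deriv (g z0) (z i)) + dist (deriv (g z0) (z i)) (deriv (g z0) (z0 i))"
        by (rule dist_triangle)
      ultimately have "dist (deriv (g z) (z i)) (deriv (g z0) (z0 i)) < e"
        using e by (simp add: dist_norm)
      then show ?thesis by (simp add: pd_def g_def[abs_def])
    qed
    ultimately show "\<forall>\<^sub>F x in at z0 within U. dist (pd i c x) (pd i c z0) < e"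
      unfolding eventually_at_topological by blast
  qed
qed

text \<open>In the variable of differentiation this is the holomorphy of a one-variable derivative.
  In another variable, the derivative is a uniform limit of the difference quotients
  \<open>F k\<close>, which are holomorphic there, so Weierstrass' theorem applies.\<close>

lemma sep_holomorphic_pd:
  assumes c: "sep_holomorphic m U c" and U: "coord_open m U" and i: "i < m"
  shows "sep_holomorphic m U (pd i c)"
  unfolding sep_holomorphic_def
proof (intro conjI ballI allI impI)
  show contD: "continuous_on U (pd i c)" by (rule sep_holomorphic_pd_cont[OF assms])
  fix z j assume z: "z \<in> U" and j: "j < m"
  have zC: "z \<in> complex_coord_space m" using U z by (rule coord_open_subset)
  have contc: "continuous_on U c" using c by (simp add: sep_holomorphic_def)
  show "(\<lambda>t. pd i c (z(j := t))) field_differentiable at (z j)"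
  proof (cases "j = i")
    case True
    have "(\<lambda>t. c (z(i := t))) holomorphic_on {t. z(i := t) \<in> U}"
      unfolding holomorphic_on_def
      using sep_holomorphic_slice[OF c _ i] by (auto intro: field_differentiable_at_within)
    then have "deriv (\<lambda>t. c (z(i := t))) holomorphic_on {t. z(i := t) \<in> U}"
      using coord_open_slice[OF U zC i] by (rule holomorphic_deriv)
    then have "deriv (\<lambda>t. c (z(i := t))) field_differentiable at (z i)"
      using coord_open_slice[OF U zC i] z by (auto intro: holomorphic_on_imp_differentiable_at)
    then show ?thesis using True by (simp add: pd_def)
  next
    case False
    obtain r1 X where r1: "r1 > 0" and X: "open X" "z \<in> X"
      and box: "\<And>z' t. z' \<in> X \<Longrightarrow> z' \<in> complex_coord_space m \<Longrightarrow> t \<in> cball (z i) r1 \<Longrightarrow> z'(i := t) \<in> U"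
      using coord_open_box[OF U z i] by metis
    have "open ((\<lambda>t. z(j := t)) -` X)"
      by (intro open_vimage X continuous_on_fun_upd continuous_intros)
    moreover have "z j \<in> (\<lambda>t. z(j := t)) -` X" using X by simp
    ultimately obtain r2 where r2: "r2 > 0" "cball (z j) r2 \<subseteq> (\<lambda>t. z(j := t)) -` X"
      by (meson open_contains_cball)
    define w where "w t s = z(j := t, i := s)" for t s
    have wU: "w t s \<in> U" if "t \<in> cball (z j) r2" "s \<in> cball (z i) r1" for t s
      unfolding w_def using that r2 by (intro box coord_space_upd zC j) auto
    have wupd: "(w t s)(i := s') = w t s'" "w t s i = s" "w t (z i) = z(j := t)" for t s s'
      using False by (auto simp: w_def)
    have wupdj: "(w t s)(j := t') = w t' s" "w t s j = t" for t s t'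
      using False by (auto simp: w_def fun_upd_twist)
    have Dder: "((\<lambda>s. c (w t s)) has_field_derivative pd i c (w t s)) (at s)"
      if "t \<in> cball (z j) r2" "s \<in> cball (z i) r1" for t s
    proof -
      have "(\<lambda>s'. c ((w t s)(i := s'))) field_differentiable at (w t s i)"
        using c wU[OF that] i unfolding sep_holomorphic_def by blast
      then show ?thesis
        by (simp add: wupd pd_def field_differentiable_derivI)
    qed
    have tdiff: "(\<lambda>t. c (w t s)) field_differentiable at t"
      if "t \<in> cball (z j) r2" "s \<in> cball (z i) r1" for t s
    proof -
      have "(\<lambda>t'. c ((w t s)(j := t'))) field_differentiable at (w t s j)"
        using c wU[OF that] j unfolding sep_holomorphic_def by blast
      then show ?thesis by (simp add: wupdj)
    qed
    \<comment> \<open>Nonzero steps tending to 0 that keep \<open>z i + \<delta> k\<close> in the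
      disc of radius \<open>r1\<close>.\<close>
    define \<delta> where "\<delta> k = complex_of_real (r1 / (real k + 1))" for k :: nat
    have \<delta>norm: "norm (\<delta> k) = r1 / (real k + 1)" for k
      using r1 unfolding \<delta>_def norm_of_real by simp
    have \<delta>0: "\<delta> k \<noteq> 0" for k
    proof
      have "norm (\<delta> k) > 0" unfolding \<delta>norm using r1 by simp
      moreover assume "\<delta> k = 0"
      ultimately show False by simp
    qed
    have \<delta>b: "norm (\<delta> k) \<le> r1" for k
      unfolding \<delta>norm using r1 by (simp add: field_simps)
    define F where "F k t = (c (w t (z i + \<delta> k)) - c (w t (z i))) / \<delta> k" for k t
    have mem: "z i + \<delta> k \<in> cball (z i) r1" "z i \<in> cball (z i) r1" for k
      using \<delta>b r1 by (auto simp: dist_norm)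
    have Fd: "F k field_differentiable at t" if "t \<in> cball (z j) r2" for k t
      unfolding F_def using tdiff[OF that] mem \<delta>0
      by (intro field_differentiable_divide field_differentiable_diff) auto
    have ul: "uniform_limit (cball (z j) r2) F (\<lambda>t. pd i c (w t (z i))) sequentially"
    proof (rule uniform_limitI)
      fix e :: real assume e: "e > 0"
      have cD: "continuous_on (cball (z i) r1 \<times> cball (z j) r2) (\<lambda>p. pd i c (w (snd p) (fst p)))"
        unfolding w_def
        by (intro continuous_on_compose2[OF contD] continuous_on_fun_upd continuous_intros)
           (use wU w_def in auto)
      obtain X0 where X0: "z i \<in> X0" "open X0"
        "\<forall>s\<in>X0 \<inter> cball (z i) r1. \<forall>t\<in>cball (z j) r2.
           dist (pd i c (w (snd (s,t)) (fst (s,t)))) (pd i c (w (snd (z i,t)) (fst (z i,t)))) \<le> e/2"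
        using continuous_on_prod_compactE[OF cD compact_cball mem(2), of "e/2"] e by auto
      obtain d where d: "d > 0" "cball (z i) d \<subseteq> X0"
        using X0 by (meson open_contains_cball)
      have "\<forall>\<^sub>F k in sequentially. norm (\<delta> k) < d"
        unfolding \<delta>norm using d r1 by real_asymp
      then show "\<forall>\<^sub>F k in sequentially. \<forall>t\<in>cball (z j) r2. dist (F k t) (pd i c (w t (z i))) < e"
      proof eventually_elim
        case (elim k)
        show ?case
        proof
          fix t assume t: "t \<in> cball (z j) r2"
          define D where "D = pd i c (w t (z i))"
          have S: "cball (z i) (norm (\<delta> k)) \<subseteq> X0 \<inter> cball (z i) r1"
            using d elim \<delta>b[of k] by auto
          \<comment> \<open>The mean value inequality is applied to
            \<open>c (w t s) - D * s\<close>. Its derivative is at most \<open>e / 2\<close> in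
            norm, uniformly in \<open>t\<close>, and this bounds the error of the difference
            quotient.\<close>
          have "norm ((c (w t (z i + \<delta> k)) - D * (z i + \<delta> k)) - (c (w t (z i)) - D * z i)) \<le> e/2 * norm ((z i + \<delta> k) - z i)"
          proof (rule field_differentiable_bound[where S = "cball (z i) (norm (\<delta> k))" and f' = "\<lambda>s. pd i c (w t s) - D"])
            fix s assume s: "s \<in> cball (z i) (norm (\<delta> k))"
            then have s': "s \<in> cball (z i) r1" "s \<in> X0" using S by auto
            show "((\<lambda>s. c (w t s) - D * s) has_field_derivative pd i c (w t s) - D) (at s within cball (z i) (norm (\<delta> k)))"
              by (rule has_field_derivative_at_within) (auto intro!: derivative_eq_intros Dder[OF t s'(1)])
            show "norm (pd i c (w t s) - D) \<le> e/2"
              using X0(3) s' t by (auto simp: D_def dist_norm)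
          qed (auto simp: dist_norm)
          moreover have "(c (w t (z i + \<delta> k)) - D * (z i + \<delta> k)) - (c (w t (z i)) - D * z i) = (F k t - D) * \<delta> k"
            using \<delta>0[of k] by (simp add: F_def field_simps)
          ultimately have "norm (F k t - D) * norm (\<delta> k) \<le> e/2 * norm (\<delta> k)"
            by (simp add: norm_mult)
          then have "norm (F k t - D) \<le> e/2"
            using \<delta>0[of k] by simp
          then show "dist (F k t) (pd i c (w t (z i))) < e"
            using e by (simp add: dist_norm D_def)
        qed
      qed
    qed
    have "(\<lambda>t. pd i c (w t (z i))) holomorphic_on ball (z j) r2"
    proof (rule holomorphic_uniform_limit[OF _ ul])
      show "\<forall>\<^sub>F k in sequentially. continuous_on (cball (z j) r2) (F k) \<and> F k holomorphic_on ball (z j) r2"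
        using Fd unfolding holomorphic_on_def
        by (intro always_eventually allI conjI continuous_at_imp_continuous_on ballI
            field_differentiable_imp_continuous_at) (auto intro: field_differentiable_at_within)
    qed auto
    then have "(\<lambda>t. pd i c (w t (z i))) field_differentiable at (z j)"
      using r2 by (auto intro: holomorphic_on_imp_differentiable_at)
    then show ?thesis by (simp add: wupd)
  qed
qed

lemma sep_holomorphic_const: "sep_holomorphic m U (\<lambda>z. a)"
  by (simp add: sep_holomorphic_def)

lemma sep_holomorphic_add:
  "sep_holomorphic m U f \<Longrightarrow> sep_holomorphic m U g \<Longrightarrow> sep_holomorphic m U (\<lambda>z. f z + g z)"
  unfolding sep_holomorphic_def by (intro conjI ballI allI impI continuous_on_add field_differentiable_add) blast+

lemma sep_holomorphic_mult:
  "sep_holomorphic m U f \<Longrightarrow> sep_holomorphic m U g \<Longrightarrow> sep_holomorphic m U (\<lambda>z. f z * g z)"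
  unfolding sep_holomorphic_def by (intro conjI ballI allI impI continuous_on_mult field_differentiable_mult) blast+

lemma sep_holomorphic_divide:
  "sep_holomorphic m U f \<Longrightarrow> sep_holomorphic m U g \<Longrightarrow> (\<And>z. z \<in> U \<Longrightarrow> g z \<noteq> 0) \<Longrightarrow>
   sep_holomorphic m U (\<lambda>z. f z / g z)"
  unfolding sep_holomorphic_def
  by (intro conjI ballI allI impI continuous_on_divide field_differentiable_divide) simp_all

lemma sep_holomorphic_subset:
  "sep_holomorphic m U f \<Longrightarrow> V \<subseteq> U \<Longrightarrow> sep_holomorphic m V f"
  by (auto simp: sep_holomorphic_def intro: continuous_on_subset)

lemma holomorphic_map_iff: "holomorphic_map m U \<phi> \<longleftrightarrow> (\<forall>a. sep_holomorphic m U (\<lambda>z. \<phi> z a))"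
proof -
  have "continuous_on U \<phi> \<longleftrightarrow> (\<forall>a. continuous_on U (\<lambda>z. \<phi> z a))"
    using continuous_on_coordinatewise_then_product[of U \<phi>] continuous_on_product_then_coordinatewise[of U \<phi>]
    by metis
  then show ?thesis
    unfolding holomorphic_map_def sep_holomorphic_def by blast
qed

lemma pd_has_derivative:
  "sep_holomorphic m U c \<Longrightarrow> z \<in> U \<Longrightarrow> i < m \<Longrightarrow>
     ((\<lambda>t. c (z(i := t))) has_field_derivative pd i c z) (at (z i))"
  unfolding pd_def sep_holomorphic_def by (blast intro: field_differentiable_derivI)

section \<open>Polynomial maps and their iterated partial derivatives\<close>

definition mono_eval :: "nat multiset \<Rightarrow> (nat \<Rightarrow> complex) \<Rightarrow> complex" where
  "mono_eval M z = (\<Prod>l\<in>#M. z l)"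

lemma mono_eval_simps [simp]:
  "mono_eval {#} z = 1" "mono_eval (add_mset l M) z = z l * mono_eval M z"
  by (simp_all add: mono_eval_def)

lemma mono_eval_0: "mono_eval M (\<lambda>_. 0) = (if M = {#} then 1 else 0)"
  by (cases M) auto

lemma continuous_on_mono_eval: "continuous_on S (mono_eval M)"
proof (induct M)
  case empty then show ?case by (simp add: mono_eval_def)
next
  case (add l M)
  have "continuous_on S (\<lambda>z. z l * mono_eval M z)"
    by (intro continuous_on_mult add continuous_on_product_then_coordinatewise[OF continuous_on_id])
  then show ?case by (simp add: fun_eq_iff cong: continuous_on_cong)
qed

lemma mono_eval_chain:
  assumes "\<And>l. l \<in># M \<Longrightarrow> ((\<lambda>t. w t l) has_field_derivative w' l) (at t0)"
  shows "((\<lambda>t. mono_eval M (w t)) has_field_derivative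
           (\<Sum>l\<in>#M. mono_eval (M - {#l#}) (w t0) * w' l)) (at t0)"
  using assms
proof (induct M)
  case empty then show ?case by (simp add: mono_eval_def)
next
  case (add x M)
  have eq: "(\<Sum>l\<in>#M. mono_eval (add_mset x M - {#l#}) (w t0) * w' l) =
      w t0 x * (\<Sum>l\<in>#M. mono_eval (M - {#l#}) (w t0) * w' l)"
    unfolding sum_mset_distrib_left
  proof (intro arg_cong[where f = sum_mset] image_mset_cong)
    fix l assume "l \<in># M"
    then have "add_mset x M - {#l#} = add_mset x (M - {#l#})" by simp
    then show "mono_eval (add_mset x M - {#l#}) (w t0) * w' l =
        w t0 x * (mono_eval (M - {#l#}) (w t0) * w' l)" by (simp add: algebra_simps)
  qed
  have IH: "((\<lambda>t. mono_eval M (w t)) has_field_derivative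
      (\<Sum>l\<in>#M. mono_eval (M - {#l#}) (w t0) * w' l)) (at t0)"
    using add by simp
  have "((\<lambda>t. w t x * mono_eval M (w t)) has_field_derivative
      w' x * mono_eval M (w t0) + w t0 x * (\<Sum>l\<in>#M. mono_eval (M - {#l#}) (w t0) * w' l)) (at t0)"
    using DERIV_mult[OF add.prems[of x] IH] by (simp add: algebra_simps)
  then show ?case using eq by (simp add: algebra_simps)
qed

lemma sum_mset_eq_sum_count:
  assumes "finite A" "set_mset M \<subseteq> A"
  shows "(\<Sum>l\<in>#M. f l :: complex) = (\<Sum>l\<in>A. of_nat (count M l) * f l)"
  using assms(2)
proof (induct M)
  case (add x M)
  have "(\<Sum>l\<in>A. of_nat (count (add_mset x M) l) * f l) =
      (\<Sum>l\<in>A. of_nat (count M l) * f l + (if l = x then f l else 0))"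
    by (intro sum.cong refl) (auto simp: algebra_simps)
  also have "\<dots> = (\<Sum>l\<in>A. of_nat (count M l) * f l) + f x"
    using add.prems assms(1) by (simp add: sum.distrib)
  finally show ?case using add by simp
qed auto

text \<open>Vector-valued polynomials with exponents as multisets. Several indices \<open>t\<close>
  may carry the same monomial, so the terms of an expansion can be listed without collecting
  them.\<close>

definition poly_map :: "'t set \<Rightarrow> ('t \<Rightarrow> nat multiset) \<Rightarrow> ('t \<Rightarrow> 'a \<Rightarrow> complex) \<Rightarrow>
    (nat \<Rightarrow> complex) \<Rightarrow> 'a \<Rightarrow> complex" where
  "poly_map K M v z a = (\<Sum>t\<in>K. mono_eval (M t) z * v t a)"

text \<open>The product of falling factorials that arises when a monomial is differentiated along
  the list; as in \<open>partials\<close>, the head of the list is differentiated last.\<close>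

fun deriv_coeff :: "nat list \<Rightarrow> nat multiset \<Rightarrow> complex" where
  "deriv_coeff [] M = 1"
| "deriv_coeff (j # js) M = deriv_coeff js M * of_nat (count (M - mset js) j)"

lemma deriv_coeff_eq_0: "\<not> mset js \<subseteq># M \<Longrightarrow> deriv_coeff js M = 0"
proof (induct js)
  case (Cons j js)
  show ?case
  proof (cases "mset js \<subseteq># M")
    case True
    have "count (M - mset js) j = 0"
    proof (rule ccontr)
      assume "count (M - mset js) j \<noteq> 0"
      then have "mset (j # js) \<subseteq># M"
        using True by (auto simp: subseteq_mset_def)
      with Cons.prems show False by simp
    qed
    then show ?thesis by simp
  qed (use Cons.hyps in simp)
qed auto

lemma deriv_coeff_mset: "deriv_coeff js (mset js) \<noteq> 0"
proof -
  have "deriv_coeff js M \<noteq> 0" if "mset js \<subseteq># M" for M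
    using that
  proof (induct js)
    case (Cons j js)
    then have le: "count (mset (j # js)) a \<le> count M a" for a
      unfolding subseteq_mset_def by blast
    have "count (mset js) a \<le> count M a" for a
      using le[of a] by (auto split: if_splits)
    then have "mset js \<subseteq># M" unfolding subseteq_mset_def by blast
    moreover have "count (M - mset js) j > 0" using le[of j] by simp
    ultimately show ?case using Cons by simp
  qed auto
  then show ?thesis by simp
qed

text \<open>For a polynomial along a curve \<open>w\<close>, the product rule on monomials already
  gives the full chain rule. It is applied both to coordinate lines and to their images under a
  reparametrization.\<close>

lemma poly_map_chain:
  assumes "finite K" "\<And>t. t \<in> K \<Longrightarrow> set_mset (M t) \<subseteq> {..<m}"
    and w: "\<And>l. l < m \<Longrightarrow> ((\<lambda>t. w t l) has_field_derivative w' l) (at t0)"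
  shows "((\<lambda>s. \<Sum>t\<in>K. mono_eval (M t) (w s) * c t) has_field_derivative
    (\<Sum>l<m. (\<Sum>t\<in>K. of_nat (count (M t) l) * mono_eval (M t - {#l#}) (w t0) * c t) * w' l)) (at t0)"
proof -
  have "((\<lambda>s. \<Sum>t\<in>K. mono_eval (M t) (w s) * c t) has_field_derivative
      (\<Sum>t\<in>K. (\<Sum>l\<in>#M t. mono_eval (M t - {#l#}) (w t0) * w' l) * c t)) (at t0)"
    by (intro DERIV_sum DERIV_cmult_right mono_eval_chain w) (use assms(2) in auto)
  also have "(\<Sum>t\<in>K. (\<Sum>l\<in>#M t. mono_eval (M t - {#l#}) (w t0) * w' l) * c t) =
      (\<Sum>t\<in>K. \<Sum>l<m. of_nat (count (M t) l) * (mono_eval (M t - {#l#}) (w t0) * w' l) * c t)"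
    by (intro sum.cong refl)
       (simp add: sum_mset_eq_sum_count[OF finite_lessThan assms(2)] sum_distrib_right)
  also have "\<dots> = (\<Sum>l<m. \<Sum>t\<in>K. of_nat (count (M t) l) * (mono_eval (M t - {#l#}) (w t0) * w' l) * c t)"
    by (rule sum.swap)
  finally show ?thesis
    by (simp add: sum_distrib_right sum_distrib_left algebra_simps)
qed

lemma partials_Cons: "partials (i # is) \<phi> = partial i (partials is \<phi>)"
  by (simp add: partials_def)

lemma partials_Nil [simp]: "partials [] \<phi> = \<phi>"
  by (simp add: partials_def)

lemma sum_mult_delta: "j < m \<Longrightarrow> (\<Sum>l<m::nat. X l * (if l = j then 1 else 0)) = (X j :: complex)"
  by (subst mult_delta_right, subst sum.delta) auto

lemma partials_poly_map:
  assumes K: "finite K" "\<And>t. t \<in> K \<Longrightarrow> set_mset (M t) \<subseteq> {..<m}" and "set js \<subseteq> {..<m}"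
  shows "partials js (poly_map K M v) z a =
     (\<Sum>t\<in>K. mono_eval (M t - mset js) z * (deriv_coeff js (M t) * v t a))"
  using assms(3)
proof (induct js arbitrary: z a)
  case Nil then show ?case by (simp add: poly_map_def)
next
  case (Cons j js)
  have eq: "partials js (poly_map K M v) =
      (\<lambda>z a. \<Sum>t\<in>K. mono_eval (M t - mset js) z * (deriv_coeff js (M t) * v t a))"
    using Cons by (intro ext) auto
  have "((\<lambda>s. \<Sum>t\<in>K. mono_eval (M t - mset js) (z(j := s)) * (deriv_coeff js (M t) * v t a))
     has_field_derivative (\<Sum>l<m. (\<Sum>t\<in>K. of_nat (count (M t - mset js) l) *
        mono_eval (M t - mset js - {#l#}) (z(j := z j)) * (deriv_coeff js (M t) * v t a)) *
         (if l = j then 1 else 0))) (at (z j))"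
    by (rule poly_map_chain[OF K(1)]) (use K(2) in \<open>auto dest!: in_diffD\<close>)
  then have "deriv (\<lambda>s. \<Sum>t\<in>K. mono_eval (M t - mset js) (z(j := s)) * (deriv_coeff js (M t) * v t a)) (z j)
     = (\<Sum>l<m. (\<Sum>t\<in>K. of_nat (count (M t - mset js) l) *
        mono_eval (M t - mset js - {#l#}) (z(j := z j)) * (deriv_coeff js (M t) * v t a)) *
         (if l = j then 1 else 0))"
    by (rule DERIV_imp_deriv)
  also have "\<dots> = (\<Sum>t\<in>K. mono_eval (M t - mset (j # js)) z * (deriv_coeff (j # js) (M t) * v t a))"
    using Cons.prems by (subst sum_mult_delta) (simp_all add: algebra_simps)
  finally show ?case
    by (simp add: partials_Cons partial_def eq)
qed

text \<open>Monomials not divisible by the one of \<open>js\<close> are killed by the derivative,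
  and its proper multiples by the evaluation at the origin.\<close>

lemma partials_poly_map_0:
  assumes K: "finite K" "\<And>t. t \<in> K \<Longrightarrow> set_mset (M t) \<subseteq> {..<m}" and js: "set js \<subseteq> {..<m}"
  shows "partials js (poly_map K M v) 0 =
     fscale (deriv_coeff js (mset js)) (\<Sum>t | t \<in> K \<and> M t = mset js. v t)"
proof
  fix a
  have "mono_eval (M t - mset js) 0 * deriv_coeff js (M t) =
      (if M t = mset js then deriv_coeff js (mset js) else 0)" for t
  proof (cases "mset js \<subseteq># M t")
    case True
    then have "M t - mset js = {#} \<longleftrightarrow> M t = mset js"
      by (metis Diff_eq_empty_iff_mset subset_mset.antisym subset_mset.order_refl)
    then show ?thesis by (auto simp: zero_fun_def mono_eval_0)
  next
    case False
    then show ?thesis by (auto simp: deriv_coeff_eq_0)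
  qed
  then have *: "mono_eval (M t - mset js) 0 * (deriv_coeff js (M t) * v t a) =
      (if M t = mset js then deriv_coeff js (mset js) * v t a else 0)" for t
    by (metis mult.assoc mult_zero_left)
  have fs: "(\<Sum>t\<in>A. v t) a = (\<Sum>t\<in>A. v t a)" for A
    by (induct A rule: infinite_finite_induct) auto
  show "partials js (poly_map K M v) 0 a =
     fscale (deriv_coeff js (mset js)) (\<Sum>t | t \<in> K \<and> M t = mset js. v t) a"
    using K(1) by (simp add: partials_poly_map[OF K js] * fscale_def fs sum_distrib_left sum.If_cases Int_def)
qed

lemma poly_map_sep_holomorphic:
  assumes K: "finite K" "\<And>t. t \<in> K \<Longrightarrow> set_mset (M t) \<subseteq> {..<m}"
  shows "sep_holomorphic m U (\<lambda>z. poly_map K M v z a)"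
  unfolding sep_holomorphic_def
proof (intro conjI ballI allI impI)
  show "continuous_on U (\<lambda>z. poly_map K M v z a)"
    unfolding poly_map_def
    by (intro continuous_on_sum continuous_on_mult_right continuous_on_mono_eval)
  fix z i assume "i < m"
  have "((\<lambda>s. \<Sum>t\<in>K. mono_eval (M t) (z(i := s)) * v t a)
     has_field_derivative (\<Sum>l<m. (\<Sum>t\<in>K. of_nat (count (M t) l) *
        mono_eval (M t - {#l#}) (z(i := z i)) * v t a) *
         (if l = i then 1 else 0))) (at (z i))"
    by (rule poly_map_chain[OF K(1)]) (use K(2) in auto)
  then show "(\<lambda>s. poly_map K M v (z(i := s)) a) field_differentiable at (z i)"
    unfolding poly_map_def field_differentiable_def by blast
qed

section \<open>Independence of the osculating space from the parametrization\<close>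

definition lists_upto :: "nat \<Rightarrow> nat \<Rightarrow> nat list set" where
  "lists_upto m k = {js. set js \<subseteq> {..<m} \<and> length js \<le> k}"

lemma finite_lists_upto [simp]: "finite (lists_upto m k)"
  unfolding lists_upto_def by (rule finite_lists_length_le[OF finite_lessThan])

lemma sum_lists_upto_Suc:
  "(\<Sum>js\<in>lists_upto m (Suc k). F js) = F [] + (\<Sum>l<m. \<Sum>js\<in>lists_upto m k. F (l # js))"
  for F :: "nat list \<Rightarrow> 'b::comm_monoid_add"
proof -
  have "lists_upto m (Suc k) = insert [] ((\<lambda>(l, js). l # js) ` ({..<m} \<times> lists_upto m k))"
  proof -
    have "js \<in> insert [] ((\<lambda>(l, js). l # js) ` ({..<m} \<times> lists_upto m k))"
      if "js \<in> lists_upto m (Suc k)" for js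
      using that by (cases js) (auto simp: lists_upto_def image_iff)
    then show ?thesis by (auto simp: lists_upto_def)
  qed
  moreover have "inj_on (\<lambda>(l, js). l # js) ({..<m} \<times> lists_upto m k)"
    by (auto simp: inj_on_def)
  ultimately show ?thesis
    by (subst \<open>lists_upto m (Suc k) = _\<close>, subst sum.insert)
       (auto simp: sum.reindex sum.cartesian_product case_prod_unfold)
qed

text \<open>The coefficients in Faa di Bruno's formula for \<open>\<mu> \<cdot> (\<phi> \<circ> \<psi>)\<close>.\<close>

fun chain_coeff :: "((nat \<Rightarrow> complex) \<Rightarrow> complex) \<Rightarrow> ((nat \<Rightarrow> complex) \<Rightarrow> nat \<Rightarrow> complex) \<Rightarrow>
    nat list \<Rightarrow> nat list \<Rightarrow> (nat \<Rightarrow> complex) \<Rightarrow> complex" where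
  "chain_coeff \<mu> \<psi> [] [] = \<mu>"
| "chain_coeff \<mu> \<psi> [] (l # js) = (\<lambda>z. 0)"
| "chain_coeff \<mu> \<psi> (i # is) [] = (\<lambda>z. pd i (chain_coeff \<mu> \<psi> is []) z)"
| "chain_coeff \<mu> \<psi> (i # is) (l # js) =
     (\<lambda>z. pd i (chain_coeff \<mu> \<psi> is (l # js)) z + chain_coeff \<mu> \<psi> is js z * pd i (\<lambda>z. \<psi> z l) z)"

text \<open>Each differentiation lengthens the list of derivatives falling on \<open>\<phi>\<close>
  by at most one.\<close>

lemma chain_coeff_long: "length is < length js \<Longrightarrow> chain_coeff \<mu> \<psi> is js = (\<lambda>z. 0)"
proof (induct "is" arbitrary: js)
  case Nil
  then show ?case by (cases js) auto
next
  case (Cons i "is")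
  then obtain l js' where "js = l # js'" by (cases js) auto
  with Cons show ?case by (simp add: pd_def)
qed

lemma sep_holomorphic_chain_coeff:
  assumes "coord_open m U" "sep_holomorphic m U \<mu>" "\<And>l. l < m \<Longrightarrow> sep_holomorphic m U (\<lambda>z. \<psi> z l)"
    "set is \<subseteq> {..<m}" "set js \<subseteq> {..<m}"
  shows "sep_holomorphic m U (chain_coeff \<mu> \<psi> is js)"
  using assms(4,5)
proof (induct "is" arbitrary: js)
  case Nil then show ?case by (cases js) (auto simp: assms(2) sep_holomorphic_const)
next
  case (Cons i "is")
  then show ?case
    by (cases js) (auto intro!: sep_holomorphic_add sep_holomorphic_mult sep_holomorphic_pd assms)
qed

text \<open>A further derivative hits either the coefficient, which keeps \<open>js\<close>, or the
  composition \<open>\<phi> \<circ> \<psi>\<close>, which prepends an index \<open>l\<close>; these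
  are the two summands in the recursion of \<open>chain_coeff\<close>.\<close>

lemma partials_reparam:
  assumes K: "finite K" "\<And>t. t \<in> K \<Longrightarrow> set_mset (M t) \<subseteq> {..<m}"
    and \<phi>: "\<phi> = poly_map K M v"
    and U: "coord_open m U" and \<mu>: "sep_holomorphic m U \<mu>"
    and \<psi>: "\<And>l. l < m \<Longrightarrow> sep_holomorphic m U (\<lambda>z. \<psi> z l)"
    and eq: "\<And>z a. z \<in> U \<Longrightarrow> \<phi>' z a = \<mu> z * \<phi> (\<psi> z) a"
    and "set is \<subseteq> {..<m}" "length is \<le> k" "z \<in> U"
  shows "partials is \<phi>' z a =
    (\<Sum>js\<in>lists_upto m k. chain_coeff \<mu> \<psi> is js z * partials js \<phi> (\<psi> z) a)"
  using assms(8-10)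
proof (induct "is" arbitrary: k z)
  case Nil
  have "(\<Sum>js\<in>lists_upto m k. chain_coeff \<mu> \<psi> [] js z * partials js \<phi> (\<psi> z) a) =
      (\<Sum>js\<in>lists_upto m k. if js = [] then \<mu> z * \<phi> (\<psi> z) a else 0)"
    by (intro sum.cong refl) (metis chain_coeff.simps(1,2) list.exhaust mult_zero_left partials_Nil)
  also have "\<dots> = \<mu> z * \<phi> (\<psi> z) a"
    by (subst sum.delta) (simp_all, simp add: lists_upto_def)
  finally show ?case using eq Nil by simp
next
  case (Cons i "is")
  then obtain k' where k: "k = Suc k'" by (cases k) auto
  have i: "i < m" and is': "set is \<subseteq> {..<m}" using Cons.prems by auto
  define C where "C = chain_coeff \<mu> \<psi> is"
  have IH: "partials is \<phi>' z a = (\<Sum>js\<in>lists_upto m k'. C js z * partials js \<phi> (\<psi> z) a)" if "z \<in> U" for z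
    unfolding C_def using Cons that k by auto
  have zC: "z \<in> complex_coord_space m" using U Cons.prems(3) by (rule coord_open_subset)
  have ev: "\<forall>\<^sub>F s in nhds (z i). partials is \<phi>' (z(i := s)) a =
      (\<Sum>js\<in>lists_upto m k'. C js (z(i := s)) * partials js \<phi> (\<psi> (z(i := s))) a)"
    unfolding eventually_nhds
    by (rule exI[of _ "{s. z(i := s) \<in> U}"])
       (use coord_open_slice[OF U zC i] Cons.prems IH in auto)
  have dP: "((\<lambda>s. partials js \<phi> (\<psi> (z(i := s))) a) has_field_derivative
     (\<Sum>l<m. partials (l # js) \<phi> (\<psi> z) a * pd i (\<lambda>z. \<psi> z l) z)) (at (z i))" if "js \<in> lists_upto m k'" for js
  proof -
    have js: "set js \<subseteq> {..<m}" using that by (simp add: lists_upto_def)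
    have "((\<lambda>s. \<Sum>t\<in>K. mono_eval (M t - mset js) (\<psi> (z(i := s))) * (deriv_coeff js (M t) * v t a))
     has_field_derivative (\<Sum>l<m. (\<Sum>t\<in>K. of_nat (count (M t - mset js) l) *
        mono_eval (M t - mset js - {#l#}) (\<psi> (z(i := z i))) * (deriv_coeff js (M t) * v t a)) *
        pd i (\<lambda>z. \<psi> z l) z)) (at (z i))"
      by (rule poly_map_chain[OF K(1)])
         (use K(2) pd_has_derivative[OF \<psi> Cons.prems(3) i] in \<open>auto dest!: in_diffD\<close>)
    moreover have "(\<Sum>l<m. (\<Sum>t\<in>K. of_nat (count (M t - mset js) l) *
        mono_eval (M t - mset js - {#l#}) (\<psi> (z(i := z i))) * (deriv_coeff js (M t) * v t a)) *
        pd i (\<lambda>z. \<psi> z l) z) = (\<Sum>l<m. partials (l # js) \<phi> (\<psi> z) a * pd i (\<lambda>z. \<psi> z l) z)"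
      using js by (intro sum.cong refl) (simp add: \<phi> partials_poly_map[OF K] algebra_simps)
    ultimately show ?thesis
      by (simp add: \<phi> partials_poly_map[OF K js])
  qed
  have dC: "((\<lambda>s. C js (z(i := s))) has_field_derivative pd i (C js) z) (at (z i))"
    if "js \<in> lists_upto m k'" for js
    unfolding C_def using that Cons.prems is' i
    by (intro pd_has_derivative[where m = m and U = U] sep_holomorphic_chain_coeff U \<mu> \<psi>)
       (auto simp: lists_upto_def)
  have "((\<lambda>s. \<Sum>js\<in>lists_upto m k'. C js (z(i := s)) * partials js \<phi> (\<psi> (z(i := s))) a) has_field_derivative
     (\<Sum>js\<in>lists_upto m k'. C js (z(i := z i)) * (\<Sum>l<m. partials (l # js) \<phi> (\<psi> z) a * pd i (\<lambda>z. \<psi> z l) z) +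
        pd i (C js) z * partials js \<phi> (\<psi> (z(i := z i))) a)) (at (z i))"
    by (intro DERIV_sum DERIV_mult' dC dP)
  then have "partials (i # is) \<phi>' z a = (\<Sum>js\<in>lists_upto m k'. C js z * (\<Sum>l<m. partials (l # js) \<phi> (\<psi> z) a * pd i (\<lambda>z. \<psi> z l) z) +
        pd i (C js) z * partials js \<phi> (\<psi> z) a)"
    unfolding partials_Cons partial_def
    by (subst deriv_cong_ev[OF ev refl]) (simp add: DERIV_imp_deriv)
  also have "\<dots> = (\<Sum>l<m. \<Sum>js\<in>lists_upto m k'. C js z * pd i (\<lambda>z. \<psi> z l) z * partials (l # js) \<phi> (\<psi> z) a) +
      (\<Sum>js\<in>lists_upto m k'. pd i (C js) z * partials js \<phi> (\<psi> z) a)"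
    by (subst sum.swap) (simp add: sum.distrib sum_distrib_left algebra_simps)
  \<comment> \<open>The range is enlarged to lists of length up to \<open>k\<close>, where the
    additional coefficients vanish. Splitting off \<open>[]\<close> then makes this sum match the
    other one index by index.\<close>
  also have "(\<Sum>js\<in>lists_upto m k'. pd i (C js) z * partials js \<phi> (\<psi> z) a) =
      (\<Sum>js\<in>lists_upto m k. pd i (C js) z * partials js \<phi> (\<psi> z) a)"
  proof (rule sum.mono_neutral_left)
    show "\<forall>js\<in>lists_upto m k - lists_upto m k'. pd i (C js) z * partials js \<phi> (\<psi> z) a = 0"
    proof
      fix js assume "js \<in> lists_upto m k - lists_upto m k'"
      then have "length is < length js" using Cons.prems k by (auto simp: lists_upto_def)
      then show "pd i (C js) z * partials js \<phi> (\<psi> z) a = 0"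
        by (simp add: C_def chain_coeff_long pd_def)
    qed
    show "lists_upto m k' \<subseteq> lists_upto m k" by (auto simp: lists_upto_def k)
  qed simp
  also have "\<dots> = pd i (C []) z * partials [] \<phi> (\<psi> z) a +
      (\<Sum>l<m. \<Sum>js\<in>lists_upto m k'. pd i (C (l # js)) z * partials (l # js) \<phi> (\<psi> z) a)"
    unfolding k by (rule sum_lists_upto_Suc)
  finally show ?case
    unfolding k sum_lists_upto_Suc
    by (simp add: C_def sum.distrib algebra_simps)
qed

text \<open>Unlike the direction in \<open>affine_osculating\<close> this includes order 0: it is
  the linear cone over the osculating space. The cone is what survives multiplication of
  \<open>\<phi>\<close> by a nonvanishing function \<open>\<mu>\<close>.\<close>

definition osc_span :: "nat \<Rightarrow> nat \<Rightarrow> ((nat \<Rightarrow> complex) \<Rightarrow> 'a \<Rightarrow> complex) \<Rightarrow> ('a \<Rightarrow> complex) set" where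
  "osc_span m s \<phi> = cfun.span ((\<lambda>js. partials js \<phi> 0) ` lists_upto m s)"

lemma osc_span_base: "set js \<subseteq> {..<m} \<Longrightarrow> length js \<le> s \<Longrightarrow> partials js \<phi> 0 \<in> osc_span m s \<phi>"
  unfolding osc_span_def by (intro cfun.span_base) (auto simp: lists_upto_def)

lemma osc_span_mono: "s \<le> s' \<Longrightarrow> osc_span m s \<phi> \<subseteq> osc_span m s' \<phi>"
  unfolding osc_span_def by (intro cfun.span_mono) (auto simp: lists_upto_def)

lemma osc_span_subspace [simp]: "cfun.subspace (osc_span m s \<phi>)"
  by (simp add: osc_span_def)

text \<open>The part of order \<open>length is\<close> in the chain rule, \<open>J\<close> being the Jacobian matrix of the
  reparametrization.\<close>

fun top_part :: "nat \<Rightarrow> (nat \<Rightarrow> nat \<Rightarrow> complex) \<Rightarrow> nat list \<Rightarrow> (nat list \<Rightarrow> 'a \<Rightarrow> complex) \<Rightarrow> 'a \<Rightarrow> complex" where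
  "top_part m J [] G = G []"
| "top_part m J (i # is) G = (\<Sum>l<m. fscale (J i l) (top_part m J is (\<lambda>js. G (l # js))))"

text \<open>To reach the length of \<open>is\<close>, every differentiation must fall on
  \<open>\<phi> \<circ> \<psi>\<close> and so contributes one entry of the Jacobian, while
  \<open>\<mu>\<close> is never differentiated.\<close>

lemma chain_coeff_top:
  assumes "length is \<le> k"
  shows "(\<Sum>js | js \<in> lists_upto m k \<and> length js = length is. chain_coeff \<mu> \<psi> is js z * G js a) =
     \<mu> z * top_part m (\<lambda>i l. pd i (\<lambda>z. \<psi> z l) z) is G a"
  using assms
proof (induct "is" arbitrary: G k)
  case Nil
  have "{js. js \<in> lists_upto m k \<and> length js = length ([] :: nat list)} = {[]}"
    by (auto simp: lists_upto_def)
  then show ?case by simp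
next
  case (Cons i "is")
  then obtain k' where k: "k = Suc k'" by (cases k) auto
  have "(\<Sum>js | js \<in> lists_upto m k \<and> length js = length (i # is). chain_coeff \<mu> \<psi> (i # is) js z * G js a) =
      (\<Sum>js\<in>lists_upto m k. if length js = length (i # is) then chain_coeff \<mu> \<psi> (i # is) js z * G js a else 0)"
    by (subst sum.If_cases) (simp_all add: Int_def)
  also have "\<dots> = (\<Sum>l<m. \<Sum>js\<in>lists_upto m k'. if length js = length is then
        chain_coeff \<mu> \<psi> is js z * pd i (\<lambda>z. \<psi> z l) z * G (l # js) a else 0)"
    unfolding k sum_lists_upto_Suc
    by (simp, intro sum.cong refl) (simp add: chain_coeff_long pd_def)
  also have "\<dots> = (\<Sum>l<m. pd i (\<lambda>z. \<psi> z l) z * (\<Sum>js\<in>lists_upto m k'. if length js = length is then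
        chain_coeff \<mu> \<psi> is js z * G (l # js) a else 0))"
    by (simp add: sum_distrib_left if_distrib[of "\<lambda>x. _ * x"] algebra_simps cong: if_cong)
  also have "\<dots> = (\<Sum>l<m. pd i (\<lambda>z. \<psi> z l) z * (\<mu> z * top_part m (\<lambda>i l. pd i (\<lambda>z. \<psi> z l) z) is (\<lambda>js. G (l # js)) a))"
  proof (intro sum.cong refl)
    fix l
    have "(\<Sum>js\<in>lists_upto m k'. if length js = length is then chain_coeff \<mu> \<psi> is js z * G (l # js) a else 0) =
       (\<Sum>js | js \<in> lists_upto m k' \<and> length js = length is. chain_coeff \<mu> \<psi> is js z * G (l # js) a)"
      by (subst sum.If_cases) (simp_all add: Int_def)
    also have "\<dots> = \<mu> z * top_part m (\<lambda>i l. pd i (\<lambda>z. \<psi> z l) z) is (\<lambda>js. G (l # js)) a"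
      using Cons k by simp
    finally show "pd i (\<lambda>z. \<psi> z l) z * (\<Sum>js\<in>lists_upto m k'. if length js = length is then chain_coeff \<mu> \<psi> is js z * G (l # js) a else 0) =
       pd i (\<lambda>z. \<psi> z l) z * (\<mu> z * top_part m (\<lambda>i l. pd i (\<lambda>z. \<psi> z l) z) is (\<lambda>js. G (l # js)) a)"
      by simp
  qed
  finally show ?case
    by (simp add: fun_sum_apply fscale_def sum_distrib_left algebra_simps)
qed

text \<open>The Jacobian acts on each index separately. Applying its inverse \<open>K\<close> to the
  first index isolates the terms with a fixed first entry, and the induction treats the other
  indices.\<close>

lemma top_part_invert:
  assumes T: "cfun.subspace T"
    and inv: "\<And>r l. r < m \<Longrightarrow> l < m \<Longrightarrow> (\<Sum>i<m. K r i * J i l) = (if r = l then 1 else 0)"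
    and top: "\<And>is. set is \<subseteq> {..<m} \<Longrightarrow> length is = k \<Longrightarrow> top_part m J is G \<in> T"
    and "set js \<subseteq> {..<m}" "length js = k"
  shows "G js \<in> T"
  using top assms(4,5)
proof (induct k arbitrary: G js)
  case 0
  then show ?case using 0(1)[of "[]"] by simp
next
  case (Suc k)
  then obtain r js' where js: "js = r # js'" by (cases js) auto
  have r: "r < m" using Suc.prems js by simp
  have "G (r # js') \<in> T"
  proof (rule Suc.hyps[where G = "\<lambda>js. G (r # js)" and js = js'])
    fix "is" assume "is": "set is \<subseteq> {..<m}" "length is = k"
    define P where "P l = top_part m J is (\<lambda>js. G (l # js))" for l
    have "(\<Sum>l<m. fscale (J i l) (P l)) \<in> T" if "i < m" for i
      using Suc.prems(1)[of "i # is"] that "is" by (simp add: P_def)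
    then have "fscale (K r i) (\<Sum>l<m. fscale (J i l) (P l)) \<in> T" if "i < m" for i
      using cfun.subspace_scale[OF T] that by blast
    then have "(\<Sum>i<m. fscale (K r i) (\<Sum>l<m. fscale (J i l) (P l))) \<in> T"
      by (rule cfun.subspace_sum[OF T]) simp
    also have "(\<Sum>i<m. fscale (K r i) (\<Sum>l<m. fscale (J i l) (P l))) = (\<Sum>l<m. fscale (\<Sum>i<m. K r i * J i l) (P l))"
      by (simp add: cfun.scale_sum_right cfun.scale_sum_left) (rule sum.swap)
    also have "\<dots> = (\<Sum>l<m. if l = r then P r else 0)"
      by (intro sum.cong refl) (use inv[OF r] in \<open>auto simp: fscale_def fun_eq_iff\<close>)
    also have "\<dots> = P r" using r by (subst sum.delta) auto
    finally show "top_part m J is (\<lambda>js. G (r # js)) \<in> T" by (simp add: P_def)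
  qed (use Suc.prems js in auto)
  then show ?case by (simp add: js)
qed

text \<open>Modulo lower order, the derivatives of \<open>\<mu> \<cdot> (\<phi> \<circ> \<psi>)\<close> and of \<open>\<phi>\<close> of a given order differ by a symmetric
  power of the Jacobian of \<open>\<psi>\<close>, so both span the same space as soon as the Jacobian is invertible.\<close>

lemma osc_span_reparam:
  assumes K: "finite K" "\<And>t. t \<in> K \<Longrightarrow> set_mset (M t) \<subseteq> {..<m}"
    and \<phi>: "\<phi> = poly_map K M v"
    and U: "coord_open m U" and zU: "0 \<in> U" and \<mu>: "sep_holomorphic m U \<mu>"
    and \<psi>: "\<And>l. l < m \<Longrightarrow> sep_holomorphic m U (\<lambda>z. \<psi> z l)"
    and eq: "\<And>z a. z \<in> U \<Longrightarrow> \<phi>' z a = \<mu> z * \<phi> (\<psi> z) a"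
    and \<mu>0: "\<mu> 0 \<noteq> 0" and \<psi>0: "\<psi> 0 = 0"
    and inv: "\<And>r l. r < m \<Longrightarrow> l < m \<Longrightarrow> (\<Sum>i<m. N r i * pd i (\<lambda>z. \<psi> z l) 0) = (if r = l then 1 else 0)"
  shows "osc_span m s \<phi>' = osc_span m s \<phi>"
proof
  define J where "J i l = pd i (\<lambda>z. \<psi> z l) 0" for i l
  have expand: "partials is \<phi>' 0 = (\<Sum>js\<in>lists_upto m k. fscale (chain_coeff \<mu> \<psi> is js 0) (partials js \<phi> 0))"
    if "set is \<subseteq> {..<m}" "length is \<le> k" for k "is"
    using partials_reparam[OF K \<phi> U \<mu> \<psi> eq that zU] unfolding \<psi>0
    by (intro ext) (simp only: fun_sum_apply fscale_def)
  show "osc_span m s \<phi>' \<subseteq> osc_span m s \<phi>"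
    unfolding osc_span_def[of m s \<phi>']
  proof (rule cfun.span_minimal)
    show "(\<lambda>js. partials js \<phi>' 0) ` lists_upto m s \<subseteq> osc_span m s \<phi>"
    proof clarify
      fix "is" assume "is \<in> lists_upto m s"
      then have "is": "set is \<subseteq> {..<m}" "length is \<le> s" by (auto simp: lists_upto_def)
      show "partials is \<phi>' 0 \<in> osc_span m s \<phi>"
        unfolding expand[OF "is"]
        by (intro cfun.subspace_sum cfun.subspace_scale osc_span_base) (auto simp: lists_upto_def)
    qed
  qed simp
  show "osc_span m s \<phi> \<subseteq> osc_span m s \<phi>'"
  proof (induct s)
    case 0
    have "\<phi> 0 = fscale (1 / \<mu> 0) (\<phi>' 0)"
      using eq[OF zU] \<mu>0 by (simp add: fun_eq_iff fscale_def \<psi>0)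
    moreover have "\<phi>' 0 \<in> osc_span m 0 \<phi>'" using osc_span_base[of "[]"] by simp
    ultimately have "\<phi> 0 \<in> osc_span m 0 \<phi>'" by (simp add: cfun.subspace_scale)
    then show ?case
      unfolding osc_span_def[of m 0 \<phi>] by (intro cfun.span_minimal) (auto simp: lists_upto_def)
  next
    case (Suc s)
    have low: "partials js \<phi> 0 \<in> osc_span m (Suc s) \<phi>'" if "set js \<subseteq> {..<m}" "length js \<le> s" for js
      using Suc osc_span_mono[of s "Suc s" m \<phi>'] osc_span_base[OF that, of \<phi>] by auto
    have "partials js \<phi> 0 \<in> osc_span m (Suc s) \<phi>'" if js: "set js \<subseteq> {..<m}" "length js = Suc s" for js
    proof (rule top_part_invert[where G = "\<lambda>js. partials js \<phi> 0" and m = m and K = N and J = J and k = "Suc s"])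
      fix "is" assume "is": "set is \<subseteq> {..<m}" "length is = Suc s"
      have "partials is \<phi>' 0 =
         (\<Sum>js | js \<in> lists_upto m (Suc s) \<and> length js = length is. fscale (chain_coeff \<mu> \<psi> is js 0) (partials js \<phi> 0)) +
         (\<Sum>js | js \<in> lists_upto m (Suc s) \<and> length js \<noteq> length is. fscale (chain_coeff \<mu> \<psi> is js 0) (partials js \<phi> 0))"
        unfolding expand[OF "is"(1) eq_refl[OF "is"(2)]]
        by (subst sum.union_disjoint[symmetric]) (auto intro!: sum.cong)
      moreover have "(\<Sum>js | js \<in> lists_upto m (Suc s) \<and> length js = length is. fscale (chain_coeff \<mu> \<psi> is js 0) (partials js \<phi> 0))
          = fscale (\<mu> 0) (top_part m J is (\<lambda>js. partials js \<phi> 0))"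
        using chain_coeff_top[OF eq_refl[OF "is"(2)], where \<mu> = \<mu> and \<psi> = \<psi> and z = 0 and m = m and G = "\<lambda>js. partials js \<phi> 0"] "is"
        by (intro ext) (simp add: fun_sum_apply fscale_def J_def[abs_def])
      \<comment> \<open>The chain rule is solved for its top part; the other terms are derivatives
        of lower order, which lie in the span for \<open>\<phi>'\<close> by induction.\<close>
      ultimately have eq': "top_part m J is (\<lambda>js. partials js \<phi> 0) = fscale (1 / \<mu> 0) (partials is \<phi>' 0 -
         (\<Sum>js | js \<in> lists_upto m (Suc s) \<and> length js \<noteq> length is. fscale (chain_coeff \<mu> \<psi> is js 0) (partials js \<phi> 0)))"
        using \<mu>0 by (simp add: fun_eq_iff fscale_def)
      show "top_part m J is (\<lambda>js. partials js \<phi> 0) \<in> osc_span m (Suc s) \<phi>'"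
        unfolding eq'
      proof (intro cfun.subspace_scale cfun.subspace_diff cfun.subspace_sum osc_span_subspace)
        show "partials is \<phi>' 0 \<in> osc_span m (Suc s) \<phi>'" using "is" by (intro osc_span_base) auto
        fix js assume "js \<in> {js. js \<in> lists_upto m (Suc s) \<and> length js \<noteq> length is}"
        then show "partials js \<phi> 0 \<in> osc_span m (Suc s) \<phi>'"
          using "is" by (intro low) (auto simp: lists_upto_def)
      qed
    qed (use js inv in \<open>auto simp: J_def\<close>)
    then have "partials js \<phi> 0 \<in> osc_span m (Suc s) \<phi>'" if "js \<in> lists_upto m (Suc s)" for js
      using low that by (auto simp: lists_upto_def le_Suc_eq)
    then show ?case
      unfolding osc_span_def[of m "Suc s" \<phi>] by (intro cfun.span_minimal) auto
  qed
qed

text \<open>The derivative of \<open>\<mu> \<cdot> (\<phi> \<circ> \<psi>)\<close> would map a vector in the kernel of the Jacobian of \<open>\<psi>\<close> to a multiple of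
  \<open>\<phi> (\<psi> 0)\<close>, on which \<open>h\<close> does not vanish.\<close>

lemma reparam_jacobian:
  fixes K :: "'t set"
  assumes K: "finite K" "\<And>t. t \<in> K \<Longrightarrow> set_mset (M t) \<subseteq> {..<m}"
    and \<phi>: "\<phi> = poly_map K M v"
    and U: "coord_open m U" and zU: "0 \<in> U" and \<mu>: "sep_holomorphic m U \<mu>"
    and \<psi>: "\<And>l. l < m \<Longrightarrow> sep_holomorphic m U (\<lambda>z. \<psi> z l)"
    and eq: "\<And>z a. z \<in> U \<Longrightarrow> \<phi>' z a = \<mu> z * \<phi> (\<psi> z) a"
    and \<mu>0: "\<mu> 0 \<noteq> 0"
    and h: "Vector_Spaces.linear fscale (*) h" and h1: "\<And>z. z \<in> U \<Longrightarrow> h (\<phi>' z) = 1"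
    and imm: "cfun.dim ((\<lambda>i. partial i \<phi>' 0) ` {..<m}) = m"
  obtains N where "\<And>r l. r < m \<Longrightarrow> l < m \<Longrightarrow> (\<Sum>i<m. N r i * pd i (\<lambda>z. \<psi> z l) 0) = (if r = l then 1 else 0)"
proof -
  define J where "J i l = pd i (\<lambda>z. \<psi> z l) 0" for i l
  have hsum: "h (\<Sum>t\<in>A. fscale (c t) (w t)) = (\<Sum>t\<in>A. c t * h (w t))" for A :: "'t set" and c w
  proof -
    interpret h: Vector_Spaces.linear fscale "(*)" h by (rule h)
    show ?thesis by (simp add: h.sum h.scale)
  qed
  have hsum': "h (\<Sum>t\<in>A. fscale (c t) (w t)) = (\<Sum>t\<in>A. c t * h (w t))" for A :: "nat set" and c w
  proof -
    interpret h: Vector_Spaces.linear fscale "(*)" h by (rule h)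
    show ?thesis by (simp add: h.sum h.scale)
  qed
  have hadd: "h (x + y) = h x + h y" "h (fscale c x) = c * h x" for x y c
    using h by (auto simp: Vector_Spaces.linear_iff)
  define D where "D l = partials [l] \<phi> (\<psi> 0)" for l
  \<comment> \<open>The functional \<open>h\<close> is linear but possibly discontinuous. Writing
    \<open>\<phi>\<close> as a finite sum of fixed vectors allows \<open>h\<close> to be
    interchanged with derivatives.\<close>
  have \<phi>vec: "\<phi> z = (\<Sum>t\<in>K. fscale (mono_eval (M t) z) (v t))" for z
    by (intro ext) (simp add: \<phi> poly_map_def fun_sum_apply fscale_def)
  have Dvec: "D l = (\<Sum>t\<in>K. fscale (of_nat (count (M t) l) * mono_eval (M t - {#l#}) (\<psi> 0)) (v t))" if "l < m" for l
    using that by (intro ext) (simp add: D_def \<phi> partials_poly_map[OF K] fun_sum_apply fscale_def algebra_simps)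
  have d\<phi>': "partial i \<phi>' 0 = fscale (pd i \<mu> 0) (\<phi> (\<psi> 0)) + fscale (\<mu> 0) (\<Sum>l<m. fscale (J i l) (D l))"
    if i: "i < m" for i
  proof
    fix a
    have "partials [i] \<phi>' 0 a = (\<Sum>js\<in>lists_upto m (Suc 0). chain_coeff \<mu> \<psi> [i] js 0 * partials js \<phi> (\<psi> 0) a)"
      by (rule partials_reparam[OF K \<phi> U \<mu> \<psi> eq]) (use i zU in auto)
    moreover have "lists_upto m 0 = {[]}" by (auto simp: lists_upto_def)
    ultimately show "partial i \<phi>' 0 a = (fscale (pd i \<mu> 0) (\<phi> (\<psi> 0)) + fscale (\<mu> 0) (\<Sum>l<m. fscale (J i l) (D l))) a"
      by (simp add: partials_Cons sum_lists_upto_Suc fun_sum_apply fscale_def J_def D_def pd_def sum_distrib_left algebra_simps)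
  qed
  have h\<phi>': "h (\<phi>' z) = \<mu> z * h (\<phi> (\<psi> z))" if "z \<in> U" for z
  proof -
    have "\<phi>' z = fscale (\<mu> z) (\<phi> (\<psi> z))" using eq[OF that] by (intro ext) (simp add: fscale_def)
    then show ?thesis by (simp add: hadd)
  qed
  have h0: "h (partial i \<phi>' 0) = 0" if i: "i < m" for i
  proof -
    have zC: "0 \<in> complex_coord_space m" using U zU by (rule coord_open_subset)
    have opn: "open {s. 0(i := s) \<in> U}" using U zC i by (rule coord_open_slice)
    have "((\<lambda>s. \<Sum>t\<in>K. mono_eval (M t) (\<psi> (0(i := s))) * h (v t)) has_field_derivative
       (\<Sum>l<m. (\<Sum>t\<in>K. of_nat (count (M t) l) * mono_eval (M t - {#l#}) (\<psi> (0(i := 0 i))) * h (v t)) * J i l)) (at (0 i))"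
      unfolding J_def
      by (rule poly_map_chain[OF K]) (use pd_has_derivative[OF \<psi> zU i] in auto)
    moreover have "(\<Sum>l<m. (\<Sum>t\<in>K. of_nat (count (M t) l) * mono_eval (M t - {#l#}) (\<psi> (0(i := 0 i))) * h (v t)) * J i l)
       = h (\<Sum>l<m. fscale (J i l) (D l))"
      by (subst fun_upd_triv) (simp add: hsum' Dvec hsum algebra_simps)
    ultimately have 1: "((\<lambda>s. h (\<phi> (\<psi> (0(i := s))))) has_field_derivative h (\<Sum>l<m. fscale (J i l) (D l))) (at (0 i))"
      by (simp only: \<phi>vec hsum)
    have 2: "((\<lambda>s. \<mu> (0(i := s)) * h (\<phi> (\<psi> (0(i := s))))) has_field_derivative
        \<mu> (0(i := 0 i)) * h (\<Sum>l<m. fscale (J i l) (D l)) + pd i \<mu> 0 * h (\<phi> (\<psi> (0(i := 0 i))))) (at (0 i))"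
      by (rule DERIV_mult'[OF pd_has_derivative[OF \<mu> zU i] 1])
    have ev: "\<forall>\<^sub>F s in nhds (0 i). \<mu> (0(i := s)) * h (\<phi> (\<psi> (0(i := s)))) = 1"
      unfolding eventually_nhds
    proof (intro exI[of _ "{s. 0(i := s) \<in> U}"] conjI ballI opn)
      show "0 i \<in> {s. 0(i := s) \<in> U}" unfolding mem_Collect_eq fun_upd_triv by (rule zU)
      fix s assume "s \<in> {s. 0(i := s) \<in> U}"
      then have "0(i := s) \<in> U" by simp
      then show "\<mu> (0(i := s)) * h (\<phi> (\<psi> (0(i := s)))) = 1" using h\<phi>' h1 by metis
    qed
    have "((\<lambda>s. 1) has_field_derivative
        \<mu> (0(i := 0 i)) * h (\<Sum>l<m. fscale (J i l) (D l)) + pd i \<mu> 0 * h (\<phi> (\<psi> (0(i := 0 i))))) (at (0 i))"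
      using 2 DERIV_cong_ev[OF refl ev refl] by blast
    then have "\<mu> 0 * h (\<Sum>l<m. fscale (J i l) (D l)) + pd i \<mu> 0 * h (\<phi> (\<psi> 0)) = 0"
      using DERIV_unique[OF _ DERIV_const] unfolding fun_upd_triv by blast
    then show ?thesis unfolding d\<phi>'[OF i] by (simp add: hadd algebra_simps)
  qed
  \<comment> \<open>A family of \<open>m\<close> vectors spanning a space of dimension
    \<open>m\<close> has neither repetitions nor linear relations.\<close>
  have indep: "c i = 0" if c: "(\<Sum>i<m. fscale (c i) (partial i \<phi>' 0)) = 0" and i: "i < m" for c i
  proof -
    define P where "P = (\<lambda>i. partial i \<phi>' 0) ` {..<m}"
    obtain B where B: "B \<subseteq> P" "cfun.independent B" "P \<subseteq> cfun.span B" "card B = cfun.dim P"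
      using cfun.basis_exists by blast
    have "card P \<le> m" unfolding P_def using card_image_le[of "{..<m}"] by simp
    moreover have finP: "finite P" by (simp add: P_def)
    ultimately have BP: "B = P" using B imm unfolding P_def[symmetric] by (intro card_subset_eq) (auto intro: antisym card_mono)
    then have "card P = m" using B(4) imm P_def by simp
    then have inj: "inj_on (\<lambda>i. partial i \<phi>' 0) {..<m}"
      unfolding P_def by (intro eq_card_imp_inj_on) auto
    have "(\<Sum>x\<in>P. fscale (c (the_inv_into {..<m} (\<lambda>i. partial i \<phi>' 0) x)) x) = 0"
      unfolding P_def sum.reindex[OF inj] using c by (simp add: the_inv_into_f_f[OF inj])
    then have "c (the_inv_into {..<m} (\<lambda>i. partial i \<phi>' 0) x) = 0" if "x \<in> P" for x
      by (rule cfun.independentD[OF B(2)[unfolded BP] finP order_refl _ that])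
    from this[of "partial i \<phi>' 0"] show ?thesis
      using i by (simp add: P_def the_inv_into_f_f[OF inj])
  qed
  define A where "A = Matrix.mat m m (\<lambda>(l, i). J i l)"
  have A: "A \<in> carrier_mat m m" by (simp add: A_def)
  have "Determinant.det A \<noteq> 0"
  proof
    assume "Determinant.det A = 0"
    then obtain u where u: "u \<in> carrier_vec m" "u \<noteq> 0\<^sub>v m" "A *\<^sub>v u = 0\<^sub>v m"
      using det_0_iff_vec_prod_zero[OF A] by blast
    have Ju: "(\<Sum>i<m. J i l * vec_index u i) = 0" if "l < m" for l
    proof -
      have "vec_index (A *\<^sub>v u) l = 0" using u that by simp
      then show ?thesis using that u(1)
        by (simp add: A_def scalar_prod_def lessThan_atLeast0)
    qed
    define S where "S = (\<Sum>i<m. fscale (vec_index u i) (partial i \<phi>' 0))"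
    have "S = fscale (\<Sum>i<m. vec_index u i * pd i \<mu> 0) (\<phi> (\<psi> 0)) + (\<Sum>l<m. fscale (\<mu> 0 * (\<Sum>i<m. J i l * vec_index u i)) (D l))"
    proof -
      have "S = (\<Sum>i<m. fscale (vec_index u i * pd i \<mu> 0) (\<phi> (\<psi> 0)) + (\<Sum>l<m. fscale (\<mu> 0 * (J i l * vec_index u i)) (D l)))"
        unfolding S_def by (intro sum.cong refl) (simp add: d\<phi>' cfun.scale_right_distrib cfun.scale_sum_right ac_simps)
      also have "\<dots> = fscale (\<Sum>i<m. vec_index u i * pd i \<mu> 0) (\<phi> (\<psi> 0)) + (\<Sum>i<m. \<Sum>l<m. fscale (\<mu> 0 * (J i l * vec_index u i)) (D l))"
        by (simp add: sum.distrib cfun.scale_sum_left)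
      also have "(\<Sum>i<m. \<Sum>l<m. fscale (\<mu> 0 * (J i l * vec_index u i)) (D l)) = (\<Sum>l<m. \<Sum>i<m. fscale (\<mu> 0 * (J i l * vec_index u i)) (D l))"
        by (rule sum.swap)
      finally show ?thesis by (simp only: cfun.scale_sum_left sum_distrib_left)
    qed
    also have "(\<Sum>l<m. fscale (\<mu> 0 * (\<Sum>i<m. J i l * vec_index u i)) (D l)) = 0"
      by (intro sum.neutral) (simp add: Ju)
    finally have S: "S = fscale (\<Sum>i<m. vec_index u i * pd i \<mu> 0) (\<phi> (\<psi> 0))" by (simp only: add_0_right)
    have "h S = 0" unfolding S_def hsum' by (simp add: h0)
    moreover have "h (\<phi> (\<psi> 0)) \<noteq> 0" using h\<phi>'[OF zU] h1[OF zU] by auto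
    ultimately have "S = 0" using S by (simp add: hadd)
    then have "vec_index u i = 0" if "i < m" for i
      using indep that unfolding S_def by blast
    then have "u = 0\<^sub>v m" using u(1) by (intro eq_vecI) auto
    with u show False by simp
  qed
  \<comment> \<open>The matrix \<open>A\<close> has its indices exchanged relative to
    \<open>J\<close>, so the adjugate is read off transposed.\<close>
  define N where "N r i = adj_mat A $$ (i, r) / Determinant.det A" for r i
  have adj: "adj_mat A \<in> carrier_mat m m" "A * adj_mat A = Determinant.det A \<cdot>\<^sub>m 1\<^sub>m m"
    using adj_mat[OF A] by auto
  have "(\<Sum>i<m. N r i * J i l) = (if r = l then 1 else 0)" if "r < m" "l < m" for r l
  proof -
    have "(A * adj_mat A) $$ (l, r) = (\<Sum>i<m. J i l * adj_mat A $$ (i, r))"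
      using that adj(1) A by (subst index_mult_mat) (auto simp: A_def scalar_prod_def lessThan_atLeast0)
    then have "(\<Sum>i<m. J i l * adj_mat A $$ (i, r)) = (if r = l then Determinant.det A else 0)"
      using that unfolding adj(2) by (auto split: if_splits)
    moreover have "(\<Sum>i<m. N r i * J i l) = (\<Sum>i<m. J i l * adj_mat A $$ (i, r)) / Determinant.det A"
      by (simp add: N_def sum_divide_distrib mult.commute)
    ultimately show ?thesis using \<open>Determinant.det A \<noteq> 0\<close> by simp
  qed
  then show thesis using that[of N] unfolding J_def by blast
qed

section \<open>The dimension of the osculating spaces of a chart\<close>

text \<open>The finite set \<open>F\<close> forces bases to be finite; on an infinite-dimensional
  space \<open>cfun.dim\<close> is 0 by convention.\<close>

lemma card_le_dim_fun:
  assumes F: "finite F" "L \<subseteq> cfun.span F" and S: "S \<subseteq> L" "cfun.independent S"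
  shows "card S \<le> cfun.dim L"
proof -
  obtain b where b: "b \<subseteq> L" "cfun.independent b" "L \<subseteq> cfun.span b" "card b = cfun.dim L"
    using cfun.basis_exists by blast
  have "finite b" using cfun.independent_span_bound[OF F(1) b(2)] b(1) F(2) by blast
  then show ?thesis using cfun.independent_span_bound[OF _ S(2), of b] S(1) b(3,4) by auto
qed

lemma dim_le_dim_plus_card:
  assumes F: "finite F0" "A \<subseteq> cfun.span F0" "finite F" "L \<subseteq> cfun.span (A \<union> F)"
  shows "cfun.dim L \<le> cfun.dim A + card F"
proof -
  obtain b where b: "b \<subseteq> A" "cfun.independent b" "A \<subseteq> cfun.span b" "card b = cfun.dim A"
    using cfun.basis_exists by blast
  have finb: "finite b" using cfun.independent_span_bound[OF F(1) b(2)] b(1) F(2) by blast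
  have "A \<union> F \<subseteq> cfun.span (b \<union> F)"
    using b(3) cfun.span_mono[of b "b \<union> F"] cfun.span_superset[of "b \<union> F"] by blast
  then have "L \<subseteq> cfun.span (b \<union> F)" using F(4) cfun.span_minimal[OF _ cfun.subspace_span] by blast
  then have "cfun.dim L \<le> card (b \<union> F)" using finb F(3) by (intro cfun.dim_le_card) auto
  also have "\<dots> \<le> card b + card F" by (rule card_Un_le)
  finally show ?thesis using b(4) by simp
qed

section \<open>Counting admissible pairs of subsets\<close>

text \<open>The injective \<open>set_encode\<close> only serves to select one of the pairs \<open>(I, J)\<close> and \<open>(J, I)\<close>.\<close>

definition dom_pairs :: "nat \<Rightarrow> nat \<Rightarrow> (nat set \<times> nat set) set" where
  "dom_pairs n k = {(I, J). I \<subseteq> {..<n} \<and> J \<subseteq> {..<n} \<and> card I = k \<and> card J = k \<and>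
     (set_encode I < set_encode J \<or> I = J \<and> even k)}"

lemma finite_dom_pairs [simp]: "finite (dom_pairs n k)"
  by (rule finite_subset[of _ "Pow {..<n} \<times> Pow {..<n}"]) (auto simp: dom_pairs_def)

lemma dom_pairs_disjoint: "k \<noteq> k' \<Longrightarrow> dom_pairs n k \<inter> dom_pairs n k' = {}"
  by (auto simp: dom_pairs_def)

lemma card_dom_pairs:
  "2 * real (card (dom_pairs n k)) = real (n choose k) * (real (n choose k) + 1) - (if odd k then 2 * real (n choose k) else 0)"
proof -
  define T where "T = {I. I \<subseteq> {..<n} \<and> card I = k}"
  have T: "finite T" "card T = n choose k"
    using n_subsets[of "{..<n}" k] by (auto simp: T_def)
  have fin: "finite I" if "I \<in> T" for I using that by (auto simp: T_def intro: finite_subset)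
  define lt where "lt = {(I, J). I \<in> T \<and> J \<in> T \<and> set_encode I < set_encode J}"
  define gt where "gt = {(I, J). I \<in> T \<and> J \<in> T \<and> set_encode J < set_encode I}"
  define eq where "eq = (\<lambda>I. (I, I)) ` T"
  have finlt: "finite lt" "finite gt" "finite eq"
    by (rule finite_subset[of _ "T \<times> T"]; use T in \<open>auto simp: lt_def gt_def eq_def\<close>)+
  have "gt = prod.swap ` lt" by (auto simp: lt_def gt_def image_iff)
  then have gt: "card gt = card lt" by (simp add: card_image)
  have eq: "card eq = n choose k" unfolding eq_def using T by (subst card_image) (auto simp: inj_on_def)
  have "T \<times> T = lt \<union> gt \<union> eq"
    using set_encode_eq fin by (auto simp: lt_def gt_def eq_def)
  moreover have "card (lt \<union> gt \<union> eq) = card lt + card gt + card eq"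
    using finlt by (subst card_Un_disjoint, simp, simp, force simp: lt_def gt_def eq_def,
        subst card_Un_disjoint) (auto simp: lt_def gt_def)
  ultimately have "card (T \<times> T) = 2 * card lt + (n choose k)" using gt eq by simp
  then have 1: "real (n choose k) * real (n choose k) = 2 * real (card lt) + real (n choose k)"
    using T by (simp add: card_cartesian_product flip: of_nat_mult of_nat_add)
  have "dom_pairs n k = lt \<union> (if even k then eq else {})"
    by (auto simp: dom_pairs_def lt_def eq_def T_def)
  moreover have "lt \<inter> eq = {}" by (auto simp: lt_def eq_def)
  ultimately have "card (dom_pairs n k) = card lt + (if even k then n choose k else 0)"
    using finlt eq by (auto simp: card_Un_disjoint)
  then show ?thesis using 1 by (auto simp: algebra_simps)
qed

lemma sum_card_dom_pairs:
  "real (\<Sum>k\<le>s. card (dom_pairs n k)) - 1 =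
     1 / 2 * (\<Sum>k = 1..s. real (n choose k) * (real (n choose k) + 1))
       - (\<Sum>k = 1..nat \<lceil>real s / 2\<rceil>. real (n choose (2 * k - 1)))"
proof -
  have half: "nat \<lceil>real s / 2\<rceil> = (s + 1) div 2" for s
  proof (cases "even s")
    case True then show ?thesis by (auto elim!: evenE)
  next
    case False
    then obtain t where t: "s = 2 * t + 1" by (auto elim!: oddE)
    have "\<lceil>real s / 2\<rceil> = int t + 1" unfolding t by (rule ceiling_unique) auto
    then show ?thesis using t by simp
  qed
  show ?thesis
    unfolding half
  proof (induct s)
    case 0
    \<comment> \<open>In degree 0 there is only the pair of empty sets. It accounts for the base
      point and cancels the -1 of the projective dimension.\<close>
    have "2 * real (card (dom_pairs n 0)) = 2" by (subst card_dom_pairs) simp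
    then show ?case by simp
  next
    case (Suc s)
    have c: "real (card (dom_pairs n (Suc s))) = 1/2 * (real (n choose Suc s) * (real (n choose Suc s) + 1))
        - (if odd (Suc s) then real (n choose Suc s) else 0)"
      using card_dom_pairs[of n "Suc s"] by (auto split: if_splits)
    \<comment> \<open>The upper limit grows exactly when \<open>Suc s\<close> is odd, and the new
      index \<open>2 * k - 1\<close> is then \<open>Suc s\<close> itself.\<close>
    have o: "(\<Sum>k = 1..(Suc s + 1) div 2. real (n choose (2 * k - 1))) =
        (\<Sum>k = 1..(s + 1) div 2. real (n choose (2 * k - 1))) + (if odd (Suc s) then real (n choose Suc s) else 0)"
    proof (cases "even s")
      case True
      then obtain t where "s = 2 * t" by (auto elim!: evenE)
      then show ?thesis by simp
    next
      case False
      then obtain t where "s = 2 * t + 1" by (auto elim!: oddE)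
      then show ?thesis by simp
    qed
    show ?case using Suc c unfolding o by (simp add: algebra_simps)
  qed
qed

text \<open>Beyond \<open>n\<close> there are no subsets. For odd \<open>n\<close>, degree
  \<open>n\<close> leaves only the full set paired with itself, and the diagonal is excluded in odd
  degree.\<close>

lemma dom_pairs_empty:
  assumes "2 * (n div 2) < k"
  shows "dom_pairs n k = {}"
proof -
  have "k \<ge> n" using assms by presburger
  have False if q: "(I, J) \<in> dom_pairs n k" for I J
  proof -
    have sub: "I \<subseteq> {..<n}" "J \<subseteq> {..<n}" "card I = k" "card J = k"
      and ord: "set_encode I < set_encode J \<or> I = J \<and> even k"
      using q by (simp_all add: dom_pairs_def)
    have "k \<le> n" using card_mono[OF _ sub(1)] sub(3) by simp
    then have k: "k = n" using \<open>k \<ge> n\<close> by simp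
    then have "odd k" using assms by presburger
    moreover have "I = {..<n}" using sub(1,3) k by (intro card_subset_eq) auto
    moreover have "J = {..<n}" using sub(2,4) k by (intro card_subset_eq) auto
    ultimately show False using ord by simp
  qed
  then show ?thesis by auto
qed

section \<open>Upper bounds from the coefficients of the chart\<close>

context polarized
begin

definition phi :: "(nat \<Rightarrow> complex) \<Rightarrow> ('v list \<Rightarrow> complex) \<Rightarrow> complex" where
  "phi z = wedge smul n (graph_list (skew_mat n z))"

abbreviation sdim :: nat where "sdim \<equiv> n * (n - 1) div 2"

definition chart_span :: "(('v list \<Rightarrow> complex) \<Rightarrow> complex) set" where
  "chart_span = cfun.span (range phi)"

lemma skew_skew_mat: "skew (skew_mat n z)"
  by (auto simp: skew_def skew_mat_def)

lemma graph_list_cong: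
  "(\<And>i j. i < n \<Longrightarrow> j < n \<Longrightarrow> A i j = A' i j) \<Longrightarrow> graph_list A = graph_list A'"
  by (auto simp: graph_list_def graph_vec_def intro!: sum.cong)

lemma skew_eq_skew_mat:
  assumes A: "skew A"
  obtains z where "z \<in> complex_coord_space sdim" "graph_list A = graph_list (skew_mat n z)"
proof -
  have A': "A i j = - A j i" if "i < n" "j < n" for i j using A that unfolding skew_def by blast
  have A0: "A i i = 0" if "i < n" for i
  proof -
    have "A i i + A i i = 0" using A'[OF that that] by (metis add.right_inverse)
    then show ?thesis by simp
  qed
  define h where "h = the_inv_into (pairs n) (pair_index n)"
  have h: "h (pair_index n (i, j)) = (i, j)" if "i < j" "j < n" for i j
    unfolding h_def using bij_pair_index that by (intro the_inv_into_f_f) (auto simp: bij_betw_def pairs_def)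
  define z where "z l = (if l < sdim then A (fst (h l)) (snd (h l)) else 0)" for l
  have lt: "pair_index n (i, j) < sdim" if "i < j" "j < n" for i j
    using bij_pair_index[of n] that by (auto simp: bij_betw_def pairs_def)
  have "graph_list A = graph_list (skew_mat n z)"
  proof (rule graph_list_cong)
    fix i j assume ij: "i < n" "j < n"
    show "A i j = skew_mat n z i j"
      using ij h lt A0 A'[OF ij] by (cases i j rule: linorder_cases) (auto simp: skew_mat_def z_def)
  qed
  moreover have "z \<in> complex_coord_space sdim" by (auto simp: complex_coord_space_def z_def)
  ultimately show thesis by (rule that[rotated])
qed

text \<open>The monomial of the term \<open>\<tau>\<close>, seen as a graph joining each
  \<open>i\<close> to its image. Edges are unordered because the coordinates of a skew matrix are
  the entries above the diagonal; a 2-cycle yields a double edge, hence the multiset.\<close>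

definition edges :: "(nat \<Rightarrow> nat option) \<Rightarrow> nat multiset" where
  "edges \<tau> = image_mset (\<lambda>i. pair_index n (min i (the (\<tau> i)), max i (the (\<tau> i)))) (mset_set (dom \<tau>))"

definition loopfree :: "(nat \<Rightarrow> nat option) set" where
  "loopfree = {\<tau> \<in> pinjs n. \<forall>i. \<tau> i \<noteq> Some i}"

text \<open>The sign comes from the entries taken below the diagonal, and the factor 1/2 from
  \<open>wedge_graph_expand_eta\<close>.\<close>

definition chart_coeff :: "(nat \<Rightarrow> nat option) \<Rightarrow> ('v list \<Rightarrow> complex) \<Rightarrow> complex" where
  "chart_coeff \<tau> = fscale ((\<Prod>i\<in>dom \<tau>. if i < the (\<tau> i) then 1 else -1) / 2) (eta \<tau>)"

lemma finite_loopfree: "finite loopfree"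
  using finite_pinjs by (simp add: loopfree_def)

lemma edges_props:
  assumes "\<tau> \<in> loopfree"
  shows "size (edges \<tau>) = card (dom \<tau>)" "set_mset (edges \<tau>) \<subseteq> {..<sdim}"
    "weight (skew_mat n z) \<tau> = (\<Prod>i\<in>dom \<tau>. if i < the (\<tau> i) then 1 else -1) * mono_eval (edges \<tau>) z"
proof -
  have \<tau>: "\<tau> \<in> pinjs n" and nofix: "\<And>i. \<tau> i \<noteq> Some i" using assms by (auto simp: loopfree_def)
  have fin: "finite (dom \<tau>)" by (rule finite_dom_pinjs[OF \<tau>])
  show "size (edges \<tau>) = card (dom \<tau>)" by (simp add: edges_def)
  have j: "i < n \<and> the (\<tau> i) < n \<and> the (\<tau> i) \<noteq> i" if "i \<in> dom \<tau>" for i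
    using that \<tau> nofix[of i] by (auto simp: pinjs_def ran_def)
  show "set_mset (edges \<tau>) \<subseteq> {..<sdim}"
  proof
    fix l assume "l \<in># edges \<tau>"
    then obtain i where i: "i \<in> dom \<tau>" "l = pair_index n (min i (the (\<tau> i)), max i (the (\<tau> i)))"
      using fin by (auto simp: edges_def)
    have "(min i (the (\<tau> i)), max i (the (\<tau> i))) \<in> pairs n"
      using j[OF i(1)] by (auto simp: pairs_def)
    then show "l \<in> {..<sdim}" using bij_pair_index[of n] i(2) by (auto simp: bij_betw_def)
  qed
  have "mono_eval (edges \<tau>) z = (\<Prod>i\<in>dom \<tau>. z (pair_index n (min i (the (\<tau> i)), max i (the (\<tau> i)))))"
    by (simp add: mono_eval_def edges_def prod_unfold_prod_mset image_mset.compositionality comp_def)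
  then show "weight (skew_mat n z) \<tau> = (\<Prod>i\<in>dom \<tau>. if i < the (\<tau> i) then 1 else -1) * mono_eval (edges \<tau>) z"
    unfolding weight_def
  proof (simp only: prod.distrib[symmetric], intro prod.cong refl)
    fix i assume "i \<in> dom \<tau>"
    from j[OF this] show "skew_mat n z i (the (\<tau> i)) = (if i < the (\<tau> i) then 1 else -1) *
        z (pair_index n (min i (the (\<tau> i)), max i (the (\<tau> i))))"
      by (auto simp: skew_mat_def min_def max_def)
  qed
qed

lemma phi_poly_map: "phi = poly_map loopfree edges chart_coeff"
proof (intro ext)
  fix z \<omega>
  have "phi z = (\<Sum>\<tau>\<in>pinjs n. fscale (weight (skew_mat n z) \<tau> / 2) (eta \<tau>))"
    unfolding phi_def by (rule wedge_graph_expand_eta[OF skew_skew_mat])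
  also have "\<dots> = (\<Sum>\<tau>\<in>loopfree. fscale (weight (skew_mat n z) \<tau> / 2) (eta \<tau>))"
  proof (rule sum.mono_neutral_right[OF finite_pinjs])
    show "\<forall>\<tau>\<in>pinjs n - loopfree. fscale (weight (skew_mat n z) \<tau> / 2) (eta \<tau>) = 0"
    proof
      fix \<tau> assume \<tau>: "\<tau> \<in> pinjs n - loopfree"
      then obtain i where i: "\<tau> i = Some i" by (auto simp: loopfree_def)
      then have "i \<in> dom \<tau>" "skew_mat n z i (the (\<tau> i)) = 0" by (auto simp: skew_mat_def)
      then have "weight (skew_mat n z) \<tau> = 0"
        unfolding weight_def using finite_dom_pinjs[of \<tau> n] \<tau> by (intro prod_zero) auto
      then show "fscale (weight (skew_mat n z) \<tau> / 2) (eta \<tau>) = 0" by simp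
    qed
  qed (auto simp: loopfree_def)
  finally show "phi z \<omega> = poly_map loopfree edges chart_coeff z \<omega>"
    by (simp add: poly_map_def fun_sum_apply fscale_def chart_coeff_def edges_props(3) cong: sum.cong)
       (intro sum.cong refl, simp add: edges_props(3))
qed

lemma partials_phi_0:
  assumes "set js \<subseteq> {..<sdim}"
  shows "partials js phi 0 = fscale (deriv_coeff js (mset js)) (\<Sum>\<tau> | \<tau> \<in> loopfree \<and> edges \<tau> = mset js. chart_coeff \<tau>)"
  unfolding phi_poly_map
  by (rule partials_poly_map_0) (use finite_loopfree edges_props(2) assms in auto)

lemma osc_span_phi_upper:
  "osc_span sdim s phi \<subseteq> cfun.span (eta ` {\<tau> \<in> pinjs n. card (dom \<tau>) \<le> s})"
  unfolding osc_span_def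
proof (intro cfun.span_minimal cfun.subspace_span subsetI)
  fix x assume "x \<in> (\<lambda>js. partials js phi 0) ` lists_upto sdim s"
  then obtain js where js: "set js \<subseteq> {..<sdim}" "length js \<le> s" "x = partials js phi 0"
    by (auto simp: lists_upto_def)
  have "chart_coeff \<tau> \<in> cfun.span (eta ` {\<tau> \<in> pinjs n. card (dom \<tau>) \<le> s})"
    if "\<tau> \<in> loopfree" "edges \<tau> = mset js" for \<tau>
  proof -
    have "card (dom \<tau>) = length js" using edges_props(1)[OF that(1)] that(2) by simp
    then show ?thesis unfolding chart_coeff_def using js(2) that(1)
      by (intro cfun.span_scale cfun.span_base) (auto simp: loopfree_def)
  qed
  then show "x \<in> cfun.span (eta ` {\<tau> \<in> pinjs n. card (dom \<tau>) \<le> s})"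
    unfolding js(3) partials_phi_0[OF js(1)] by (intro cfun.span_scale cfun.span_sum) auto
qed

text \<open>Once equal monomials are collected, a coefficient of degree at most \<open>s\<close> is
  a derivative at the origin up to a nonzero factor; a coefficient of higher degree is a combination
  of the \<open>eta \<tau>\<close> of that degree.\<close>

lemma chart_span_subset:
  "chart_span \<subseteq> cfun.span (osc_span sdim s phi \<union> eta ` {\<tau> \<in> pinjs n. s < card (dom \<tau>)})" (is "_ \<subseteq> cfun.span ?G")
  unfolding chart_span_def
proof (intro cfun.span_minimal cfun.subspace_span subsetI)
  fix x assume "x \<in> range phi"
  then obtain z where z: "x = phi z" by blast
  have "phi z = (\<Sum>\<tau>\<in>loopfree. fscale (mono_eval (edges \<tau>) z) (chart_coeff \<tau>))"
    by (intro ext) (simp add: phi_poly_map poly_map_def fun_sum_apply fscale_def)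
  also have "\<dots> = (\<Sum>M\<in>edges ` loopfree. \<Sum>\<tau> | \<tau> \<in> loopfree \<and> edges \<tau> = M. fscale (mono_eval (edges \<tau>) z) (chart_coeff \<tau>))"
    by (rule sum.image_gen[OF finite_loopfree])
  also have "\<dots> = (\<Sum>M\<in>edges ` loopfree. fscale (mono_eval M z) (\<Sum>\<tau> | \<tau> \<in> loopfree \<and> edges \<tau> = M. chart_coeff \<tau>))"
    unfolding cfun.scale_sum_right by (intro sum.cong refl) auto
  also have "\<dots> \<in> cfun.span ?G"
  proof (rule cfun.span_sum, rule cfun.span_scale)
    fix M assume "M \<in> edges ` loopfree"
    then obtain \<tau>0 where \<tau>0: "\<tau>0 \<in> loopfree" "M = edges \<tau>0" by blast
    obtain js where js: "mset js = M" using ex_mset by blast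
    have setjs: "set js \<subseteq> {..<sdim}" using edges_props(2)[OF \<tau>0(1)] \<tau>0(2) js by (metis set_mset_mset)
    show "(\<Sum>\<tau> | \<tau> \<in> loopfree \<and> edges \<tau> = M. chart_coeff \<tau>) \<in> cfun.span ?G"
    proof (cases "size M \<le> s")
      case True
      have eq: "(\<Sum>\<tau> | \<tau> \<in> loopfree \<and> edges \<tau> = M. chart_coeff \<tau>) = fscale (1 / deriv_coeff js (mset js)) (partials js phi 0)"
        unfolding partials_phi_0[OF setjs] using deriv_coeff_mset[of js] by (simp add: js)
      moreover have "partials js phi 0 \<in> osc_span sdim s phi"
        by (rule osc_span_base[OF setjs]) (use True js in auto)
      ultimately show ?thesis unfolding eq by (intro cfun.span_scale cfun.span_base) blast
    next
      case False
      show ?thesis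
      proof (intro cfun.span_sum)
        fix \<tau> assume "\<tau> \<in> {\<tau> \<in> loopfree. edges \<tau> = M}"
        then have "\<tau> \<in> pinjs n" "card (dom \<tau>) = size M" using edges_props(1) by (auto simp: loopfree_def)
        then show "chart_coeff \<tau> \<in> cfun.span ?G"
          unfolding chart_coeff_def using False by (intro cfun.span_scale cfun.span_base) auto
      qed
    qed
  qed
  finally show "x \<in> cfun.span ?G" unfolding z .
qed

text \<open>If a functional \<open>h\<close> kills all values of \<open>phi\<close>, the polynomial
  \<open>h (phi z)\<close> is zero, and so are its derivatives, which are the values of
  \<open>h\<close> on the derivatives of \<open>phi\<close>.\<close>

lemma osc_span_subset_chart_span: "osc_span sdim s phi \<subseteq> chart_span"
proof (rule ccontr)
  assume "\<not> osc_span sdim s phi \<subseteq> chart_span"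
  then have "\<not> (\<lambda>js. partials js phi 0) ` lists_upto sdim s \<subseteq> chart_span"
    unfolding osc_span_def chart_span_def using cfun.span_minimal[OF _ cfun.subspace_span] by blast
  then obtain js where js: "set js \<subseteq> {..<sdim}" "partials js phi 0 \<notin> chart_span"
    by (auto simp: lists_upto_def)
  obtain h where h: "Vector_Spaces.linear fscale (*) h" "\<And>y. y \<in> chart_span \<Longrightarrow> h y = 0" "h (partials js phi 0) = 1"
    using separating_functional[OF _ js(2)] unfolding chart_span_def by (metis cfun.subspace_span)
  interpret h: Vector_Spaces.linear fscale "(*)" h by (rule h)
  have h\<phi>: "(\<Sum>\<tau>\<in>loopfree. mono_eval (edges \<tau>) z * h (chart_coeff \<tau>)) = 0" for z
  proof -
    have "phi z = (\<Sum>\<tau>\<in>loopfree. fscale (mono_eval (edges \<tau>) z) (chart_coeff \<tau>))"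
      by (intro ext) (simp add: phi_poly_map poly_map_def fun_sum_apply fscale_def)
    then have "h (phi z) = (\<Sum>\<tau>\<in>loopfree. mono_eval (edges \<tau>) z * h (chart_coeff \<tau>))"
      by (simp add: h.sum h.scale)
    moreover have "h (phi z) = 0" by (rule h(2)) (auto simp: chart_span_def intro: cfun.span_base)
    ultimately show ?thesis by simp
  qed
  \<comment> \<open>A scalar polynomial is written as a map into functions on \<open>unit\<close>,
    so that the formulas for \<open>poly_map\<close> apply to it.\<close>
  define \<Phi> where "\<Phi> = poly_map loopfree edges (\<lambda>\<tau> (_ :: unit). h (chart_coeff \<tau>))"
  have "\<Phi> = (\<lambda>_ _. 0)" using h\<phi> by (simp add: \<Phi>_def poly_map_def fun_eq_iff)
  moreover have "partials is (\<lambda>_ (_ :: unit). 0 :: complex) = (\<lambda>_ _. 0)" for "is"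
    by (induct "is") (auto simp: partials_Cons partial_def)
  ultimately have "partials js \<Phi> 0 () = 0" by simp
  moreover have "partials js \<Phi> 0 () = deriv_coeff js (mset js) * (\<Sum>\<tau> | \<tau> \<in> loopfree \<and> edges \<tau> = mset js. h (chart_coeff \<tau>))"
    unfolding \<Phi>_def
    by (subst partials_poly_map_0) (use finite_loopfree edges_props(2) js in \<open>auto simp: fscale_def fun_sum_apply\<close>)
  moreover have "h (partials js phi 0) = deriv_coeff js (mset js) * (\<Sum>\<tau> | \<tau> \<in> loopfree \<and> edges \<tau> = mset js. h (chart_coeff \<tau>))"
    unfolding partials_phi_0[OF js(1)] by (simp add: h.sum h.scale)
  ultimately show False using h(3) by (metis zero_neq_one)
qed

definition canonical :: "nat set \<times> nat set \<Rightarrow> nat \<Rightarrow> nat option" where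
  "canonical q = (SOME \<tau>. \<tau> \<in> pinjs n \<and> dom \<tau> = fst q \<and> ran \<tau> = snd q)"

lemma canonical_dom_ran:
  assumes "\<tau> \<in> pinjs n"
  shows "canonical (dom \<tau>, ran \<tau>) \<in> pinjs n" "dom (canonical (dom \<tau>, ran \<tau>)) = dom \<tau>"
    "ran (canonical (dom \<tau>, ran \<tau>)) = ran \<tau>"
  using someI[of "\<lambda>\<tau>'. \<tau>' \<in> pinjs n \<and> dom \<tau>' = dom \<tau> \<and> ran \<tau>' = ran \<tau>" \<tau>] assms
  by (auto simp: canonical_def)

text \<open>Up to a factor, \<open>eta \<tau>\<close> depends only on \<open>dom \<tau>\<close> and
  \<open>ran \<tau>\<close> and, by \<open>eta_pinv\<close>, not on their order. Equal sets of odd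
  size give zero.\<close>

lemma eta_canonical:
  assumes \<tau>: "\<tau> \<in> pinjs n"
  shows "eta \<tau> \<in> cfun.span ((\<lambda>q. eta (canonical q)) ` dom_pairs n (card (dom \<tau>)))" (is "_ \<in> ?S")
proof -
  define k where "k = card (dom \<tau>)"
  have sub: "dom \<tau> \<subseteq> {..<n}" "ran \<tau> \<subseteq> {..<n}" using \<tau> by (auto simp: pinjs_def)
  have kr: "card (ran \<tau>) = k" using card_ran_pinj[OF \<tau>] by (simp add: k_def)
  have base: "eta \<tau>' \<in> cfun.span ((\<lambda>q. eta (canonical q)) ` dom_pairs n k)"
    if t: "\<tau>' \<in> pinjs n" "(dom \<tau>', ran \<tau>') \<in> dom_pairs n k" for \<tau>'
  proof -
    obtain \<sigma> where \<sigma>: "eta \<tau>' = fscale \<sigma> (eta (canonical (dom \<tau>', ran \<tau>')))"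
      using eta_same_dom_ran[OF canonical_dom_ran(1)[OF t(1)] t(1) canonical_dom_ran(2,3)[OF t(1), symmetric]] by blast
    show ?thesis unfolding \<sigma> using t(2) by (intro cfun.span_scale cfun.span_base) blast
  qed
  have "set_encode (dom \<tau>) < set_encode (ran \<tau>) \<or> set_encode (ran \<tau>) < set_encode (dom \<tau>) \<or> dom \<tau> = ran \<tau>"
    using set_encode_eq[of "dom \<tau>" "ran \<tau>"] sub by (metis finite_lessThan finite_subset linorder_neqE_nat)
  then consider "set_encode (dom \<tau>) < set_encode (ran \<tau>)" | "set_encode (ran \<tau>) < set_encode (dom \<tau>)"
    | "dom \<tau> = ran \<tau>" "even k" | "dom \<tau> = ran \<tau>" "odd k" by blast
  then have "eta \<tau> \<in> cfun.span ((\<lambda>q. eta (canonical q)) ` dom_pairs n k)"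
  proof cases
    case 1
    then show ?thesis using sub kr by (intro base \<tau>) (auto simp: dom_pairs_def k_def)
  next
    case 2
    have "eta (pinv \<tau>) \<in> cfun.span ((\<lambda>q. eta (canonical q)) ` dom_pairs n k)"
      using 2 sub kr by (intro base pinv_props \<tau>) (auto simp: dom_pairs_def k_def pinv_props[OF \<tau>])
    moreover have "eta \<tau> = fscale ((-1) ^ card (dom (pinv \<tau>))) (eta (pinv \<tau>))"
      using eta_pinv[OF pinv_props(3)[OF \<tau>]] pinv_props(4)[OF \<tau>] by simp
    ultimately show ?thesis by (metis cfun.span_scale)
  next
    case 3
    have "card (dom \<tau>) = k" by (simp add: k_def)
    then have "(dom \<tau>, ran \<tau>) \<in> dom_pairs n k"
      unfolding dom_pairs_def using 3 sub kr by blast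
    then show ?thesis by (rule base[OF \<tau>])
  next
    case 4
    \<comment> \<open>The identity on \<open>dom \<tau>\<close> is its own inverse, so for odd
      \<open>k\<close> the two summands of \<open>eta\<close> cancel.\<close>
    define \<iota> where "\<iota> i = (if i \<in> dom \<tau> then Some i else None)" for i
    have d: "dom \<iota> = dom \<tau>" "ran \<iota> = ran \<tau>"
      using 4(1) by (auto simp: \<iota>_def dom_def ran_def split: if_splits)
    have inj: "inj_on \<iota> (dom \<iota>)" by (auto simp: inj_on_def \<iota>_def split: if_splits)
    have \<iota>: "\<iota> \<in> pinjs n" using d sub inj by (simp add: pinjs_def)
    have "pinv \<iota> = \<iota>"
    proof
      fix j
      have "pinv \<iota> j = Some i \<longleftrightarrow> \<iota> j = Some i" for i
        unfolding pinv_eq_Some[OF inj] by (auto simp: \<iota>_def split: if_splits)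
      then show "pinv \<iota> j = \<iota> j" by (metis option.exhaust)
    qed
    then have "eta \<iota> = eps \<iota> + fscale ((-1) ^ k) (eps \<iota>)" by (simp only: eta_def d k_def)
    then have "eta \<iota> = 0" using 4(2) by (simp add: fscale_def fun_eq_iff)
    moreover obtain \<sigma> where "eta \<tau> = fscale \<sigma> (eta \<iota>)" using eta_same_dom_ran[OF \<iota> \<tau>] d by auto
    ultimately have "eta \<tau> = 0" by simp
    then show ?thesis by (simp only: cfun.span_zero)
  qed
  then show ?thesis by (simp add: k_def)
qed

section \<open>Lower bound from dual Pluecker coordinates\<close>

definition bas :: "nat + nat \<Rightarrow> 'v" where "bas = case_sum e f"

definition cobas :: "nat + nat \<Rightarrow> 'v \<Rightarrow> complex" where "cobas = case_sum (\<lambda>i. B (f i)) (\<lambda>i. B (e i))"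

text \<open>The indices of the basis wedge with \<open>e i\<close> for \<open>i\<close> outside
  \<open>I\<close> and \<open>f j\<close> for \<open>j\<close> in \<open>J\<close>, arranged as in
  \<open>basis_list\<close>; \<open>Inl\<close> marks \<open>e\<close> and \<open>Inr\<close> marks
  \<open>f\<close>.\<close>

definition index_list :: "nat set \<times> nat set \<Rightarrow> (nat + nat) list" where
  "index_list q = map Inr (sorted_list_of_set (fst q \<inter> snd q)) @
     concat (map (\<lambda>p. [Inl p, Inr p]) (sorted_list_of_set (snd q - fst q))) @
     map Inl (sorted_list_of_set ({..<n} - (fst q \<union> snd q)))"

definition coform :: "nat set \<times> nat set \<Rightarrow> 'v list \<Rightarrow> complex" where
  "coform q = det_form n (\<lambda>j. cobas (index_list q ! j))"

lemma cobas_bas: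
  assumes "k \<in> {..<n} <+> {..<n}" "l \<in> {..<n} <+> {..<n}"
  shows "cobas k (bas l) = (if k = l then 1 else 0)"
  using assms by (auto simp: cobas_def bas_def fe ef ee ff split: if_splits)

lemma index_list_props:
  assumes "I \<subseteq> {..<n}" "J \<subseteq> {..<n}" "card I = card J"
  shows "distinct (index_list (I, J))" "set (index_list (I, J)) = Inl ` ({..<n} - I) \<union> Inr ` J"
    "length (index_list (I, J)) = n"
proof -
  have fin: "finite I" "finite J" using assms by (auto intro: finite_subset)
  have dc: "distinct (concat (map (\<lambda>p. [Inl p, Inr p]) xs :: ('x + 'x) list list))" if "distinct xs" for xs :: "'x list"
    using that by (induct xs) auto
  have sc: "set (concat (map (\<lambda>p. [Inl p, Inr p]) xs)) = Inl ` set xs \<union> Inr ` set xs" for xs :: "'x list"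
    by (induct xs) auto
  show d: "distinct (index_list (I, J))"
    unfolding index_list_def distinct_append sc set_append
    using fin by (auto simp: distinct_map intro!: dc)
  show s: "set (index_list (I, J)) = Inl ` ({..<n} - I) \<union> Inr ` J"
    unfolding index_list_def set_append sc using fin assms(1,2) by auto
  have "card (Inl ` ({..<n} - I) \<union> Inr ` J :: (nat + nat) set) = (n - card I) + card J"
    using fin assms(1) by (subst card_Un_disjoint) (auto simp: card_image card_Diff_subset)
  moreover have "card I \<le> n" using card_mono[OF _ assms(1)] by simp
  ultimately show "length (index_list (I, J)) = n" using distinct_card[OF d] s assms(3) by simp
qed

lemma altform_coform: "altform n (coform q)"
  unfolding coform_def by (intro altform_det_form) (auto simp: cobas_def B_laws split: sum.splits)

lemma coform_index_list:
  assumes "I \<subseteq> {..<n}" "J \<subseteq> {..<n}" "card I = card J"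
  shows "wedge smul n (map bas (index_list (I, J))) (coform (I, J)) = 1"
proof -
  note p = index_list_props[OF assms]
  have mem: "index_list (I, J) ! i \<in> {..<n} <+> {..<n}" if "i < n" for i
    using nth_mem[of i "index_list (I, J)"] p that assms by auto
  have "coform (I, J) (map bas (index_list (I, J))) = 1"
    unfolding coform_def
    by (rule det_form_dual) (use p mem in \<open>simp add: cobas_bas nth_eq_iff_index_eq eq_commute\<close>)
  then show ?thesis by (simp add: wedge_def altform_coform)
qed

text \<open>Distinct index sets of equal size leave some covector for \<open>(I', J')\<close>
  without a partner in the list for \<open>(I, J)\<close>, and this gives a zero column.\<close>

lemma coform_other:
  assumes "I \<subseteq> {..<n}" "J \<subseteq> {..<n}" "card I = card J" and "I' \<subseteq> {..<n}" "J' \<subseteq> {..<n}" "card I' = card J'"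
    and ne: "(I, J) \<noteq> (I', J')"
  shows "wedge smul n (map bas (index_list (I, J))) (coform (I', J')) = 0"
proof -
  note p = index_list_props[OF assms(1-3)] and p' = index_list_props[OF assms(4-6)]
  have mem: "index_list (I, J) ! i \<in> {..<n} <+> {..<n}" "index_list (I', J') ! i \<in> {..<n} <+> {..<n}" if "i < n" for i
    using nth_mem[of i "index_list (I, J)"] nth_mem[of i "index_list (I', J')"] p p' that assms by auto
  have "set (index_list (I', J')) \<noteq> set (index_list (I, J))"
  proof
    assume eq: "set (index_list (I', J')) = set (index_list (I, J))"
    have "Inl -` set (index_list (I, J)) = {..<n} - I" "Inl -` set (index_list (I', J')) = {..<n} - I'"
      "Inr -` set (index_list (I, J)) = J" "Inr -` set (index_list (I', J')) = J'"
      unfolding p(2) p'(2) by auto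
    then have "{..<n} - I = {..<n} - I'" "J = J'" using eq by auto
    then show False using ne assms(1,4) by (metis double_diff order_refl)
  qed
  moreover have "card (set (index_list (I', J'))) = card (set (index_list (I, J)))"
    by (simp only: distinct_card[OF p(1)] distinct_card[OF p'(1)] p(3) p'(3))
  ultimately have "\<not> set (index_list (I', J')) \<subseteq> set (index_list (I, J))"
    by (metis List.finite_set card_subset_eq)
  then obtain j where j: "j < n" "index_list (I', J') ! j \<notin> set (index_list (I, J))"
    using p'(3) by (metis in_set_conv_nth subsetI)
  have "coform (I', J') (map bas (index_list (I, J))) = 0"
    unfolding coform_def
  proof (rule det_form_zero_column[OF j(1)])
    fix i assume i: "i < n"
    then have "index_list (I', J') ! j \<noteq> index_list (I, J) ! i" using j(2) p(3) nth_mem by metis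
    then show "cobas (index_list (I', J') ! j) (map bas (index_list (I, J)) ! i) = 0"
      using mem(2)[OF j(1)] mem(1)[OF i] i p(3) by (simp add: cobas_bas)
  qed
  then show ?thesis by (simp add: wedge_def altform_coform)
qed

lemma basis_list_index_list:
  "map bas (index_list (I, J)) =
     basis_list (sorted_list_of_set (I \<inter> J)) (J - I) (sorted_list_of_set ({..<n} - (I \<union> J)))"
proof -
  have "map bas (concat (map (\<lambda>p. [Inl p, Inr p]) xs)) = ef_list xs" for xs
    by (induct xs) (auto simp: bas_def)
  then show ?thesis by (simp add: index_list_def basis_list_def bas_def)
qed

text \<open>The vector on which a form takes the combination in \<open>key\<close>, or the value in
  \<open>key_diagonal\<close> when the two sets agree.\<close>

definition span_vec :: "nat set \<times> nat set \<Rightarrow> ('v list \<Rightarrow> complex) \<Rightarrow> complex" where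
  "span_vec q = (if fst q = snd q then wedge smul n (map bas (index_list q))
     else wedge smul n (map bas (index_list q)) +
       fscale ((-1) ^ card (fst q \<inter> snd q)) (wedge smul n (map bas (index_list (snd q, fst q)))))"

text \<open>A functional vanishing on the chart is an alternating form vanishing on all graphs. It
  kills this vector by \<open>key\<close> or \<open>key_diagonal\<close>, so no functional separates
  the vector from the span.\<close>

lemma span_vec_in_chart_span:
  assumes q: "q \<in> dom_pairs n k"
  shows "span_vec q \<in> chart_span"
proof (rule ccontr)
  assume "span_vec q \<notin> chart_span"
  then obtain h where h: "Vector_Spaces.linear fscale (*) h" "\<And>y. y \<in> chart_span \<Longrightarrow> h y = 0" "h (span_vec q) = 1"
    using separating_functional[of chart_span "span_vec q"] unfolding chart_span_def by (metis cfun.subspace_span)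
  interpret h: Vector_Spaces.linear fscale "(*)" h by (rule h)
  define \<omega> where "\<omega> vs = h (wedge smul n vs)" for vs
  have \<omega>: "altform n \<omega>" unfolding \<omega>_def[abs_def] by (rule altform_functional_wedge[OF h(1)])
  have van: "\<omega> (graph_list A) = 0" if A: "skew A" for A
  proof -
    obtain z where "graph_list A = graph_list (skew_mat n z)" using skew_eq_skew_mat[OF A] by metis
    then show ?thesis unfolding \<omega>_def
      by (intro h(2)) (auto simp: chart_span_def phi_def[symmetric] intro: cfun.span_base)
  qed
  obtain I J where IJ: "q = (I, J)" by fastforce
  have sub: "I \<subseteq> {..<n}" "J \<subseteq> {..<n}" "card I = k" "card J = k"
    and ord: "set_encode I < set_encode J \<or> I = J \<and> even k"
    using q by (auto simp: dom_pairs_def IJ)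
  have fin: "finite I" "finite J" using sub by (auto intro: finite_subset)
  have "h (span_vec q) = 0"
  proof (cases "I = J")
    case True
    have ev: "even k" using ord True by auto
    have "\<omega> (map f (sorted_list_of_set I) @ map e (sorted_list_of_set ({..<n} - I))) = 0"
      by (rule key_diagonal[OF \<omega> van]) (use sub fin ev in auto)
    then show ?thesis using True unfolding IJ span_vec_def basis_list_index_list
      by (simp add: \<omega>_def basis_list_def)
  next
    case False
    have cD: "card (I - J) = card (J - I)"
      using sub fin by (metis card_Diff_subset_Int finite_Int inf_commute)
    have "J - I \<noteq> {}"
    proof
      assume "J - I = {}"
      then have "J \<subseteq> I" by blast
      then show False using False sub fin by (metis card_subset_eq)
    qed
    then obtain d where d: "card (J - I) = Suc d" using fin by (metis card_0_eq finite_Diff not0_implies_Suc)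
    have eqD: "(I - J \<union> (J - I)) - (J - I) = I - J" by auto
    have "\<omega> (basis_list (sorted_list_of_set (I \<inter> J)) (J - I) (sorted_list_of_set ({..<n} - (I \<union> J)))) +
       (-1) ^ length (sorted_list_of_set (I \<inter> J)) *
       \<omega> (basis_list (sorted_list_of_set (I \<inter> J)) ((I - J \<union> (J - I)) - (J - I)) (sorted_list_of_set ({..<n} - (I \<union> J)))) = 0"
    proof (rule key[OF \<omega> van])
      show "card (I - J \<union> (J - I)) = 2 * Suc d"
        using cD d fin by (subst card_Un_disjoint) auto
    qed (use d fin sub in auto)
    then show ?thesis using False unfolding IJ span_vec_def eqD
      by (simp add: basis_list_index_list h.add h.scale \<omega>_def Int_commute Un_commute)
  qed
  then show False using h(3) by simp
qed

text \<open>The coordinate \<open>coform q\<close> is nonzero on \<open>span_vec q\<close> and zero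
  on the other vectors: at most one order of each pair is admissible, so the swapped summand of a
  vector never meets a chosen coordinate.\<close>

lemma card_dom_pairs_le_dim:
  assumes "finite K"
  shows "card (\<Union>k\<in>K. dom_pairs n k) \<le> cfun.dim chart_span"
proof -
  define S where "S = (\<Union>k\<in>K. dom_pairs n k)"
  have finS: "finite S" using assms by (simp add: S_def)
  have sub: "fst q \<subseteq> {..<n}" "snd q \<subseteq> {..<n}" "card (fst q) = card (snd q)"
    and ord: "set_encode (fst q) < set_encode (snd q) \<or> fst q = snd q" if "q \<in> S" for q
    using that by (auto simp: S_def dom_pairs_def)
  have off: "span_vec q (coform q') = 0" if q: "q \<in> S" "q' \<in> S" "q \<noteq> q'" for q q'
  proof -
    have 1: "wedge smul n (map bas (index_list q)) (coform q') = 0"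
      using coform_other[OF sub[OF q(1)] sub[OF q(2)]] q(3) by simp
    have "wedge smul n (map bas (index_list (snd q, fst q))) (coform q') = 0" if "fst q \<noteq> snd q"
    proof -
      have "(snd q, fst q) \<noteq> (fst q', snd q')"
        using ord[OF q(1)] ord[OF q(2)] that by auto
      then show ?thesis
        using coform_other[OF sub(2,1)[OF q(1)] sub(3)[OF q(1), symmetric] sub[OF q(2)]] by simp
    qed
    then show ?thesis using 1 by (simp add: span_vec_def fscale_def)
  qed
  have on: "span_vec q (coform q) \<noteq> 0" if q: "q \<in> S" for q
  proof -
    have 1: "wedge smul n (map bas (index_list q)) (coform q) = 1"
      using coform_index_list[OF sub[OF q]] by simp
    have "wedge smul n (map bas (index_list (snd q, fst q))) (coform q) = 0" if "fst q \<noteq> snd q"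
    proof -
      have "(snd q, fst q) \<noteq> (fst q, snd q)" using that by (metis Pair_inject)
      from coform_other[OF sub(2,1)[OF q] sub(3)[OF q, symmetric] sub[OF q] this] show ?thesis by simp
    qed
    then show ?thesis using 1 by (simp add: span_vec_def fscale_def)
  qed
  note ind = independent_if_dual[of S span_vec coform, OF finS off on]
  have "card (span_vec ` S) \<le> cfun.dim chart_span"
  proof (rule card_le_dim_fun[of "eta ` pinjs n"])
    show "chart_span \<subseteq> cfun.span (eta ` pinjs n)"
    proof -
      have "osc_span sdim 0 phi \<union> eta ` {\<tau> \<in> pinjs n. 0 < card (dom \<tau>)} \<subseteq> cfun.span (eta ` pinjs n)"
        using osc_span_phi_upper[of 0] cfun.span_mono[of "eta ` {\<tau> \<in> pinjs n. card (dom \<tau>) \<le> 0}" "eta ` pinjs n"]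
          cfun.span_superset[of "eta ` pinjs n"] by blast
      then show ?thesis using chart_span_subset[of 0] cfun.span_minimal[OF _ cfun.subspace_span] by blast
    qed
    show "span_vec ` S \<subseteq> chart_span" using span_vec_in_chart_span by (auto simp: S_def)
  qed (use finite_pinjs ind in auto)
  then show ?thesis using ind(1) by (simp add: card_image S_def)
qed

text \<open>The terms of degree above \<open>s\<close> add at most \<open>card hi\<close> dimensions
  to the osculating span. As the whole chart span has at least \<open>card lo + card hi\<close>, the
  osculating span has to supply \<open>card lo\<close>.\<close>

lemma dim_osc_span_phi: "cfun.dim (osc_span sdim s phi) = (\<Sum>k\<le>s. card (dom_pairs n k))"
proof -
  define c where "c = (\<lambda>q. eta (canonical q))"
  define lo where "lo = (\<Union>k\<in>{..s}. dom_pairs n k)"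
  define hi where "hi = (\<Union>k\<in>{s<..n}. dom_pairs n k)"
  have fin: "finite lo" "finite hi" by (auto simp: lo_def hi_def)
  have card_lo: "card lo = (\<Sum>k\<le>s. card (dom_pairs n k))"
    unfolding lo_def by (rule card_UN_disjoint) (auto dest: dom_pairs_disjoint[THEN equalityD1, THEN subsetD, OF _ IntI])
  have upper: "osc_span sdim s phi \<subseteq> cfun.span (c ` lo)"
  proof -
    have "eta \<tau> \<in> cfun.span (c ` lo)" if "\<tau> \<in> pinjs n" "card (dom \<tau>) \<le> s" for \<tau>
    proof -
      have "dom_pairs n (card (dom \<tau>)) \<subseteq> lo"
        unfolding lo_def using that by (intro UN_upper) auto
      then have "c ` dom_pairs n (card (dom \<tau>)) \<subseteq> c ` lo" by (rule image_mono)
      then show ?thesis using eta_canonical[OF that(1)] cfun.span_mono unfolding c_def by blast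
    qed
    then have "eta ` {\<tau> \<in> pinjs n. card (dom \<tau>) \<le> s} \<subseteq> cfun.span (c ` lo)" by auto
    then show ?thesis using osc_span_phi_upper[of s] cfun.span_minimal[OF _ cfun.subspace_span] by blast
  qed
  have high: "eta \<tau> \<in> cfun.span (c ` hi)" if "\<tau> \<in> pinjs n" "s < card (dom \<tau>)" for \<tau>
  proof -
    have "card (dom \<tau>) \<le> n" using that(1) card_mono[of "{..<n}" "dom \<tau>"] by (auto simp: pinjs_def)
    then have "dom_pairs n (card (dom \<tau>)) \<subseteq> hi"
      unfolding hi_def using that by (intro UN_upper) auto
    then have "c ` dom_pairs n (card (dom \<tau>)) \<subseteq> c ` hi" by (rule image_mono)
    then show ?thesis using eta_canonical[OF that(1)] cfun.span_mono unfolding c_def by blast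
  qed
  have "chart_span \<subseteq> cfun.span (osc_span sdim s phi \<union> c ` hi)"
  proof -
    have "osc_span sdim s phi \<union> eta ` {\<tau> \<in> pinjs n. s < card (dom \<tau>)} \<subseteq> cfun.span (osc_span sdim s phi \<union> c ` hi)"
      using high cfun.span_mono[of "c ` hi" "osc_span sdim s phi \<union> c ` hi"]
        cfun.span_superset[of "osc_span sdim s phi \<union> c ` hi"] by blast
    then show ?thesis using chart_span_subset[of s] cfun.span_minimal[OF _ cfun.subspace_span] by blast
  qed
  then have "cfun.dim chart_span \<le> cfun.dim (osc_span sdim s phi) + card (c ` hi)"
    using fin by (intro dim_le_dim_plus_card[OF _ upper]) auto
  also have "\<dots> \<le> cfun.dim (osc_span sdim s phi) + card hi" using fin card_image_le by simp
  finally have "card (lo \<union> hi) \<le> cfun.dim (osc_span sdim s phi) + card hi"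
    using card_dom_pairs_le_dim[of "{..s} \<union> {s<..n}"] by (simp add: lo_def hi_def UN_Un)
  moreover have "card (lo \<union> hi) = card lo + card hi"
    using fin by (rule card_Un_disjoint) (auto simp: lo_def hi_def dom_pairs_def)
  ultimately have "card lo \<le> cfun.dim (osc_span sdim s phi)" by simp
  moreover have "cfun.dim (osc_span sdim s phi) \<le> card lo"
    using cfun.dim_le_card[OF upper] fin card_image_le[of lo c] by (meson finite_imageI le_trans)
  ultimately show ?thesis using card_lo by simp
qed

text \<open>Above this order there are no admissible pairs, so every remaining
  \<open>eta \<tau>\<close> lies in the span of the empty set.\<close>

lemma osc_span_phi_full:
  assumes s: "s \<ge> 2 * (n div 2)"
  shows "osc_span sdim s phi = chart_span"
proof
  show "osc_span sdim s phi \<subseteq> chart_span" by (rule osc_span_subset_chart_span)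
  have "eta \<tau> = 0" if "\<tau> \<in> pinjs n" "s < card (dom \<tau>)" for \<tau>
    using eta_canonical[OF that(1)] dom_pairs_empty[of n "card (dom \<tau>)"] s that(2) by simp
  then have "osc_span sdim s phi \<union> eta ` {\<tau> \<in> pinjs n. s < card (dom \<tau>)} \<subseteq> osc_span sdim s phi"
    using cfun.subspace_0[OF osc_span_subspace] by auto
  then have "cfun.span (osc_span sdim s phi \<union> eta ` {\<tau> \<in> pinjs n. s < card (dom \<tau>)}) \<subseteq> osc_span sdim s phi"
    by (rule cfun.span_minimal) simp
  then show "chart_span \<subseteq> osc_span sdim s phi" using chart_span_subset[of s] by blast
qed

end

section \<open>The topology of projective space\<close>

lemma line_in_proj_space:
  assumes "cfun.subspace L"
  shows "line x \<in> proj_space L \<longleftrightarrow> x \<in> L \<and> x \<noteq> 0"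
proof
  assume "line x \<in> proj_space L"
  then obtain y where y: "y \<in> L" "y \<noteq> 0" "line x = line y" by (auto simp: proj_space_def)
  have "x \<in> line y" using y(3) cfun.span_base[of x "{x}"] by simp
  then have "x \<in> L" using cfun.span_minimal[of "{y}" L] assms y(1) by blast
  moreover have "x \<noteq> 0"
  proof
    assume "x = 0"
    moreover have "y \<in> line x" using y(3) cfun.span_base[of y "{y}"] by simp
    ultimately show False using y(2) by (simp add: cfun.span_singleton)
  qed
  ultimately show "x \<in> L \<and> x \<noteq> 0" by simp
qed (auto simp: proj_space_def)

lemma topspace_proj_topology: "topspace (proj_topology E) = proj_space E"
proof
  show "topspace (proj_topology E) \<subseteq> proj_space E"
    using openin_topspace[of "proj_topology E"] unfolding openin_proj_topology by blast
  have "{x \<in> E - {0}. line x \<in> proj_space E} = E - {0}" by (auto simp: proj_space_def)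
  then have "openin (proj_topology E) (proj_space E)"
    unfolding openin_proj_topology by simp
  then show "proj_space E \<subseteq> topspace (proj_topology E)" by (rule openin_subset)
qed

lemma Union_proj_space:
  assumes "cfun.subspace L" "x \<in> L" "x \<noteq> 0"
  shows "\<Union> (proj_space L) = L"
proof
  show "\<Union> (proj_space L) \<subseteq> L"
  proof
    fix y assume "y \<in> \<Union> (proj_space L)"
    then obtain z where z: "z \<in> L" "y \<in> line z" unfolding proj_space_def by blast
    have "line z \<subseteq> L" using z(1) assms(1) by (intro cfun.span_minimal) auto
    then show "y \<in> L" using z(2) by blast
  qed
  show "L \<subseteq> \<Union> (proj_space L)"
  proof
    fix y assume y: "y \<in> L"
    show "y \<in> \<Union> (proj_space L)"
    proof (cases "y = 0")
      case True
      then show ?thesis using assms(2,3) cfun.span_zero by (auto simp: proj_space_def)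
    next
      case False
      then show ?thesis using y cfun.span_base[of y "{y}"] by (auto simp: proj_space_def)
    qed
  qed
qed

lemma continuous_map_line: "continuous_map (top_of_set (E - {0})) (proj_topology E) line"
  unfolding continuous_map_def
  by (auto simp: topspace_proj_topology openin_proj_topology proj_space_def)

text \<open>Stability under nonzero scaling makes the part of \<open>G\<close> in \<open>E\<close> a
  union of punctured lines, so it is the full preimage of its image.\<close>

lemma openin_proj_topologyI:
  assumes "cfun.subspace E" "open G" "0 \<notin> G"
    and "\<And>x c. x \<in> E \<Longrightarrow> c \<noteq> 0 \<Longrightarrow> x \<in> G \<Longrightarrow> fscale c x \<in> G"
  shows "openin (proj_topology E) {q \<in> proj_space E. q \<inter> G \<noteq> {}}"
proof -
  have "{x \<in> E - {0}. line x \<in> {q \<in> proj_space E. q \<inter> G \<noteq> {}}} = (E - {0}) \<inter> G"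
  proof (intro equalityI subsetI)
    fix x assume "x \<in> {x \<in> E - {0}. line x \<in> {q \<in> proj_space E. q \<inter> G \<noteq> {}}}"
    then obtain c where x: "x \<in> E" "x \<noteq> 0" and c: "fscale c x \<in> G" by (auto simp: cfun.span_singleton)
    have c0: "c \<noteq> 0" using c assms(3) by auto
    have "fscale (1 / c) (fscale c x) \<in> G"
      by (rule assms(4)) (use x c c0 assms(1) in \<open>auto intro: cfun.subspace_scale\<close>)
    then show "x \<in> (E - {0}) \<inter> G" using x c0 by simp
  next
    fix x assume "x \<in> (E - {0}) \<inter> G"
    then show "x \<in> {x \<in> E - {0}. line x \<in> {q \<in> proj_space E. q \<inter> G \<noteq> {}}}"
      using cfun.span_base[of x "{x}"] by (auto simp: proj_space_def)
  qed
  then show ?thesis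
    using assms(2) unfolding openin_proj_topology by (auto intro: openin_open_Int)
qed

text \<open>A point at infinity \<open>d\<close> of the affine space is the limit of \<open>\<phi> + d / \<epsilon>\<close>, which spans the same line
  as \<open>\<epsilon> \<phi> + d\<close>.\<close>

lemma closure_of_line_affine:
  fixes E :: "('a \<Rightarrow> complex) set"
  assumes E: "cfun.subspace E" and D: "cfun.subspace D" and sub: "v \<in> E" "D \<subseteq> E"
    and cl: "closed (cfun.span (insert v D))"
  shows "proj_topology E closure_of (line ` (\<lambda>d. v + d) ` D) = proj_space (cfun.span (insert v D))"
proof -
  define L where "L = cfun.span (insert v D)"
  have L: "cfun.subspace L" by (simp add: L_def)
  have LE: "L \<subseteq> E" unfolding L_def using E sub by (intro cfun.span_minimal) auto
  have vL: "v + d \<in> L" if "d \<in> D" for d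
    unfolding L_def using that by (intro cfun.span_add cfun.span_base) auto
  have spanD: "cfun.span D = D" using D by simp
  have closed: "closedin (proj_topology E) (proj_space L)"
    unfolding closedin_def topspace_proj_topology
  proof
    show "proj_space L \<subseteq> proj_space E" using LE by (auto simp: proj_space_def)
    have "{x \<in> E - {0}. line x \<in> proj_space E - proj_space L} = (E - {0}) \<inter> - L"
      using line_in_proj_space[OF L] line_in_proj_space[OF E] by auto
    moreover have "open (- L)" using cl by (simp add: L_def open_Compl)
    ultimately show "openin (proj_topology E) (proj_space E - proj_space L)"
      unfolding openin_proj_topology by (auto intro: openin_open_Int)
  qed
  show ?thesis
    unfolding L_def[symmetric]
  proof
    have "proj_topology E closure_of (line ` (\<lambda>d. v + d) ` D) =
        proj_topology E closure_of (proj_space E \<inter> line ` (\<lambda>d. v + d) ` D)"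
      using closure_of_restrict[of "proj_topology E" "line ` (\<lambda>d. v + d) ` D"] by (simp add: topspace_proj_topology)
    also have "\<dots> \<subseteq> proj_space L"
    proof (rule closure_of_minimal[OF _ closed])
      show "proj_space E \<inter> line ` (\<lambda>d. v + d) ` D \<subseteq> proj_space L"
        using line_in_proj_space[OF L] line_in_proj_space[OF E] vL by auto
    qed
    finally show "proj_topology E closure_of (line ` (\<lambda>d. v + d) ` D) \<subseteq> proj_space L" .
    show "proj_space L \<subseteq> proj_topology E closure_of (line ` (\<lambda>d. v + d) ` D)"
    proof
      fix q assume "q \<in> proj_space L"
      then obtain x where x: "x \<in> L" "x \<noteq> 0" "q = line x" by (auto simp: proj_space_def)
      obtain c where "x - fscale c v \<in> D" using x(1) unfolding L_def cfun.span_insert spanD by auto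
      then obtain d where d: "d \<in> D" "x = fscale c v + d" by (metis add.commute diff_add_cancel)
      show "q \<in> proj_topology E closure_of (line ` (\<lambda>d. v + d) ` D)"
        unfolding in_closure_of topspace_proj_topology
      proof (intro conjI allI impI)
        show "q \<in> proj_space E" using x LE by (auto simp: proj_space_def)
        fix T assume T: "q \<in> T \<and> openin (proj_topology E) T"
        then obtain O' where O: "open O'" "{x \<in> E - {0}. line x \<in> T} = (E - {0}) \<inter> O'"
          unfolding openin_proj_topology openin_open by blast
        define g where "g t = fscale (c + t) v + d" for t
        have gc: "continuous_on UNIV g"
          unfolding g_def fscale_def plus_fun_def
          by (intro continuous_on_coordinatewise_then_product continuous_intros)
        have g0: "g 0 = x" by (simp add: g_def d)
        have xO: "x \<in> O'" using O(2) x T LE by auto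
        have "closed {0 :: 'a \<Rightarrow> complex}" using closed_span_finite[of "{}"] by simp
        then have "open (O' - {0})" by (rule open_Diff[OF O(1)])
        then have "open (g -` (O' - {0}))" using gc by (intro open_vimage)
        moreover have "0 \<in> g -` (O' - {0})" using g0 xO x(2) by simp
        ultimately obtain r where r: "r > 0" "ball 0 r \<subseteq> g -` (O' - {0})" by (meson open_contains_ball)
        \<comment> \<open>For a point at infinity, where \<open>c = 0\<close>, a small nonzero
          \<open>t\<close> moves the vector into the affine chart; otherwise \<open>t = 0\<close>
          will do.\<close>
        obtain t where t: "t \<in> ball 0 r" "c + t \<noteq> (0::complex)"
        proof (cases "c = 0")
          case True
          have "complex_of_real (r/2) \<in> ball 0 r" using r by simp
          then show thesis using True r by (intro that[of "complex_of_real (r/2)"]) auto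
        next
          case False
          then show thesis using r by (intro that[of 0]) auto
        qed
        have gO: "g t \<in> O'" "g t \<noteq> 0" using r t(1) by auto
        have gE: "g t \<in> E" unfolding g_def using E sub d(1) by (intro cfun.subspace_add cfun.subspace_scale) auto
        have lT: "line (g t) \<in> T" using gO gE O(2) by auto
        define y where "y = v + fscale (1 / (c + t)) d"
        have gy: "g t = fscale (c + t) y" unfolding g_def y_def using t(2) by (simp add: cfun.scale_right_distrib)
        then have "line (g t) = line y"
          using gO(2) by (intro line_eqI) (auto intro: cfun.span_scale cfun.span_base)
        moreover have "y \<in> (\<lambda>d. v + d) ` D" unfolding y_def using D d(1) by (auto intro: cfun.subspace_scale)
        ultimately show "\<exists>y. y \<in> line ` (\<lambda>d. v + d) ` D \<and> y \<in> T" using lT by (metis imageI)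
      qed
    qed
  qed
qed

lemma connected_complex_coord_space: "connected (complex_coord_space m)"
proof -
  have c: "connected_component (complex_coord_space m) 0 z" if z: "z \<in> complex_coord_space m" for z
  proof -
    define g where "g t = (\<lambda>i. complex_of_real t * z i)" for t
    have "continuous_on UNIV g"
      unfolding g_def by (intro continuous_on_coordinatewise_then_product continuous_intros)
    then have "connected (range g)" by (rule connected_continuous_image) simp
    moreover have "range g \<subseteq> complex_coord_space m" using z by (auto simp: g_def complex_coord_space_def)
    moreover have "0 \<in> range g" by (rule range_eqI[of _ _ 0]) (simp add: g_def fun_eq_iff)
    moreover have "z \<in> range g" by (rule range_eqI[of _ _ 1]) (simp add: g_def)
    ultimately show ?thesis unfolding connected_component_def by blast
  qed
  show ?thesis
    unfolding connected_iff_connected_component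
    using c connected_component_sym connected_component_trans by blast
qed

text \<open>Passing to the cone adjoins the base point \<open>\<phi> 0\<close> to the directions,
  which restores the derivative of order 0.\<close>

lemma affine_osculating_closure:
  assumes E: "cfun.subspace E" and \<phi>0: "\<phi> 0 \<in> E" and sub: "osc_span m s \<phi> \<subseteq> E"
  shows "proj_topology E closure_of (line ` affine_osculating m s \<phi>) = proj_space (osc_span m s \<phi>)"
proof -
  define A where "A = {partials is \<phi> 0 | is. set is \<subseteq> {..<m} \<and> 1 \<le> length is \<and> length is \<le> s}"
  have "insert (\<phi> 0) A = (\<lambda>js. partials js \<phi> 0) ` lists_upto m s"
  proof (intro equalityI subsetI)
    fix x assume "x \<in> insert (\<phi> 0) A"
    then show "x \<in> (\<lambda>js. partials js \<phi> 0) ` lists_upto m s"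
    proof
      assume "x = \<phi> 0"
      then show ?thesis by (intro image_eqI[of _ _ "[]"]) (auto simp: lists_upto_def)
    qed (auto simp: A_def lists_upto_def)
  next
    fix x assume "x \<in> (\<lambda>js. partials js \<phi> 0) ` lists_upto m s"
    then obtain js where js: "set js \<subseteq> {..<m}" "length js \<le> s" "x = partials js \<phi> 0" by (auto simp: lists_upto_def)
    then show "x \<in> insert (\<phi> 0) A" by (cases "js = []") (auto simp: A_def Suc_le_eq)
  qed
  then have osc: "cfun.span (insert (\<phi> 0) A) = osc_span m s \<phi>" by (simp add: osc_span_def)
  have "cfun.span (insert (\<phi> 0) (cfun.span A)) = cfun.span (insert (\<phi> 0) A)"
  proof
    have "insert (\<phi> 0) (cfun.span A) \<subseteq> cfun.span (insert (\<phi> 0) A)"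
      using cfun.span_mono[of A "insert (\<phi> 0) A"] cfun.span_base[of "\<phi> 0" "insert (\<phi> 0) A"] by auto
    then show "cfun.span (insert (\<phi> 0) (cfun.span A)) \<subseteq> cfun.span (insert (\<phi> 0) A)"
      by (rule cfun.span_minimal) simp
    show "cfun.span (insert (\<phi> 0) A) \<subseteq> cfun.span (insert (\<phi> 0) (cfun.span A))"
      using cfun.span_superset[of A] by (intro cfun.span_mono) auto
  qed
  then have span: "cfun.span (insert (\<phi> 0) (cfun.span A)) = osc_span m s \<phi>" using osc by simp
  have "proj_topology E closure_of (line ` (\<lambda>d. \<phi> 0 + d) ` cfun.span A) = proj_space (cfun.span (insert (\<phi> 0) (cfun.span A)))"
  proof (rule closure_of_line_affine[OF E cfun.subspace_span \<phi>0])
    show "cfun.span A \<subseteq> E"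
      using cfun.span_mono[of A "insert (\<phi> 0) A"] osc sub by blast
    show "closed (cfun.span (insert (\<phi> 0) (cfun.span A)))"
      unfolding span osc_span_def by (intro closed_span_finite) simp
  qed
  then show ?thesis unfolding span by (simp add: affine_osculating_def A_def)
qed

section \<open>Restriction of polynomial maps to lines\<close>

lemma mono_eval_along_line: "\<exists>p. \<forall>t. mono_eval M (\<lambda>i. a i + t * b i) = poly p t"
proof (induct M)
  case empty
  show ?case by (rule exI[of _ 1]) simp
next
  case (add l M)
  then obtain p where "\<forall>t. mono_eval M (\<lambda>i. a i + t * b i) = poly p t" by blast
  then have "\<forall>t. mono_eval (add_mset l M) (\<lambda>i. a i + t * b i) = poly ([:a l, b l:] * p) t"
    by (simp add: algebra_simps)
  then show ?case by blast
qed

lemma poly_map_along_line: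
  assumes "finite K"
  shows "\<exists>p. \<forall>t. (\<Sum>\<tau>\<in>K. mono_eval (M \<tau>) (\<lambda>i. a i + t * b i) * c \<tau>) = poly p t"
  using assms
proof (induct K)
  case empty
  show ?case by (rule exI[of _ 0]) simp
next
  case (insert \<tau> K)
  then obtain p where "\<forall>t. (\<Sum>\<tau>\<in>K. mono_eval (M \<tau>) (\<lambda>i. a i + t * b i) * c \<tau>) = poly p t" by blast
  moreover obtain q where "\<forall>t. mono_eval (M \<tau>) (\<lambda>i. a i + t * b i) = poly q t"
    using mono_eval_along_line by blast
  ultimately have "\<forall>t. (\<Sum>\<tau>\<in>insert \<tau> K. mono_eval (M \<tau>) (\<lambda>i. a i + t * b i) * c \<tau>) = poly ([:c \<tau>:] * q + p) t"
    using insert by (simp add: mult.commute)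
  then show ?case by blast
qed

section \<open>Charts of the spinor variety\<close>

context polarized
begin

abbreviation Ext :: "(('v list \<Rightarrow> complex) \<Rightarrow> complex) set" where
  "Ext \<equiv> exterior_power smul n UNIV"

abbreviation iso_points :: "(('v list \<Rightarrow> complex) \<Rightarrow> complex) set set" where
  "iso_points \<equiv> pluecker smul n ` isotropic_subspaces smul Q n"

definition chart :: "(('v list \<Rightarrow> complex) \<Rightarrow> complex) set set" where
  "chart = (\<lambda>z. line (phi z)) ` complex_coord_space sdim"

lemma subspace_Ext: "cfun.subspace Ext"
  by (simp add: exterior_power_def)

lemma phi_in_Ext: "phi z \<in> Ext"
  unfolding phi_def exterior_power_def by (intro cfun.span_base) auto

lemma phi_chart_form [simp]: "phi z chart_form = 1"
  by (simp add: phi_def)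

lemma phi_nonzero: "phi z \<noteq> 0"
  unfolding phi_def by (rule graph_nonzero)

lemma line_phi_in_iso_points: "line (phi z) \<in> iso_points"
  using graph_isotropic[OF skew_skew_mat, of z] pluecker_graph[of "skew_mat n z"]
  unfolding phi_def by (metis imageI)

lemma chart_span_subset_Ext: "chart_span \<subseteq> Ext"
  unfolding chart_span_def using phi_in_Ext subspace_Ext by (intro cfun.span_minimal) auto

text \<open>A neighbour of \<open>chart_form\<close> among the Pluecker coordinates: one covector is
  exchanged in order to read off a single matrix entry.\<close>

definition coord_form :: "nat \<times> nat \<Rightarrow> 'v list \<Rightarrow> complex" where
  "coord_form q = det_form n (\<lambda>k. if k = fst q then B (e (snd q)) else B (f k))"

lemma altform_coord_form: "altform n (coord_form q)"
  unfolding coord_form_def by (intro altform_det_form) (simp add: B_laws)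

text \<open>The matrix is the identity outside column \<open>i\<close>. A permutation other than the
  identity sends some row to a different column that is not \<open>i\<close>, where the entry is
  0.\<close>

lemma coord_form_graph:
  assumes ij: "i < n" "j < n"
  shows "wedge smul n (graph_list A) (coord_form (i, j)) = A i j"
proof -
  define \<xi> where "\<xi> k = (if k = i then B (e j) else B (f k))" for k
  have \<xi>: "\<xi> k (graph_list A ! r) = (if k = i then A r j else if k = r then 1 else 0)" if "k < n" "r < n" for k r
    using that ij by (simp add: \<xi>_def graph_list_def B_graph_vec)
  have "coord_form (i, j) (graph_list A) = (\<Sum>p | p permutes {0..<n}. signof p * (\<Prod>r = 0..<n. \<xi> (p r) (graph_list A ! r)))"
    unfolding coord_form_def det_form_leibniz by (simp only: \<xi>_def fst_conv snd_conv)
  also have "\<dots> = (\<Sum>p\<in>{id}. signof p * (\<Prod>r = 0..<n. \<xi> (p r) (graph_list A ! r)))"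
  proof (rule sum.mono_neutral_right)
    show "finite {p. p permutes {0..<n}}" by (simp add: finite_permutations)
    show "{id} \<subseteq> {p. p permutes {0..<n}}" by (simp add: permutes_id)
    show "\<forall>p\<in>{p. p permutes {0..<n}} - {id}. signof p * (\<Prod>r = 0..<n. \<xi> (p r) (graph_list A ! r)) = 0"
    proof
      fix p assume p: "p \<in> {p. p permutes {0..<n}} - {id}"
      then have pp: "p permutes {0..<n}" by simp
      have pn: "p r < n" if "r < n" for r using permutes_in_image[OF pp, of r] that by simp
      have "\<exists>r<n. p r \<noteq> i \<and> p r \<noteq> r"
      proof (rule ccontr)
        assume "\<not> (\<exists>r<n. p r \<noteq> i \<and> p r \<noteq> r)"
        then have no: "\<And>r. r < n \<Longrightarrow> p r = i \<or> p r = r" by blast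
        have pi: "p i = i" using no[OF ij(1)] by blast
        have "p r = r" for r
        proof (cases "r < n")
          case True
          have "p r = i \<Longrightarrow> r = i" using pi permutes_inj[OF pp] by (metis injD)
          then show ?thesis using no[OF True] pi by blast
        next
          case False
          then show ?thesis using permutes_not_in[OF pp, of r] by simp
        qed
        then have "p = id" by auto
        with p show False by simp
      qed
      then obtain r where "r < n" "p r \<noteq> i" "p r \<noteq> r" by blast
      then have "\<xi> (p r) (graph_list A ! r) = 0" using \<xi>[of "p r" r] pn by simp
      then have "(\<Prod>r = 0..<n. \<xi> (p r) (graph_list A ! r)) = 0"
        using \<open>r < n\<close> by (intro prod_zero bexI[of _ r]) auto
      then show "signof p * (\<Prod>r = 0..<n. \<xi> (p r) (graph_list A ! r)) = 0" by simp
    qed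
  qed
  also have "\<dots> = (\<Prod>r = 0..<n. \<xi> r (graph_list A ! r))" by (simp add: sign_id)
  also have "\<dots> = (\<Prod>r = 0..<n. if r = i then A i j else 1)"
    by (intro prod.cong refl) (simp add: \<xi>)
  also have "\<dots> = A i j" using ij by (subst prod.delta) auto
  finally show ?thesis by (simp add: wedge_def altform_coord_form)
qed

definition pair_of :: "nat \<Rightarrow> nat \<times> nat" where
  "pair_of = the_inv_into (pairs n) (pair_index n)"

lemma phi_coord:
  assumes "l < sdim"
  shows "phi z (coord_form (pair_of l)) = z l"
proof -
  have l: "l \<in> pair_index n ` pairs n" using bij_pair_index[of n] assms by (auto simp: bij_betw_def)
  have inj: "inj_on (pair_index n) (pairs n)" using bij_pair_index[of n] by (auto simp: bij_betw_def)
  have "pair_of l \<in> pairs n" unfolding pair_of_def by (rule the_inv_into_into[OF inj l order_refl])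
  moreover have "pair_index n (pair_of l) = l" unfolding pair_of_def by (rule f_the_inv_into_f[OF inj l])
  moreover obtain i j where "pair_of l = (i, j)" by fastforce
  ultimately have "i < j" "j < n" "pair_of l = (i, j)" "pair_index n (i, j) = l" by (auto simp: pairs_def)
  then show ?thesis unfolding phi_def by (simp add: coord_form_graph skew_mat_def)
qed

text \<open>Quotients of Pluecker coordinates are invariant under scaling, hence defined on lines;
  they invert the chart and are holomorphic along any other parametrization where the denominator is
  nonzero.\<close>

definition crd :: "(('v list \<Rightarrow> complex) \<Rightarrow> complex) \<Rightarrow> nat \<Rightarrow> complex" where
  "crd x l = (if l < sdim then x (coord_form (pair_of l)) / x chart_form else 0)"

lemma crd_phi:
  assumes "z \<in> complex_coord_space sdim" "c \<noteq> 0"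
  shows "crd (fscale c (phi z)) = z"
proof
  fix l show "crd (fscale c (phi z)) l = z l"
    using assms by (auto simp: crd_def fscale_def phi_coord complex_coord_space_def)
qed

lemma crd_in_coord_space: "crd x \<in> complex_coord_space sdim"
  by (simp add: crd_def complex_coord_space_def)

lemma continuous_on_crd: "continuous_on {x. x chart_form \<noteq> 0} crd"
proof (rule continuous_on_coordinatewise_then_product)
  fix l
  show "continuous_on {x. x chart_form \<noteq> 0} (\<lambda>x. crd x l)"
  proof (cases "l < sdim")
    case True
    have "continuous_on {x. x chart_form \<noteq> 0} (\<lambda>x :: ('v list \<Rightarrow> complex) \<Rightarrow> complex. x (coord_form (pair_of l)) / x chart_form)"
      by (intro continuous_on_divide continuous_on_subset[OF continuous_on_product_coordinates]) auto
    then show ?thesis using True by (simp add: crd_def)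
  qed (simp add: crd_def)
qed

lemma open_chart_form: "open {x :: ('v list \<Rightarrow> complex) \<Rightarrow> complex. x chart_form \<noteq> 0}"
  by (intro open_Collect_neq continuous_on_product_coordinates continuous_on_const)

text \<open>Graphs have chart coordinate 1, and the converse is the normal form of
  \<open>chart_form_nonzero_imp_graph\<close>. As the complement of a hyperplane section the chart
  is open.\<close>

lemma chart_char:
  assumes n: "n \<ge> 1"
  shows "chart = {q \<in> iso_points. \<exists>x\<in>q. x chart_form \<noteq> 0}"
proof (intro equalityI subsetI)
  fix q assume "q \<in> chart"
  then obtain z where q: "q = line (phi z)" by (auto simp: chart_def)
  have "phi z \<in> q" unfolding q by (intro cfun.span_base) simp
  then show "q \<in> {q \<in> iso_points. \<exists>x\<in>q. x chart_form \<noteq> 0}"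
    using line_phi_in_iso_points[of z] q by (auto intro!: bexI[of _ "phi z"])
next
  fix q assume "q \<in> {q \<in> iso_points. \<exists>x\<in>q. x chart_form \<noteq> 0}"
  then obtain W x where W: "W \<in> isotropic_subspaces smul Q n" "q = pluecker smul n W" "x \<in> q" "x chart_form \<noteq> 0"
    by blast
  obtain A where A: "skew A" "q = line (wedge smul n (graph_list A))"
    using chart_form_nonzero_imp_graph[OF n W(1), of x] W by metis
  obtain z where z: "z \<in> complex_coord_space sdim" "graph_list A = graph_list (skew_mat n z)"
    using skew_eq_skew_mat[OF A(1)] by blast
  have "q = line (phi z)" using A(2) z(2) by (simp add: phi_def)
  then show "q \<in> chart" unfolding chart_def using z(1) by blast
qed

lemma openin_chart:
  assumes n: "n \<ge> 1"
  shows "openin (subtopology (proj_topology Ext) iso_points) chart"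
proof -
  let ?G = "{x :: ('v list \<Rightarrow> complex) \<Rightarrow> complex. x chart_form \<noteq> 0}"
  have "openin (proj_topology Ext) {q \<in> proj_space Ext. q \<inter> ?G \<noteq> {}}"
    by (rule openin_proj_topologyI[OF subspace_Ext open_chart_form]) (auto simp: fscale_def)
  moreover have "chart \<subseteq> proj_space Ext"
    using phi_in_Ext phi_nonzero by (auto simp: chart_def proj_space_def)
  then have "chart = {q \<in> proj_space Ext. q \<inter> ?G \<noteq> {}} \<inter> iso_points"
    using chart_char[OF n] by auto
  ultimately show ?thesis unfolding openin_subtopology by blast
qed

lemma continuous_on_phi: "continuous_on U phi"
proof (rule continuous_on_coordinatewise_then_product)
  fix a
  have "sep_holomorphic sdim U (\<lambda>z. phi z a)"
    unfolding phi_poly_map by (rule poly_map_sep_holomorphic[OF finite_loopfree edges_props(2)])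
  then show "continuous_on U (\<lambda>z. phi z a)" by (simp add: sep_holomorphic_def)
qed

lemma continuous_map_line_phi:
  "continuous_map (top_of_set (complex_coord_space sdim)) (proj_topology Ext) (\<lambda>z. line (phi z))"
proof -
  have "continuous_map (top_of_set (complex_coord_space sdim)) (top_of_set (Ext - {0})) phi"
    using continuous_on_phi phi_in_Ext phi_nonzero
    by (auto simp: continuous_map_in_subtopology continuous_map_iff_continuous)
  from continuous_map_compose[OF this continuous_map_line] show ?thesis by (simp add: comp_def)
qed

lemma connectedin_chart: "connectedin (subtopology (proj_topology Ext) iso_points) chart"
proof -
  have "connectedin (top_of_set (complex_coord_space sdim)) (complex_coord_space sdim)"
    by (simp add: connectedin_subtopology connected_complex_coord_space connectedin_iff_connected)
  from connectedin_continuous_map_image[OF continuous_map_line_phi this]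
  have "connectedin (proj_topology Ext) chart" by (simp add: chart_def)
  then show ?thesis
    unfolding connectedin_subtopology using line_phi_in_iso_points by (auto simp: chart_def)
qed

text \<open>The zero matrix gives back the span of \<open>e\<close>, so that together with
  \<open>exists_polarization\<close> every isotropic subspace becomes the origin of some
  chart.\<close>

lemma line_phi_0: "line (phi 0) = pluecker smul n (span (e ` {..<n}))"
proof -
  have "graph_vec (skew_mat n 0) i = e i" for i
    by (rule graph_vec_0) (simp add: skew_mat_def)
  then have "graph_list (skew_mat n 0) = map e [0..<n]" by (simp add: graph_list_def)
  then show ?thesis
    using exterior_power_eq_line[of "map e [0..<n]" n]
    by (simp add: phi_def pluecker_def lessThan_atLeast0)
qed

lemma line_phi_0_in_chart: "line (phi 0) \<in> chart"
  unfolding chart_def by (rule imageI) (simp add: complex_coord_space_def)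

text \<open>The forms \<open>coord_form (pair_of l)\<close> read off the coordinates of
  \<open>z\<close>, so at every point they are dual to the partial derivatives.\<close>

lemma independent_partials_phi:
  "cfun.dim ((\<lambda>i. partial i phi z) ` {..<sdim}) = sdim"
proof -
  have d: "partial i phi z (coord_form (pair_of l)) = (if i = l then 1 else 0)" if "l < sdim" for i l
  proof -
    have "(\<lambda>t. phi (z(i := t)) (coord_form (pair_of l))) = (\<lambda>t. if i = l then t else z l)"
      using phi_coord[OF that] by auto
    then show ?thesis by (simp add: partial_def)
  qed
  have "inj_on (\<lambda>i. partial i phi z) {..<sdim}" "cfun.independent ((\<lambda>i. partial i phi z) ` {..<sdim})"
    by (rule independent_if_dual[of "{..<sdim}" _ "\<lambda>l. coord_form (pair_of l)"]; simp add: d)+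
  then show ?thesis by (simp add: cfun.dim_eq_card_independent card_image)
qed

lemma homeomorphic_map_phi:
  "homeomorphic_map (top_of_set (complex_coord_space sdim)) (subtopology (proj_topology Ext) chart) (\<lambda>z. line (phi z))"
proof -
  \<comment> \<open>Any nonzero vector of the line serves, because \<open>crd\<close> does not
    change under scaling.\<close>
  define g where "g q = crd (SOME x. x \<in> q \<and> x \<noteq> 0)" for q
  have g: "g (line (phi z)) = z" if z: "z \<in> complex_coord_space sdim" for z
  proof -
    have "phi z \<in> line (phi z)" by (intro cfun.span_base) simp
    then have "(SOME x. x \<in> line (phi z) \<and> x \<noteq> 0) \<in> line (phi z) \<and> (SOME x. x \<in> line (phi z) \<and> x \<noteq> 0) \<noteq> 0"
      using phi_nonzero by (intro someI_ex[of "\<lambda>x. x \<in> line (phi z) \<and> x \<noteq> 0"]) blast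
    then obtain c where "(SOME x. x \<in> line (phi z) \<and> x \<noteq> 0) = fscale c (phi z)" "c \<noteq> 0"
      by (auto simp: cfun.span_singleton)
    then show ?thesis unfolding g_def using crd_phi[OF z] by simp
  qed
  have "homeomorphic_maps (top_of_set (complex_coord_space sdim)) (subtopology (proj_topology Ext) chart) (\<lambda>z. line (phi z)) g"
    unfolding homeomorphic_maps_def
  proof (intro conjI ballI)
    show "continuous_map (top_of_set (complex_coord_space sdim)) (subtopology (proj_topology Ext) chart) (\<lambda>z. line (phi z))"
      using continuous_map_line_phi by (auto simp: continuous_map_in_subtopology chart_def)
    show "continuous_map (subtopology (proj_topology Ext) chart) (top_of_set (complex_coord_space sdim)) g"
      unfolding continuous_map_def
    proof (intro conjI allI impI)
      show "g \<in> topspace (subtopology (proj_topology Ext) chart) \<rightarrow> topspace (top_of_set (complex_coord_space sdim))"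
        unfolding g_def topspace_euclidean_subtopology using crd_in_coord_space by blast
      fix U assume "openin (top_of_set (complex_coord_space sdim)) U"
      then obtain O' where O: "open O'" "U = complex_coord_space sdim \<inter> O'" by (auto simp: openin_open)
      \<comment> \<open>The condition on a line is lifted to an open set of vectors, which is stable
        under scaling since \<open>crd\<close> is invariant.\<close>
      define G where "G = {x. x chart_form \<noteq> 0} \<inter> crd -` O'"
      have "open G" unfolding G_def
        by (rule continuous_open_preimage[OF continuous_on_crd open_chart_form O(1)])
      have "openin (proj_topology Ext) {q \<in> proj_space Ext. q \<inter> G \<noteq> {}}"
      proof (rule openin_proj_topologyI[OF subspace_Ext \<open>open G\<close>])
        show "0 \<notin> G" by (simp add: G_def)
        fix x :: "('v list \<Rightarrow> complex) \<Rightarrow> complex" and c :: complex assume "c \<noteq> 0" "x \<in> G"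
        moreover have "crd (fscale c x) = crd x" using \<open>c \<noteq> 0\<close> by (auto simp: crd_def fscale_def)
        ultimately show "fscale c x \<in> G" by (simp add: G_def) (simp add: fscale_def)
      qed
      moreover have "{q \<in> topspace (subtopology (proj_topology Ext) chart). g q \<in> U} = {q \<in> proj_space Ext. q \<inter> G \<noteq> {}} \<inter> chart"
      proof (intro equalityI subsetI)
        fix q assume "q \<in> {q \<in> topspace (subtopology (proj_topology Ext) chart). g q \<in> U}"
        then obtain z where z: "z \<in> complex_coord_space sdim" "q = line (phi z)" and q: "q \<in> proj_space Ext" "g q \<in> U" "q \<in> chart"
          by (auto simp: chart_def topspace_proj_topology)
        have "phi z \<in> q" unfolding z(2) by (intro cfun.span_base) simp
        moreover have "phi z \<in> G" using q(2) z g[OF z(1)] O(2) crd_phi[OF z(1), of 1] by (simp add: G_def)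
        ultimately show "q \<in> {q \<in> proj_space Ext. q \<inter> G \<noteq> {}} \<inter> chart" using q by auto
      next
        fix q assume q: "q \<in> {q \<in> proj_space Ext. q \<inter> G \<noteq> {}} \<inter> chart"
        then obtain z where z: "z \<in> complex_coord_space sdim" "q = line (phi z)" by (auto simp: chart_def)
        obtain x where x: "x \<in> q" "x \<in> G" using q by auto
        then obtain c where c: "x = fscale c (phi z)" using z(2) by (auto simp: cfun.span_singleton)
        then have "c \<noteq> 0" using x(2) by (auto simp: G_def)
        then have "z \<in> O'" using x(2) crd_phi[OF z(1)] c by (simp add: G_def)
        then have "g q \<in> U" using z g[OF z(1)] O(2) by simp
        then show "q \<in> {q \<in> topspace (subtopology (proj_topology Ext) chart). g q \<in> U}"
          using q by (auto simp: topspace_proj_topology)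
      qed
      ultimately show "openin (subtopology (proj_topology Ext) chart) {q \<in> topspace (subtopology (proj_topology Ext) chart). g q \<in> U}"
        unfolding openin_subtopology by blast
    qed
    fix z assume "z \<in> topspace (top_of_set (complex_coord_space sdim))"
    then show "g (line (phi z)) = z" using g by simp
  next
    fix q assume "q \<in> topspace (subtopology (proj_topology Ext) chart)"
    then obtain z where "z \<in> complex_coord_space sdim" "q = line (phi z)" by (auto simp: chart_def)
    then show "line (phi (g q)) = q" using g by simp
  qed
  then show ?thesis unfolding homeomorphic_map_maps by blast
qed

section \<open>Comparison with arbitrary parametrizations\<close>

lemma local_parametrization_phi:
  assumes n: "n \<ge> 1" and S: "S \<subseteq> iso_points" "chart \<subseteq> S"
  shows "local_parametrization Ext sdim S (line (phi 0)) (\<lambda>x. x chart_form) (complex_coord_space sdim) phi"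
  unfolding local_parametrization_def chart_def[symmetric]
proof (intro conjI ballI)
  show "Vector_Spaces.linear fscale (*) (\<lambda>x :: ('v list \<Rightarrow> complex) \<Rightarrow> complex. x chart_form)"
    unfolding Vector_Spaces.linear_iff
    using cfun.vector_space_axioms vector_space_over_itself.vector_space_axioms by (auto simp: fscale_def)
  show "0 \<in> complex_coord_space sdim" by (simp add: complex_coord_space_def)
  show "holomorphic_map sdim (complex_coord_space sdim) phi"
    unfolding holomorphic_map_iff phi_poly_map
    by (intro allI poly_map_sep_holomorphic[OF finite_loopfree edges_props(2)])
  show "openin (subtopology (proj_topology Ext) S) chart"
  proof -
    obtain T where T: "openin (proj_topology Ext) T" "chart = T \<inter> iso_points"
      using openin_chart[OF n] unfolding openin_subtopology by blast
    then have "chart = T \<inter> S" using S by blast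
    then show ?thesis using T(1) unfolding openin_subtopology by blast
  qed
  show "openin (top_of_set (complex_coord_space sdim)) (complex_coord_space sdim)" by simp
  show "homeomorphic_map (top_of_set (complex_coord_space sdim)) (subtopology (proj_topology Ext) chart) (\<lambda>z. line (phi z))"
    by (rule homeomorphic_map_phi)
  show "cfun.dim ((\<lambda>i. partial i phi z) ` {..<sdim}) = sdim" for z by (rule independent_partials_phi)
  show "phi z \<in> Ext" "phi z chart_form = 1" for z by (rule phi_in_Ext, rule phi_chart_form)
qed (rule refl)

lemma osc_span_local_parametrization:
  assumes n: "n \<ge> 1" and S: "S \<subseteq> iso_points"
    and loc: "local_parametrization Ext sdim S (line (phi 0)) h U \<phi>"
  shows "osc_span sdim s \<phi> = osc_span sdim s phi" and "\<phi> 0 \<in> Ext"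
proof -
  have h: "Vector_Spaces.linear fscale (*) h" and U: "coord_open sdim U" and U0: "0 \<in> U"
    and \<phi>: "\<And>z. z \<in> U \<Longrightarrow> \<phi> z \<in> Ext \<and> h (\<phi> z) = 1" and hol: "holomorphic_map sdim U \<phi>"
    and imm: "\<And>z. z \<in> U \<Longrightarrow> cfun.dim ((\<lambda>i. partial i \<phi> z) ` {..<sdim}) = sdim"
    and p: "line (\<phi> 0) = line (phi 0)"
    and opn: "openin (subtopology (proj_topology Ext) S) ((\<lambda>z. line (\<phi> z)) ` U)"
    using loc unfolding local_parametrization_def by blast+
  interpret h: Vector_Spaces.linear fscale "(*)" h by (rule h)
  show "\<phi> 0 \<in> Ext" using \<phi> U0 by blast
  have sep: "sep_holomorphic sdim U (\<lambda>z. \<phi> z a)" for a using hol by (simp add: holomorphic_map_iff)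
  have inS: "line (\<phi> z) \<in> S" if "z \<in> U" for z
    using openin_subset[OF opn] that by auto
  have nz: "\<phi> z \<noteq> 0" if "z \<in> U" for z using \<phi>[OF that] h.zero by auto
  \<comment> \<open>On \<open>U'\<close> the points lie in the chart, so \<open>\<phi>\<close>
    factors through \<open>phi\<close> there. It contains 0 because \<open>\<phi> 0\<close> is a
    nonzero multiple of \<open>phi 0\<close>.\<close>
  define U' where "U' = U \<inter> (\<lambda>z. \<phi> z chart_form) -` (- {0})"
  have "openin (top_of_set U) U'"
    unfolding U'_def using sep[of chart_form]
    by (intro continuous_openin_preimage_gen) (auto simp: sep_holomorphic_def)
  then have U': "coord_open sdim U'" using U by (rule openin_trans)
  have sub: "U' \<subseteq> U" by (simp add: U'_def)
  have rep: "crd (\<phi> z) \<in> complex_coord_space sdim \<and> \<phi> z = fscale (\<phi> z chart_form) (phi (crd (\<phi> z)))"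
    if z: "z \<in> U'" for z
  proof -
    have c0: "\<phi> z chart_form \<noteq> 0" using z by (simp add: U'_def)
    have mem: "\<phi> z \<in> line (\<phi> z)" by (intro cfun.span_base) simp
    have "line (\<phi> z) \<in> iso_points" using inS z sub S by blast
    then have "line (\<phi> z) \<in> chart" unfolding chart_char[OF n] using c0 mem by blast
    then obtain w where w: "w \<in> complex_coord_space sdim" "line (\<phi> z) = line (phi w)" by (auto simp: chart_def)
    then obtain c where c: "\<phi> z = fscale c (phi w)" using mem by (auto simp: cfun.span_singleton)
    then have "\<phi> z chart_form = c" by (simp add: fscale_def)
    moreover have "crd (\<phi> z) = w" using c c0 crd_phi[OF w(1), of c] \<open>\<phi> z chart_form = c\<close> by simp
    ultimately show ?thesis using c w by simp
  qed
  have p0: "\<phi> 0 \<in> line (phi 0)" using p cfun.span_base[of "\<phi> 0" "{\<phi> 0}"] by simp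
  then obtain c where c: "\<phi> 0 = fscale c (phi 0)" by (auto simp: cfun.span_singleton)
  then have c0: "c \<noteq> 0" using nz[OF U0] by auto
  have zU': "0 \<in> U'" using U0 c c0 by (simp add: U'_def fscale_def)
  define \<mu> where "\<mu> z = \<phi> z chart_form" for z
  define \<psi> where "\<psi> z = crd (\<phi> z)" for z
  have \<mu>: "sep_holomorphic sdim U' \<mu>"
    unfolding \<mu>_def[abs_def] by (rule sep_holomorphic_subset[OF sep sub])
  have \<psi>: "sep_holomorphic sdim U' (\<lambda>z. \<psi> z l)" if "l < sdim" for l
  proof -
    have "sep_holomorphic sdim U' (\<lambda>z. \<phi> z (coord_form (pair_of l)) / \<phi> z chart_form)"
      by (intro sep_holomorphic_divide sep_holomorphic_subset[OF sep sub]) (simp add: U'_def)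
    then show ?thesis using that by (simp add: \<psi>_def crd_def)
  qed
  have eq: "\<phi> z a = \<mu> z * phi (\<psi> z) a" if "z \<in> U'" for z a
    using rep[OF that] unfolding \<mu>_def \<psi>_def by (metis fscale_def)
  have \<mu>0: "\<mu> 0 \<noteq> 0" using zU' by (simp add: \<mu>_def U'_def)
  have "0 \<in> complex_coord_space sdim" by (simp add: complex_coord_space_def)
  then have \<psi>0: "\<psi> 0 = 0" unfolding \<psi>_def c using crd_phi c0 by blast
  have h1: "h (\<phi> z) = 1" if "z \<in> U'" for z using \<phi> that sub by blast
  obtain N where N: "\<And>r l. r < sdim \<Longrightarrow> l < sdim \<Longrightarrow> (\<Sum>i<sdim. N r i * pd i (\<lambda>z. \<psi> z l) 0) = (if r = l then 1 else 0)"
    using reparam_jacobian[OF finite_loopfree edges_props(2) phi_poly_map U' zU' \<mu> \<psi> eq \<mu>0 h h1 imm[OF U0]] by blast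
  show "osc_span sdim s \<phi> = osc_span sdim s phi"
    by (rule osc_span_reparam[OF finite_loopfree edges_props(2) phi_poly_map U' zU' \<mu> \<psi> eq \<mu>0 \<psi>0 N])
qed

lemma osculating_space_eq:
  assumes n: "n \<ge> 1" and S: "S \<subseteq> iso_points" "chart \<subseteq> S"
  shows "osculating_space Ext sdim S (line (phi 0)) s = proj_space (osc_span sdim s phi)"
proof -
  have cl: "proj_topology Ext closure_of (line ` affine_osculating sdim s \<phi>) = proj_space (osc_span sdim s phi)"
    if "local_parametrization Ext sdim S (line (phi 0)) h U \<phi>" for h U \<phi>
  proof -
    note o = osc_span_local_parametrization[OF n S(1) that]
    have "osc_span sdim s \<phi> \<subseteq> Ext"
      unfolding o(1) using osc_span_subset_chart_span chart_span_subset_Ext by blast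
    from affine_osculating_closure[OF subspace_Ext o(2) this] show ?thesis by (simp only: o(1))
  qed
  show ?thesis
    unfolding osculating_space_def
  proof (rule the_equality)
    show "\<exists>h U \<phi>. local_parametrization Ext sdim S (line (phi 0)) h U \<phi> \<and>
        proj_space (osc_span sdim s phi) = proj_topology Ext closure_of (line ` affine_osculating sdim s \<phi>)"
      using local_parametrization_phi[OF n S] cl by metis
  qed (use cl in metis)
qed

text \<open>A functional killing the second span kills \<open>phi z\<close> wherever the second
  chart coordinate is nonzero. On the line from a common point \<open>z0\<close> to a point
  \<open>z1\<close> where the functional is nonzero, two nonzero polynomials in one variable would
  have product zero.\<close>

lemma chart_span_subset_if_meet:
  assumes n: "n \<ge> 1" and P': "polarized smul Q n e' f'"
    and q: "q \<in> chart" "q \<in> polarized.chart smul n e' f'"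
  shows "chart_span \<subseteq> polarized.chart_span smul n e' f'"
proof (rule ccontr)
  interpret P': polarized smul Q n e' f' by (rule P')
  assume "\<not> chart_span \<subseteq> P'.chart_span"
  then obtain x where x: "x \<in> chart_span" "x \<notin> P'.chart_span" by blast
  have sub: "cfun.subspace P'.chart_span" by (simp add: P'.chart_span_def)
  obtain h where h: "Vector_Spaces.linear fscale (*) h" "\<And>y. y \<in> P'.chart_span \<Longrightarrow> h y = 0" "h x = 1"
    using separating_functional[OF sub x(2)] by blast
  interpret h: Vector_Spaces.linear fscale "(*)" h by (rule h)
  obtain z1 where z1: "h (phi z1) \<noteq> 0"
  proof (rule ccontr)
    assume "\<not> thesis"
    then have "\<And>y. y \<in> range phi \<Longrightarrow> h y = 0" using that by blast
    then have "h x = 0" using h.eq_0_on_span[of "range phi" x] x(1) by (simp add: chart_span_def)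
    with h(3) show False by simp
  qed
  have form: "h (phi z) = 0" if "phi z P'.chart_form \<noteq> 0" for z
  proof -
    have mem: "phi z \<in> line (phi z)" by (intro cfun.span_base) simp
    have "line (phi z) \<in> P'.chart"
      unfolding P'.chart_char[OF n] using line_phi_in_iso_points[of z] mem that by blast
    then obtain w where "line (phi z) = line (P'.phi w)" by (auto simp: P'.chart_def)
    moreover have "P'.phi w \<in> P'.chart_span" unfolding P'.chart_span_def by (intro cfun.span_base) simp
    then have "line (P'.phi w) \<subseteq> P'.chart_span" using sub by (intro cfun.span_minimal) auto
    ultimately show ?thesis using mem h(2) by blast
  qed
  obtain z0 where z0: "q = line (phi z0)" using q(1) by (auto simp: chart_def)
  obtain y where y: "y \<in> q" "y P'.chart_form \<noteq> 0" using q(2) unfolding P'.chart_char[OF n] by blast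
  then obtain c where "y = fscale c (phi z0)" unfolding z0 by (auto simp: cfun.span_singleton)
  then have nz0: "phi z0 P'.chart_form \<noteq> 0" using y(2) by (auto simp: fscale_def)
  define z where "z t = (\<lambda>i. z0 i + t * (z1 i - z0 i))" for t :: complex
  have vec: "phi w = (\<Sum>\<tau>\<in>loopfree. fscale (mono_eval (edges \<tau>) w) (chart_coeff \<tau>))" for w
    by (intro ext) (simp add: phi_poly_map poly_map_def fun_sum_apply fscale_def)
  obtain a where a: "\<And>t. h (phi (z t)) = poly a t"
    using poly_map_along_line[OF finite_loopfree, of edges z0 "\<lambda>i. z1 i - z0 i" "\<lambda>\<tau>. h (chart_coeff \<tau>)"]
    by (auto simp: vec h.sum h.scale z_def)
  obtain b where b: "\<And>t. phi (z t) P'.chart_form = poly b t"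
    using poly_map_along_line[OF finite_loopfree, of edges z0 "\<lambda>i. z1 i - z0 i" "\<lambda>\<tau>. chart_coeff \<tau> P'.chart_form"]
    by (auto simp: phi_poly_map poly_map_def z_def)
  have "poly (a * b) t = 0" for t
    using form[of "z t"] a[of t] b[of t] by auto
  then have "a * b = 0" using poly_all_0_iff_0 by blast
  then consider "a = 0" | "b = 0" by auto
  then show False
  proof cases
    case 1
    have "z 1 = z1" by (simp add: z_def)
    then show False using 1 a[of 1] z1 by simp
  next
    case 2
    have "z 0 = z0" by (simp add: z_def)
    then show False using 2 b[of 0] nz0 by simp
  qed
qed

lemma chart_span_eq_if_meet:
  assumes n: "n \<ge> 1" and P': "polarized smul Q n e' f'"
    and q: "q \<in> chart" "q \<in> polarized.chart smul n e' f'"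
  shows "chart_span = polarized.chart_span smul n e' f'"
  using chart_span_subset_if_meet[OF assms]
    polarized.chart_span_subset_if_meet[OF P' n polarized_axioms q(2,1)] by blast

text \<open>The spans of the charts are locally constant, hence constant on a connected component.\<close>

lemma component_facts:
  assumes n: "n \<ge> 1" and dim: "dim (UNIV :: 'v set) = 2 * n" and nd: "nondegenerate Q"
    and S: "S \<in> connected_components_of (subtopology (proj_topology Ext) iso_points)"
    and p: "line (phi 0) \<in> S"
  shows "S \<subseteq> iso_points" "chart \<subseteq> S" "cfun.span (\<Union> S) = chart_span"
proof -
  let ?X = "subtopology (proj_topology Ext) iso_points"
  have conn: "connectedin ?X S" using S by (rule connectedin_connected_components_of)
  then show sub: "S \<subseteq> iso_points" using connectedin_subset_topspace by fastforce
  show chartS: "chart \<subseteq> S"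
    by (rule connected_components_of_maximal[OF S connectedin_chart])
       (use p line_phi_0_in_chart in \<open>auto simp: disjnt_def\<close>)
  \<comment> \<open>Charts with different spans do not meet, so the two properties \<open>P\<close>
    used below give disjoint open sets covering \<open>S\<close>.\<close>
  define charts where "charts P = \<Union> {polarized.chart smul n e' f' | e' f'. polarized smul Q n e' f' \<and>
     P (polarized.chart_span smul n e' f')}" for P :: "_ \<Rightarrow> bool"
  have opn: "openin ?X (charts P)" for P
    unfolding charts_def using polarized.openin_chart[OF _ n] by (intro openin_Union) blast
  have cover: "S \<subseteq> charts (\<lambda>L. L = chart_span) \<union> charts (\<lambda>L. L \<noteq> chart_span)"
  proof
    fix q assume "q \<in> S"
    then obtain W where W: "W \<in> isotropic_subspaces smul Q n" "q = pluecker smul n W" using sub by blast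
    obtain e' f' where P': "polarized smul Q n e' f'" and W': "W = span (e' ` {..<n})"
      using exists_polarization[OF n dim Q nd W(1)] by blast
    interpret P': polarized smul Q n e' f' by (rule P')
    have "q \<in> P'.chart" using P'.line_phi_0 P'.line_phi_0_in_chart W(2) W' by simp
    then show "q \<in> charts (\<lambda>L. L = chart_span) \<union> charts (\<lambda>L. L \<noteq> chart_span)"
      unfolding charts_def using P' by blast
  qed
  have disj: "charts (\<lambda>L. L = chart_span) \<inter> charts (\<lambda>L. L \<noteq> chart_span) = {}"
    unfolding charts_def using polarized.chart_span_eq_if_meet[OF _ n] by blast
  have pc: "line (phi 0) \<in> charts (\<lambda>L. L = chart_span)"
    unfolding charts_def using line_phi_0_in_chart polarized_axioms by blast
  have "charts (\<lambda>L. L \<noteq> chart_span) \<inter> S = {}"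
    using connectedinD[OF conn opn opn cover] disj pc p by blast
  then have S': "S \<subseteq> charts (\<lambda>L. L = chart_span)" using cover by blast
  show "cfun.span (\<Union> S) = chart_span"
  proof
    show "cfun.span (\<Union> S) \<subseteq> chart_span"
    proof (rule cfun.span_minimal)
      show "cfun.subspace chart_span" by (simp add: chart_span_def)
      show "\<Union> S \<subseteq> chart_span"
      proof
        fix x assume "x \<in> \<Union> S"
        then obtain q where q: "q \<in> S" "x \<in> q" by blast
        then obtain e' f' where P': "polarized smul Q n e' f'" "q \<in> polarized.chart smul n e' f'"
          "polarized.chart_span smul n e' f' = chart_span"
          using S' unfolding charts_def by blast
        interpret P': polarized smul Q n e' f' by (rule P')
        obtain w where w: "q = line (P'.phi w)" using P'(2) by (auto simp: P'.chart_def)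
        have "P'.phi w \<in> P'.chart_span" unfolding P'.chart_span_def by (intro cfun.span_base) simp
        then have "q \<subseteq> P'.chart_span" unfolding w by (intro cfun.span_minimal) (auto simp: P'.chart_span_def)
        then show "x \<in> chart_span" using q(2) P'(3) by blast
      qed
    qed
    show "chart_span \<subseteq> cfun.span (\<Union> S)"
      unfolding chart_span_def
    proof (intro cfun.span_minimal cfun.subspace_span subsetI)
      fix x assume "x \<in> range phi"
      then obtain z where z: "x = phi z" by blast
      \<comment> \<open>The definition of \<open>chart_span\<close> lets \<open>z\<close> range over
        all sequences, whereas the chart uses those supported on the first \<open>sdim\<close>
        coordinates; the other coordinates do not enter \<open>phi\<close>.\<close>
      obtain w where w: "w \<in> complex_coord_space sdim" "phi z = phi w"
        using skew_eq_skew_mat[OF skew_skew_mat, of z] unfolding phi_def by metis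
      have "line (phi w) \<in> S" using chartS w(1) by (auto simp: chart_def)
      moreover have "phi w \<in> line (phi w)" by (intro cfun.span_base) simp
      ultimately show "x \<in> cfun.span (\<Union> S)" unfolding z w(2) by (intro cfun.span_base) blast
    qed
  qed
qed

end

theorem corollary3p17:
  fixes smul :: "complex \<Rightarrow> 'v \<Rightarrow> 'v::ab_group_add"
    and Q :: "'v \<Rightarrow> complex"
    and n :: nat
    and S :: "(('v list \<Rightarrow> complex) \<Rightarrow> complex) set set"
    and p :: "(('v list \<Rightarrow> complex) \<Rightarrow> complex) set"
  assumes "vector_space smul"
    and "n \<ge> 1"
    and "vector_space.dim smul (UNIV :: 'v set) = 2 * n"
    and "quadratic_form smul Q"
    and "nondegenerate Q"
    and "spinor_variety smul Q n S"
    and "p \<in> S"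
  shows "(\<forall>s. 1 \<le> s \<and> s \<le> 2 * (n div 2) - 1 \<longrightarrow>
            real_of_int (proj_dim
              (osculating_space (exterior_power smul n UNIV) (n * (n - 1) div 2) S p s)) =
              1 / 2 * (\<Sum>k = 1..s. real (n choose k) * (real (n choose k) + 1))
              - (\<Sum>k = 1..nat \<lceil>real s / 2\<rceil>. real (n choose (2 * k - 1))))
       \<and> (\<forall>s. s \<ge> 2 * (n div 2) \<longrightarrow>
            osculating_space (exterior_power smul n UNIV) (n * (n - 1) div 2) S p s =
              linear_span S)"
proof -
  interpret complex_space smul
    using assms(1) by (simp add: complex_space_def)
  have comp: "S \<in> connected_components_of (subtopology (proj_topology (exterior_power smul n UNIV))
      (pluecker smul n ` isotropic_subspaces smul Q n))"
    using assms(6) by (simp add: spinor_variety_def)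
  have "S \<subseteq> pluecker smul n ` isotropic_subspaces smul Q n"
    using connectedin_subset_topspace[OF connectedin_connected_components_of[OF comp]] by fastforce
  then obtain W where W: "W \<in> isotropic_subspaces smul Q n" "p = pluecker smul n W" using assms(7) by blast
  obtain e f where P: "polarized smul Q n e f" and We: "W = span (e ` {..<n})"
    using exists_polarization[OF assms(2-5) W(1)] by blast
  interpret polarized smul Q n e f by (rule P)
  have p: "p = line (phi 0)" using line_phi_0 W(2) We by simp
  note facts = component_facts[OF assms(2,3,5) comp assms(7)[unfolded p]]
  have osc: "osculating_space (exterior_power smul n UNIV) (n * (n - 1) div 2) S p s = proj_space (osc_span sdim s phi)" for s
    unfolding p by (rule osculating_space_eq[OF assms(2) facts(1,2)])
  have dim: "proj_dim (proj_space (osc_span sdim s phi)) = int (\<Sum>k\<le>s. card (dom_pairs n k)) - 1" for s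
  proof -
    \<comment> \<open>The projective space of the zero space is empty and its union does not give
      back the zero space; the nonzero vector \<open>phi 0\<close> rules this case out.\<close>
    have "phi 0 \<in> osc_span sdim s phi"
      using osc_span_base[of "[]" sdim s phi] by simp
    then have "\<Union> (proj_space (osc_span sdim s phi)) = osc_span sdim s phi"
      by (rule Union_proj_space[OF osc_span_subspace _ phi_nonzero])
    then show ?thesis unfolding proj_dim_def by (simp only: dim_osc_span_phi)
  qed
  show ?thesis
  proof (intro conjI allI impI)
    fix s
    show "real_of_int (proj_dim (osculating_space (exterior_power smul n UNIV) (n * (n - 1) div 2) S p s)) =
        1 / 2 * (\<Sum>k = 1..s. real (n choose k) * (real (n choose k) + 1))
        - (\<Sum>k = 1..nat \<lceil>real s / 2\<rceil>. real (n choose (2 * k - 1)))"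
      unfolding osc dim using sum_card_dom_pairs[of n s] by simp
  next
    fix s assume s: "s \<ge> 2 * (n div 2)"
    show "osculating_space (exterior_power smul n UNIV) (n * (n - 1) div 2) S p s = linear_span S"
      unfolding osc linear_span_def facts(3) osc_span_phi_full[OF s] by (rule refl)
  qed
qed

end
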